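(* For $m\in\mathbb{N}$ let $K^m\subseteq\mathbb{R}^2$ be the (symmetric) radial set defined by $\rho_{K^m}(v)=\cos(2mv)^2$, $v\in[0,2\pi]$. Then for every $\delta\in(0,1)$ there exists $m\in\mathbb{N}$ such that $$\frac{\partial^2}{\partial t^2}|C_\delta\overline{K^m_t}|_2\bigg|_{t=0}>0 .$$
   Context: $|\cdot|_2$ denotes Lebesgue measure in the plane and $|\cdot|$ the Euclidean norm. Points of $S^1$ are identified with their angles $v\in[0,2\pi)$. A radial set in $\mathbb{R}^2$ is a set of the form $K=\{0\}\cup\{x\in\mathbb{R}^2\setminus\{0\}: |x|\le\rho_K(x/|x|)\}$ where $\rho_K:S^{1}\to[0,\infty)$ (the radial function) is continuous. A radial body is a radial set whose radial function is strictly positive. For a radial set $K$ and real $t$ near $0$ (so that $1+t\rho_K>0$), $K_t$ is the radial body with radial function $\rho_{K_t}(v)=1+t\rho_K(v)$, and $\overline{K_t}=K_t/|K_t|_2^{1/2}$; $\overline{K^m_t}$ denotes $\overline{(K^m)_t}$. For $\delta\in(0,1)$ and a radial body (or convex body) $L$, $C_\delta L=\{x\in\mathbb{R}^2: |L\cap(L+x)|_2\ge\delta|L|_2\}$. *)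

theory Defs
  imports "HOL-Analysis.Analysis"
begin

text \<open>The unit circle is \<^term>\<open>sphere (0 :: real^2) 1\<close>; values of a radial function
  outside of it are irrelevant.\<close>

definition radial_set_of :: "(real^2 \<Rightarrow> real) \<Rightarrow> (real^2) set" where
  "radial_set_of \<rho> = {0} \<union> {x. x \<noteq> 0 \<and> norm x \<le> \<rho> (x /\<^sub>R norm x)}"

definition radial_set :: "(real^2) set \<Rightarrow> bool" where
  "radial_set K \<longleftrightarrow>
     (\<exists>\<rho>. continuous_on (sphere 0 1) \<rho> \<and> (\<forall>u\<in>sphere 0 1. 0 \<le> \<rho> u) \<and> K = radial_set_of \<rho>)"

definition radial_body :: "(real^2) set \<Rightarrow> bool" where
  "radial_body K \<longleftrightarrow>
     (\<exists>\<rho>. continuous_on (sphere 0 1) \<rho> \<and> (\<forall>u\<in>sphere 0 1. 0 < \<rho> u) \<and> K = radial_set_of \<rho>)"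

text \<open>Recovers \<open>\<rho>\<close> from the radial set; see \<open>radial_function_radial_set_of\<close> below.\<close>

definition radial_function :: "(real^2) set \<Rightarrow> real^2 \<Rightarrow> real" where
  "radial_function K u = Sup {r. 0 \<le> r \<and> r *\<^sub>R u \<in> K}"

text \<open>This is \<open>K\<^sub>t\<close>; it is meaningful for real \<open>t\<close> near \<open>0\<close>, of either sign.\<close>

definition perturbed_disc :: "(real^2) set \<Rightarrow> real \<Rightarrow> (real^2) set" where
  "perturbed_disc K t = radial_set_of (\<lambda>u. 1 + t * radial_function K u)"

definition normalized :: "(real^2) set \<Rightarrow> (real^2) set" where
  "normalized L = (\<lambda>x. x /\<^sub>R sqrt (measure lebesgue L)) ` L"

definition conv_body :: "real \<Rightarrow> (real^2) set \<Rightarrow> (real^2) set" where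
  "conv_body \<delta> L =
     {x. measure lebesgue (L \<inter> (\<lambda>y. y + x) ` L) \<ge> \<delta> * measure lebesgue L}"

text \<open>The angle in \<open>[0, 2\<pi>)\<close> of a point of the unit circle.\<close>

definition angle :: "real^2 \<Rightarrow> real" where
  "angle u = Arg2pi (Complex (u $ 1) (u $ 2))"

definition K_cos :: "nat \<Rightarrow> (real^2) set" where
  "K_cos m = radial_set_of (\<lambda>u. (cos (2 * real m * angle u))\<^sup>2)"

lemma radial_function_radial_set_of:
  assumes u: "u \<in> sphere 0 1" and nn: "0 \<le> \<rho> u"
  shows "radial_function (radial_set_of \<rho>) u = \<rho> u"
proof -
  have nu: "norm u = 1" "u \<noteq> 0" using u by auto
  have "{r. 0 \<le> r \<and> r *\<^sub>R u \<in> radial_set_of \<rho>} = {0..\<rho> u}"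
    using nu nn by (auto simp: radial_set_of_def)
  then show ?thesis
    using nn by (simp add: radial_function_def)
qed

lemma angle_unit:
  assumes "0 \<le> v" "v < 2 * pi"
  shows "angle (vector [cos v, sin v]) = v"
proof -
  have "Complex (cos v) (sin v) = exp (\<i> * of_real v)"
    by (simp add: complex_eq_iff Re_exp Im_exp)
  then show ?thesis
    using assms Arg2pi_unique[of 1 v "Complex (cos v) (sin v)"] by (simp add: angle_def)
qed

lemma cos_angle:
  assumes "u \<in> sphere 0 1"
  shows "cos (real n * angle u) = Re (Complex (u $ 1) (u $ 2) ^ n)"
proof -
  let ?z = "Complex (u $ 1) (u $ 2)"
  have "norm ?z = 1"
    using assms by (simp add: cmod_def norm_vec_def L2_set_def sum_2)
  then have "?z = cis (angle u)"
    using Arg2pi_eq[of ?z] by (simp add: angle_def cis_conv_exp)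
  then have "?z ^ n = cis (real n * angle u)"
    by (simp add: Complex.DeMoivre)
  then show ?thesis by simp
qed

lemma rho_K_cos_eq:
  assumes "u \<in> sphere 0 1"
  shows "(cos (2 * real m * angle u))\<^sup>2 = (Re (Complex (u $ 1) (u $ 2) ^ (2 * m)))\<^sup>2"
  using cos_angle[OF assms, of "2 * m"] by simp

lemma continuous_rho_K_cos:
  "continuous_on (sphere 0 1) (\<lambda>u::real^2. (cos (2 * real m * angle u))\<^sup>2)"
proof -
  have "continuous_on (sphere 0 1) (\<lambda>u::real^2. (Re (Complex (u $ 1) (u $ 2) ^ (2 * m)))\<^sup>2)"
    unfolding Complex_eq by (intro continuous_intros)
  then show ?thesis
    using rho_K_cos_eq by (subst continuous_on_cong[OF refl]) auto
qed

lemma radial_set_K_cos: "radial_set (K_cos m)"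
  unfolding radial_set_def K_cos_def using continuous_rho_K_cos[of m]
  by (intro exI[of _ "\<lambda>u. (cos (2 * real m * angle u))\<^sup>2"]) auto

lemma radial_function_K_cos:
  "u \<in> sphere 0 1 \<Longrightarrow> radial_function (K_cos m) u = (cos (2 * real m * angle u))\<^sup>2"
  unfolding K_cos_def by (subst radial_function_radial_set_of) auto

lemma radial_body_perturbed_disc_K_cos:
  assumes "\<bar>t\<bar> < 1"
  shows "radial_body (perturbed_disc (K_cos m) t)"
proof -
  let ?\<rho> = "\<lambda>u::real^2. 1 + t * radial_function (K_cos m) u"
  have "continuous_on (sphere 0 1) (\<lambda>u::real^2. 1 + t * (cos (2 * real m * angle u))\<^sup>2)"
    by (intro continuous_intros continuous_rho_K_cos)
  then have "continuous_on (sphere 0 1) ?\<rho>"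
    using radial_function_K_cos by (subst continuous_on_cong[OF refl]) auto
  moreover have "0 < ?\<rho> u" if "u \<in> sphere 0 1" for u
  proof -
    let ?c = "(cos (2 * real m * angle u))\<^sup>2"
    have "\<bar>t * ?c\<bar> \<le> \<bar>t\<bar> * 1"
      unfolding abs_mult by (intro mult_left_mono) (auto simp: abs_square_le_1)
    then show ?thesis
      unfolding radial_function_K_cos[OF that] using assms by linarith
  qed
  ultimately show ?thesis
    unfolding radial_body_def perturbed_disc_def by blast
qed

lemma K_cos_symmetric: "uminus ` K_cos m = K_cos m"
proof -
  have *: "- x \<in> K_cos m" if "x \<in> K_cos m" for x
  proof (cases "x = 0")
    case False
    let ?u = "x /\<^sub>R norm x"
    have u: "?u \<in> sphere 0 1" "- ?u \<in> sphere 0 1"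
      using False by simp_all
    have "Complex ((- ?u) $ 1) ((- ?u) $ 2) = - Complex (?u $ 1) (?u $ 2)"
      by (simp add: complex_eq_iff)
    then have "(cos (2 * real m * angle (- ?u)))\<^sup>2 = (cos (2 * real m * angle ?u))\<^sup>2"
      unfolding rho_K_cos_eq[OF u(1)] rho_K_cos_eq[OF u(2)] by simp
    then show ?thesis
      using that by (simp add: K_cos_def radial_set_of_def)
  qed (use that in simp)
  show ?thesis
  proof (intro set_eqI iffI)
    fix x assume "x \<in> K_cos m"
    then show "x \<in> uminus ` K_cos m"
      using * by (intro image_eqI[of _ _ "- x"]) auto
  qed (use * in auto)
qed

end

theory Submission
  imports Defs
begin

text \<open>The radial function \<open>1 + t cos\<^sup>2(2mv)\<close> is a multiple of \<open>1 + s cos(N v)\<close> with \<open>N = 4m\<close> and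
\<open>s = t / (2 + t)\<close>. Let \<open>L\<^sub>s\<close> be the body with the latter radial function \<open>\<rho>\<close>. The ratio
\<open>|C\<^sub>\<delta> L| / |L|\<close> is invariant under scaling, so the function to differentiate is
\<open>A(s) / |L\<^sub>s|\<close> at \<open>s = t / (2 + t)\<close>, with \<open>A(s) = |C\<^sub>\<delta> L\<^sub>s|\<close> and \<open>|L\<^sub>s| = \<pi> (1 + s\<^sup>2 / 2)\<close>.

For small \<open>s\<close> the body \<open>L\<^sub>s\<close> is convex and symmetric. Write \<open>p(v)\<close> for its boundary point at angle \<open>v\<close>.
If \<open>x = p(\<phi> - h) + p(\<phi> + h)\<close>, then the chord from \<open>p(\<phi> - h)\<close> to \<open>p(\<phi> + h)\<close> cuts the lens
\<open>L\<^sub>s \<inter> (L\<^sub>s + x)\<close> into a cap of \<open>L\<^sub>s\<close> and the reflection of this cap (\<open>measure_lens\<close>), so that its area, the covariogram at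
\<open>x\<close>, is an explicit trigonometric function of \<open>\<phi>\<close>, \<open>h\<close> and \<open>s\<close> (\<open>cov_wave_point\<close>). Along rays the
covariogram is strictly decreasing while positive (\<open>cov_strict\<close>). Hence \<open>C\<^sub>\<delta> L\<^sub>s\<close> is star-shaped, and its
boundary is the curve \<open>\<phi> \<mapsto> p(\<phi> - h) + p(\<phi> + h)\<close>, where \<open>h = h(\<phi>, s)\<close> solves the one scalar equation
that the lens has area \<open>\<delta> |L\<^sub>s|\<close>; for \<open>s = 0\<close> it is the constant \<open>h\<^sub>0\<close> with
\<open>2 h\<^sub>0 - sin(2 h\<^sub>0) = \<delta> \<pi>\<close>.

The area swept by this curve is \<open>1/2\<close> of the integral of \<open>x \<times> x'\<close>, which involves the derivative of \<open>h\<close> in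
\<open>\<phi>\<close>. Subtracting the derivative of a periodic function (\<open>swept_area\<close>) removes it, and \<open>A(s)\<close> becomes the integral
of an explicit function of \<open>\<phi>\<close>, \<open>h(\<phi>, s)\<close> and \<open>s\<close> (\<open>measure_conv_body_wave\<close>). Differentiating twice
under the integral and implicitly (\<open>integral_along_implicit\<close>) gives \<open>A'(0) = 0\<close> and
\<open>A''(0) = 4 \<pi> (cos\<^sup>2 h\<^sub>0 - S\<^sup>2 + k\<^sup>2)\<close>, where \<open>S = sin(N h\<^sub>0)\<close>, \<open>C = cos(N h\<^sub>0)\<close> and
\<open>k = S / (N sin\<^sup>2 h\<^sub>0) - C cot h\<^sub>0\<close> (\<open>area_second_derivative\<close>). Since \<open>A(0) = 4 \<pi> cos\<^sup>2 h\<^sub>0\<close>, the second derivative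
of \<open>A(s) / |L\<^sub>s|\<close> at \<open>s = 0\<close> is \<open>4 (k\<^sup>2 - S\<^sup>2)\<close>. By Dirichlet's approximation theorem \<open>m\<close> can be chosen
with \<open>4 m h\<^sub>0\<close> so close to a multiple of \<open>\<pi>\<close> that \<open>S\<close> is negligible while \<open>|C|\<close> is near \<open>1\<close>; as
\<open>cot h\<^sub>0 > 0\<close>, the value is then positive (\<open>exists_resonant_frequency\<close>).\<close>

section \<open>Area in polar coordinates\<close>

text \<open>The point with polar coordinates \<open>(r, v)\<close>; \<open>r\<close> may be any real number.\<close>

definition polar :: "real \<Rightarrow> real \<Rightarrow> real^2" where
  "polar r v = r *\<^sub>R vector [cos v, sin v]"

lemma polar_nth [simp]: "polar r v $ 1 = r * cos v" "polar r v $ 2 = r * sin v"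
  by (simp_all add: polar_def)

lemma vec2_eq_iff: "(x :: real^2) = y \<longleftrightarrow> x $ 1 = y $ 1 \<and> x $ 2 = y $ 2"
  by (simp add: vec_eq_iff forall_2)

lemma ex_2: "(\<exists>i :: 2. P i) \<longleftrightarrow> P 1 \<or> P 2"
  by (metis exhaust_2)

lemma norm_vec2: "norm (x :: real^2) = sqrt ((x $ 1)\<^sup>2 + (x $ 2)\<^sup>2)"
  by (simp add: norm_vec_def L2_set_def sum_2)

lemma norm_polar [simp]: "norm (polar r v) = \<bar>r\<bar>"
proof -
  have "(r * cos v)\<^sup>2 + (r * sin v)\<^sup>2 = r\<^sup>2"
    by (simp add: power_mult_distrib flip: distrib_left)
  then show ?thesis by (simp add: norm_vec2)
qed

lemma polar_eq_0_iff [simp]: "polar r v = 0 \<longleftrightarrow> r = 0"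
  using norm_polar[of r v] by (metis abs_eq_0 norm_eq_zero)

lemma polar_scale: "c *\<^sub>R polar r v = polar (c * r) v"
  by (simp add: polar_def)

lemma polar_plus_pi: "polar r (v + pi) = - polar r v"
  by (simp add: vec2_eq_iff)

lemma polar_eqD:
  assumes "polar r v = polar r' v'" "0 < r" "0 < r'" "\<bar>v - v'\<bar> < 2 * pi"
  shows "r = r'" "v = v'"
proof -
  show r: "r = r'" using assms norm_polar[of r v] norm_polar[of r' v'] by simp
  have "cos v = cos v'" "sin v = sin v'"
    using assms(1,2) r by (auto simp: vec2_eq_iff)
  then have "cos (v - v') = 1" using sin_cos_squared_add2[of v']
    by (simp add: cos_diff power2_eq_square)
  then obtain n where n: "v - v' = real_of_int n * (2 * pi)" using cos_one_2pi_int by (auto simp: mult.assoc)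
  then have "\<bar>real_of_int n\<bar> * (2 * pi) < 1 * (2 * pi)" using assms(4) by (simp add: abs_mult)
  then have "\<bar>real_of_int n\<bar> < 1" by (rule mult_right_less_imp_less) simp
  then have "n = 0" by linarith
  then show "v = v'" using n by simp
qed

lemma polar_exists:
  assumes "(x :: real^2) \<noteq> 0"
  obtains v where "a \<le> v" "v < a + 2 * pi" "x = polar (norm x) v"
proof -
  have n: "norm x > 0" using assms by simp
  have "(norm x)\<^sup>2 = (x $ 1)\<^sup>2 + (x $ 2)\<^sup>2" by (simp add: norm_vec2)
  moreover have "(norm x)\<^sup>2 \<noteq> 0" using n by simp
  ultimately have "(x $ 1 / norm x)\<^sup>2 + (x $ 2 / norm x)\<^sup>2 = 1"
    unfolding power_divide by (simp only: divide_self_if if_False flip: add_divide_distrib)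
  then obtain t where t: "x $ 1 / norm x = cos t" "x $ 2 / norm x = sin t"
    using sincos_total_2pi by metis
  define k where "k = \<lfloor>(t - a) / (2 * pi)\<rfloor>"
  define v where "v = t - 2 * pi * of_int k"
  have "of_int k \<le> (t - a) / (2 * pi)" "(t - a) / (2 * pi) < of_int k + 1"
    unfolding k_def by linarith+
  then have "a \<le> v" "v < a + 2 * pi" unfolding v_def
    by (simp_all add: field_simps)
  moreover have "cos v = cos t" "sin v = sin t"
    unfolding v_def using cos_int_2pin[of k] sin_int_2pin[of k]
    by (simp_all add: cos_diff sin_diff)
  then have "x = polar (norm x) v"
    using n by (simp add: vec2_eq_iff flip: t)
  ultimately show ?thesis using that by blast
qed

text \<open>The part at angles \<open>a \<le> v < b\<close> of the region with radial function \<open>\<rho>\<close>. The half-open range of angles and the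
missing origin make adjacent sectors disjoint.\<close>

definition sector :: "(real \<Rightarrow> real) \<Rightarrow> real \<Rightarrow> real \<Rightarrow> (real^2) set" where
  "sector \<rho> a b = {polar r v | r v. a \<le> v \<and> v < b \<and> 0 < r \<and> r \<le> \<rho> v}"

text \<open>Polar coordinates with \<open>r\<^sup>2 / 2\<close> in place of \<open>r\<close>: this map preserves area.\<close>

definition sqrt_polar :: "real^2 \<Rightarrow> real^2" where
  "sqrt_polar y = polar (sqrt (2 * y $ 1)) (y $ 2)"

lemma sqrt_polar_has_derivative:
  assumes "0 < y $ 1"
  shows "(sqrt_polar has_derivative (\<lambda>z. (z $ 1 / sqrt (2 * y $ 1)) *\<^sub>R polar 1 (y $ 2)
      + (z $ 2 * sqrt (2 * y $ 1)) *\<^sub>R vector [- sin (y $ 2), cos (y $ 2)])) (at y within S)"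
proof -
  have c: "sqrt_polar = (\<lambda>y. sqrt (2 * y $ 1) *\<^sub>R (cos (y $ 2) *\<^sub>R axis 1 1 + sin (y $ 2) *\<^sub>R axis 2 1))"
    by (auto simp: sqrt_polar_def vec2_eq_iff axis_def)
  have D: "((\<lambda>y::real^2. y $ i) has_derivative (\<lambda>z. z $ i)) (at y within S)" for i y
    by (rule bounded_linear_imp_has_derivative[OF bounded_linear_vec_nth])
  have D1: "((\<lambda>y. sqrt (2 * y $ 1)) has_derivative (\<lambda>z. z $ 1 / sqrt (2 * y $ 1))) (at y within S)"
    by (rule has_derivative_eq_rhs, rule has_derivative_real_sqrt, use assms in simp,
        rule has_derivative_mult_right, rule D) (use assms in \<open>simp add: fun_eq_iff field_simps\<close>)
  have Dc: "((\<lambda>y. cos (y $ 2)) has_derivative (\<lambda>z. - sin (y $ 2) * z $ 2)) (at y within S)"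
    by (rule has_derivative_eq_rhs, rule has_derivative_cos, rule D) (simp add: fun_eq_iff mult.commute)
  have Ds: "((\<lambda>y. sin (y $ 2)) has_derivative (\<lambda>z. cos (y $ 2) * z $ 2)) (at y within S)"
    by (rule has_derivative_eq_rhs, rule has_derivative_sin, rule D) (simp add: fun_eq_iff mult.commute)
  show ?thesis unfolding c
    by (rule has_derivative_eq_rhs, rule has_derivative_scaleR, rule D1, rule has_derivative_add,
        (rule has_derivative_scaleR_left, rule Dc), rule has_derivative_scaleR_left, rule Ds)
       (simp add: vec2_eq_iff axis_def fun_eq_iff algebra_simps)
qed

lemma measure_sqrt_polar_image:
  assumes "S \<in> lmeasurable" "\<And>y. y \<in> S \<Longrightarrow> 0 < y $ 1 \<and> a \<le> y $ 2 \<and> y $ 2 < a + 2 * pi"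
  shows "sqrt_polar ` S \<in> lmeasurable" "measure lebesgue (sqrt_polar ` S) = measure lebesgue S"
proof -
  let ?D = "\<lambda>y z. (z $ 1 / sqrt (2 * y $ 1)) *\<^sub>R polar 1 (y $ 2)
      + (z $ 2 * sqrt (2 * y $ 1)) *\<^sub>R (vector [- sin (y $ 2), cos (y $ 2)] :: real^2)"
  have inj: "inj_on sqrt_polar S"
  proof (rule inj_onI)
    fix x y assume "x \<in> S" "y \<in> S" "sqrt_polar x = sqrt_polar y"
    with assms(2)[of x] assms(2)[of y]
    have "\<bar>x $ 2 - y $ 2\<bar> < 2 * pi" unfolding abs_less_iff by auto
    with \<open>x \<in> S\<close> \<open>y \<in> S\<close> \<open>sqrt_polar x = sqrt_polar y\<close> assms(2)[of x] assms(2)[of y] show "x = y"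
      using polar_eqD[of "sqrt (2 * x $ 1)" "x $ 2" "sqrt (2 * y $ 1)" "y $ 2"]
      by (simp add: sqrt_polar_def vec2_eq_iff)
  qed
  have det: "\<bar>det (matrix (?D y))\<bar> = 1" if "y \<in> S" for y
  proof -
    have p: "0 < y $ 1" using assms(2)[OF that] by simp
    then have "det (matrix (?D y)) = (cos (y $ 2))\<^sup>2 + (sin (y $ 2))\<^sup>2"
      by (simp add: det_2 matrix_def axis_def power2_eq_square)
    then show ?thesis by simp
  qed
  have "((\<lambda>y. \<bar>det (matrix (?D y))\<bar>) has_integral measure lebesgue S) S"
    using assms(1) has_integral_cong[of S "\<lambda>y. \<bar>det (matrix (?D y))\<bar>" "\<lambda>_. 1 :: real"] det
    by (simp add: lmeasure_integral lmeasurable_iff_integrable_on flip: has_integral_integral)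
  then have "sqrt_polar ` S \<in> lmeasurable \<and> measure lebesgue (sqrt_polar ` S) = measure lebesgue S"
    using assms inj
    by (subst has_measure_differentiable_image[where f' = ?D]) (auto simp: fmeasurableD intro!: sqrt_polar_has_derivative)
  then show "sqrt_polar ` S \<in> lmeasurable" "measure lebesgue (sqrt_polar ` S) = measure lebesgue S"
    by auto
qed

lemma sector_eq_image:
  assumes "\<And>v. a \<le> v \<Longrightarrow> v < b \<Longrightarrow> 0 \<le> \<rho> v"
  shows "sector \<rho> a b = sqrt_polar ` {y. 0 < y $ 1 \<and> y $ 1 \<le> (\<rho> (y $ 2))\<^sup>2 / 2 \<and> a \<le> y $ 2 \<and> y $ 2 < b}"
proof (intro equalityI subsetI)
  fix x assume "x \<in> sector \<rho> a b"
  then obtain r v where x: "x = polar r v" "a \<le> v" "v < b" "0 < r" "r \<le> \<rho> v"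
    by (auto simp: sector_def)
  then have "x = sqrt_polar (vector [r\<^sup>2 / 2, v])" "r\<^sup>2 \<le> (\<rho> v)\<^sup>2"
    by (auto simp: sqrt_polar_def power_mono)
  then show "x \<in> sqrt_polar ` {y. 0 < y $ 1 \<and> y $ 1 \<le> (\<rho> (y $ 2))\<^sup>2 / 2 \<and> a \<le> y $ 2 \<and> y $ 2 < b}"
    using x by (intro image_eqI[of _ _ "vector [r\<^sup>2 / 2, v]"]) auto
next
  fix x assume "x \<in> sqrt_polar ` {y. 0 < y $ 1 \<and> y $ 1 \<le> (\<rho> (y $ 2))\<^sup>2 / 2 \<and> a \<le> y $ 2 \<and> y $ 2 < b}"
  then obtain y where y: "x = sqrt_polar y" "0 < y $ 1" "y $ 1 \<le> (\<rho> (y $ 2))\<^sup>2 / 2" "a \<le> y $ 2" "y $ 2 < b"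
    by auto
  then have "sqrt (2 * y $ 1) \<le> \<rho> (y $ 2)" using assms[of "y $ 2"]
    by (intro real_le_lsqrt) auto
  then show "x \<in> sector \<rho> a b" unfolding sector_def using y
    by (intro CollectI exI[of _ "sqrt (2 * y $ 1)"] exI[of _ "y $ 2"]) (auto simp: sqrt_polar_def)
qed

lemma circular_sector:
  assumes "0 \<le> R" "a \<le> b" "b \<le> a + 2 * pi"
  shows "sector (\<lambda>_. R) a b \<in> lmeasurable"
    "measure lebesgue (sector (\<lambda>_. R) a b) = (b - a) * R\<^sup>2 / 2"
proof -
  let ?S = "{y :: real^2. 0 < y $ 1 \<and> y $ 1 \<le> R\<^sup>2 / 2 \<and> a \<le> y $ 2 \<and> y $ 2 < b}"
  let ?B = "cbox (vector [0, a]) (vector [R\<^sup>2 / 2, b]) :: (real^2) set"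
  have B: "?B = {y. 0 \<le> y $ 1 \<and> y $ 1 \<le> R\<^sup>2 / 2 \<and> a \<le> y $ 2 \<and> y $ 2 \<le> b}"
    by (auto simp: mem_box_cart forall_2)
  have "negligible {y :: real^2. axis 1 1 \<bullet> y = 0}" "negligible {y :: real^2. axis 2 1 \<bullet> y = b}"
    by (intro negligible_hyperplane; simp add: axis_eq_0_iff)+
  then have "negligible ({y :: real^2. axis 1 1 \<bullet> y = 0} \<union> {y. axis 2 1 \<bullet> y = b})"
    by (rule negligible_Un)
  then have n: "negligible ((?B - ?S) \<union> (?S - ?B))"
    by (rule negligible_subset) (auto simp: B inner_axis')
  have mS: "?S \<in> lmeasurable" by (rule lmeasurable_negligible_symdiff[OF _ n]) simp
  have "measure lebesgue ?S = measure lebesgue ?B"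
    by (rule measure_negligible_symdiff[OF _ n]) simp
  also have "\<dots> = (b - a) * R\<^sup>2 / 2"
  proof -
    have "?B \<noteq> {}" using assms(2) by (simp add: interval_eq_empty_cart ex_2 not_less)
    then have "measure lborel ?B = (R\<^sup>2 / 2 - 0) * (b - a)"
      by (simp add: content_cbox_cart UNIV_2)
    then show ?thesis by (simp add: field_simps)
  qed
  finally have mes: "measure lebesgue ?S = (b - a) * R\<^sup>2 / 2" .
  have sec: "sector (\<lambda>_. R) a b = sqrt_polar ` ?S"
    using assms(1) by (rule sector_eq_image)
  show "sector (\<lambda>_. R) a b \<in> lmeasurable"
    "measure lebesgue (sector (\<lambda>_. R) a b) = (b - a) * R\<^sup>2 / 2"
    unfolding sec using measure_sqrt_polar_image[OF mS, of a] mes assms(3) by auto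
qed

lemma sector_lmeasurable:
  assumes "continuous_on {a..b} \<rho>" "\<And>v. v \<in> {a..b} \<Longrightarrow> 0 \<le> \<rho> v" "b \<le> a + 2 * pi"
  shows "sector \<rho> a b \<in> lmeasurable"
proof -
  let ?S = "{y :: real^2. 0 < y $ 1 \<and> y $ 1 \<le> (\<rho> (y $ 2))\<^sup>2 / 2 \<and> a \<le> y $ 2 \<and> y $ 2 < b}"
  let ?f = "\<lambda>(l, v). (l * (\<rho> v)\<^sup>2 / 2) *\<^sub>R axis 1 1 + v *\<^sub>R axis 2 1 :: real^2"
  let ?T = "?f ` ({0..1} \<times> {a..b})"
  have "continuous_on ({0..1} \<times> {a..b}) ?f"
    unfolding case_prod_beta
    by (intro continuous_intros continuous_on_compose2[OF assms(1)]) auto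
  then have "compact ?T" by (intro compact_continuous_image compact_Times) auto
  then have T: "?T \<in> lmeasurable" by (rule lmeasurable_compact)
  have "?S = ?T \<inter> ({y. 0 < y $ 1} \<inter> {y. y $ 2 < b})"
  proof (intro equalityI subsetI)
    fix y assume y: "y \<in> ?S"
    then have "y = ?f (y $ 1 / ((\<rho> (y $ 2))\<^sup>2 / 2), y $ 2)"
      by (auto simp: vec2_eq_iff axis_def)
    moreover have "(y $ 1 / ((\<rho> (y $ 2))\<^sup>2 / 2), y $ 2) \<in> {0..1} \<times> {a..b}"
      using y by (auto simp: divide_simps)
    ultimately show "y \<in> ?T \<inter> ({y. 0 < y $ 1} \<inter> {y. y $ 2 < b})"
      using y by blast
  next
    fix y assume "y \<in> ?T \<inter> ({y. 0 < y $ 1} \<inter> {y. y $ 2 < b})"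
    then show "y \<in> ?S" by (auto simp: axis_def mult_left_le_one_le)
  qed
  moreover have "open ({y :: real^2. 0 < y $ 1} \<inter> {y. y $ 2 < b})"
    by (intro open_Int open_Collect_less continuous_intros)
  then have "({y :: real^2. 0 < y $ 1} \<inter> {y. y $ 2 < b}) \<in> sets lebesgue"
    by (simp add: borel_open)
  ultimately have "?S \<in> lmeasurable" using T by (simp only: fmeasurable_Int_fmeasurable)
  then show ?thesis
    using measure_sqrt_polar_image(1)[of ?S a] sector_eq_image[of a b \<rho>] assms(2,3)
    by fastforce
qed

lemma sector_split:
  assumes "a \<le> b" "b \<le> c"
  shows "sector \<rho> a c = sector \<rho> a b \<union> sector \<rho> b c"
proof (intro equalityI subsetI)
  fix x assume "x \<in> sector \<rho> a c"
  then obtain r v where "x = polar r v" "a \<le> v" "v < c" "0 < r" "r \<le> \<rho> v" by (auto simp: sector_def)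
  then show "x \<in> sector \<rho> a b \<union> sector \<rho> b c" unfolding sector_def by (cases "v < b") auto
next
  fix x assume "x \<in> sector \<rho> a b \<union> sector \<rho> b c"
  then obtain r v where "x = polar r v" "a \<le> v" "v < c" "0 < r" "r \<le> \<rho> v" using assms by (fastforce simp: sector_def)
  then show "x \<in> sector \<rho> a c" unfolding sector_def by auto
qed

lemma sector_disjoint:
  assumes "c \<le> a + 2 * pi"
  shows "sector \<rho> a b \<inter> sector \<rho> b c = {}"
proof -
  have "False" if x: "x = polar r v" "x = polar r' v'" "a \<le> v" "v < b" "b \<le> v'" "v' < c" "0 < r" "0 < r'" for x r r' v v'
    using polar_eqD(2)[of r v r' v'] x assms by auto
  then show ?thesis unfolding sector_def by blast
qed

lemma sector_mono:
  assumes "\<And>v. a \<le> v \<Longrightarrow> v < b \<Longrightarrow> \<rho> v \<le> \<rho>' v"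
  shows "sector \<rho> a b \<subseteq> sector \<rho>' a b"
proof
  fix x assume "x \<in> sector \<rho> a b"
  then obtain r v where "x = polar r v" "a \<le> v" "v < b" "0 < r" "r \<le> \<rho> v" by (auto simp: sector_def)
  with assms[of v] show "x \<in> sector \<rho>' a b" unfolding sector_def by force
qed

text \<open>Area in polar coordinates, with an antiderivative \<open>M\<close> in place of the integral: both sides have the same
derivative in \<open>b\<close>, by comparison with circular sectors.\<close>

lemma measure_sector:
  assumes cont: "continuous_on {a..b} \<rho>" and nn: "\<And>v. v \<in> {a..b} \<Longrightarrow> 0 \<le> \<rho> v"
    and ab: "a \<le> b" "b \<le> a + 2 * pi"
    and M: "\<And>v. v \<in> {a..b} \<Longrightarrow> (M has_real_derivative (\<rho> v)\<^sup>2 / 2) (at v within {a..b})"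
  shows "measure lebesgue (sector \<rho> a b) = M b - M a"
proof -
  define m where "m t = measure lebesgue (sector \<rho> a t)" for t
  have add: "m w = m v + measure lebesgue (sector \<rho> v w)" if "a \<le> v" "v \<le> w" "w \<le> b" for v w
  proof -
    have "sector \<rho> a v \<in> lmeasurable" "sector \<rho> v w \<in> lmeasurable"
      using that nn ab by (auto intro!: sector_lmeasurable continuous_on_subset[OF cont])
    then show ?thesis
      unfolding m_def sector_split[OF that(1,2)] using that ab
      by (simp add: measure_Un3 sector_disjoint)
  qed
  have small: "\<bar>measure lebesgue (sector \<rho> v w) - (w - v) * k\<bar> \<le> e * (w - v)"
    if vw: "a \<le> v" "v \<le> w" "w \<le> b" and e: "e > 0" "k \<ge> 0" and "\<And>y. y \<in> {v..w} \<Longrightarrow> \<bar>(\<rho> y)\<^sup>2 / 2 - k\<bar> \<le> e"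
    for v w e k
  proof -
    have meas: "sector \<rho> v w \<in> lmeasurable"
      using that nn ab by (auto intro!: sector_lmeasurable continuous_on_subset[OF cont])
    define lo where "lo = sqrt (max 0 (2 * k - 2 * e))"
    define hi where "hi = sqrt (2 * k + 2 * e)"
    have y: "lo \<le> \<rho> y \<and> \<rho> y \<le> hi" if "v \<le> y" "y \<le> w" for y
    proof -
      have b: "\<bar>(\<rho> y)\<^sup>2 / 2 - k\<bar> \<le> e" and n: "0 \<le> \<rho> y" using that vw \<open>\<And>y. y \<in> {v..w} \<Longrightarrow> _\<close> nn by auto
      then have "max 0 (2 * k - 2 * e) \<le> (\<rho> y)\<^sup>2" by (auto simp: abs_if split: if_splits)
      then have "lo \<le> \<rho> y" unfolding lo_def using n by (intro real_le_lsqrt) auto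
      moreover have "(\<rho> y)\<^sup>2 \<le> 2 * k + 2 * e" using b by (auto simp: abs_if split: if_splits)
      then have "\<rho> y \<le> hi" unfolding hi_def by (rule real_le_rsqrt)
      ultimately show ?thesis by simp
    qed
    have len: "w \<le> v + 2 * pi" using vw ab by simp
    have "lo\<^sup>2 \<ge> 2 * k - 2 * e" "lo \<ge> 0" "hi \<ge> 0" "hi\<^sup>2 = 2 * k + 2 * e"
      unfolding lo_def hi_def using e by auto
    note cs = circular_sector[OF \<open>lo \<ge> 0\<close> vw(2) len] circular_sector[OF \<open>hi \<ge> 0\<close> vw(2) len]
    have "measure lebesgue (sector (\<lambda>_. lo) v w) \<le> measure lebesgue (sector \<rho> v w)"
      using cs meas y by (intro measure_mono_fmeasurable sector_mono) (auto simp: fmeasurableD)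
    moreover have "measure lebesgue (sector \<rho> v w) \<le> measure lebesgue (sector (\<lambda>_. hi) v w)"
      using cs meas y by (intro measure_mono_fmeasurable sector_mono) (auto simp: fmeasurableD)
    moreover have "(w - v) * (2 * k - 2 * e) \<le> (w - v) * lo\<^sup>2"
      using \<open>lo\<^sup>2 \<ge> 2 * k - 2 * e\<close> vw by (intro mult_left_mono) auto
    moreover have "(w - v) * hi\<^sup>2 = (w - v) * (2 * k + 2 * e)" using \<open>hi\<^sup>2 = 2 * k + 2 * e\<close> by simp
    ultimately show ?thesis unfolding cs by (simp add: abs_le_iff algebra_simps)
  qed
  have der: "(m has_real_derivative (\<rho> t)\<^sup>2 / 2) (at t within {a..b})" if t: "t \<in> {a..b}" for t
    unfolding has_field_derivative_def has_derivative_within_alt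
  proof (intro conjI allI impI)
    show "bounded_linear ((*) ((\<rho> t)\<^sup>2 / 2))" by (rule bounded_linear_mult_right)
    fix e :: real assume e: "e > 0"
    have "continuous_on {a..b} (\<lambda>v. (\<rho> v)\<^sup>2 / 2)" by (intro continuous_intros cont) simp
    then obtain d where d: "d > 0" "\<And>y. y \<in> {a..b} \<Longrightarrow> dist y t < d \<Longrightarrow> dist ((\<rho> y)\<^sup>2 / 2) ((\<rho> t)\<^sup>2 / 2) < e"
      using t e unfolding continuous_on_iff by blast
    show "\<exists>d>0. \<forall>y\<in>{a..b}. norm (y - t) < d \<longrightarrow>
        norm (m y - m t - (\<rho> t)\<^sup>2 / 2 * (y - t)) \<le> e * norm (y - t)"
    proof (intro exI[of _ d] conjI ballI impI)
      show "d > 0" by fact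
      fix y assume y: "y \<in> {a..b}" "norm (y - t) < d"
      have near: "\<bar>(\<rho> z)\<^sup>2 / 2 - (\<rho> t)\<^sup>2 / 2\<bar> \<le> e" if "z \<in> {min y t..max y t}" for z
      proof -
        have "dist z t < d" "z \<in> {a..b}" using that y t by (auto simp: dist_real_def)
        from d(2)[OF this(2,1)] show ?thesis by (simp add: dist_real_def)
      qed
      show "norm (m y - m t - (\<rho> t)\<^sup>2 / 2 * (y - t)) \<le> e * norm (y - t)"
      proof (cases "t \<le> y")
        case True
        then show ?thesis using small[of t y e "(\<rho> t)\<^sup>2 / 2"] near y t e add[of t y]
          by (simp add: algebra_simps)
      next
        case False
        then have "\<bar>measure lebesgue (sector \<rho> y t) - (t - y) * ((\<rho> t)\<^sup>2 / 2)\<bar> \<le> e * (t - y)"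
          using near y t e by (intro small) auto
        moreover have "m t = m y + measure lebesgue (sector \<rho> y t)" using False y t by (intro add) auto
        moreover have "- (m y - m t - k * (y - t)) = (m t - m y) - (t - y) * k" for k
          by (simp add: algebra_simps)
        ultimately have "\<bar>- (m y - m t - (\<rho> t)\<^sup>2 / 2 * (y - t))\<bar> \<le> e * (t - y)"
          by simp
        then show ?thesis using False by simp
      qed
    qed
  qed
  have "\<exists>c. \<forall>x\<in>{a..b}. m x - M x = c"
  proof (rule has_field_derivative_zero_constant)
    show "((\<lambda>x. m x - M x) has_real_derivative 0) (at x within {a..b})" if "x \<in> {a..b}" for x
      using DERIV_diff[OF der[OF that] M[OF that]] by simp
  qed simp
  then obtain c where "\<forall>x\<in>{a..b}. m x - M x = c" ..
  then have "m b - M b = m a - M a" using ab by auto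
  moreover have "sector \<rho> a a = {}" unfolding sector_def by auto
  then have "m a = 0" unfolding m_def by simp
  ultimately show ?thesis unfolding m_def by simp
qed

section \<open>Convex bodies given by a radial function\<close>

text \<open>The star-shaped set with radial function \<open>\<rho>\<close>, a function of the angle. For \<open>r > 0\<close> and \<open>\<rho>\<close> of period
\<open>2 * pi\<close>, the representation by \<open>(r, v)\<close> does not depend on the choice of \<open>v\<close>.\<close>

definition star_body :: "(real \<Rightarrow> real) \<Rightarrow> (real^2) set" where
  "star_body \<rho> = {polar r v | r v. 0 \<le> r \<and> r \<le> \<rho> v}"

text \<open>Twice differentiable positive radial functions of period \<open>pi\<close> whose boundary curve has positive curvature: the body
\<open>L\<close> is convex and symmetric about the origin.\<close>

locale polar_convex =
  fixes \<rho> \<rho>' \<rho>'' :: "real \<Rightarrow> real"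
  assumes periodic: "\<rho> (v + pi) = \<rho> v"
    and pos: "0 < \<rho> v"
    and deriv1: "(\<rho> has_real_derivative \<rho>' v) (at v)"
    and deriv2: "(\<rho>' has_real_derivative \<rho>'' v) (at v)"
    and curvature: "\<rho> v * \<rho>'' v < (\<rho> v)\<^sup>2 + 2 * (\<rho>' v)\<^sup>2"
begin

abbreviation L where "L \<equiv> star_body \<rho>"

text \<open>The reciprocal of the radial function and its first two derivatives. In terms of the reciprocal, positive curvature
reads \<open>recip + recip'' > 0\<close>.\<close>

definition recip where "recip v = 1 / \<rho> v"
definition recip' where "recip' v = - \<rho>' v / (\<rho> v)\<^sup>2"
definition recip'' where "recip'' v = (2 * (\<rho>' v)\<^sup>2 - \<rho> v * \<rho>'' v) / (\<rho> v) ^ 3"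

text \<open>The linear functional whose level line \<open>1\<close> is the tangent of \<open>L\<close> at the boundary point of angle \<open>v\<close>.\<close>

definition support :: "real \<Rightarrow> real^2 \<Rightarrow> real" where
  "support v y = recip v * (y $ 1 * cos v + y $ 2 * sin v) + recip' v * (y $ 2 * cos v - y $ 1 * sin v)"

lemma continuous_on_rho: "continuous_on S \<rho>"
  using deriv1 by (meson DERIV_continuous continuous_at_imp_continuous_on)

lemma periodic2: "\<rho> (v + 2 * pi) = \<rho> v"
  using periodic[of v] periodic[of "v + pi"] by (simp add: algebra_simps)

lemma deriv_recip: "(recip has_real_derivative recip' v) (at v)"
  unfolding recip_def[abs_def] recip'_def using pos[of v]
  by (auto intro!: derivative_eq_intros deriv1 simp: power2_eq_square)

lemma deriv_recip': "(recip' has_real_derivative recip'' v) (at v)"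
  unfolding recip'_def[abs_def] recip''_def using pos[of v]
  by (auto intro!: derivative_eq_intros deriv1 deriv2 simp: field_simps power2_eq_square power3_eq_cube eval_nat_numeral)

lemma recip_curvature: "0 < recip v + recip'' v"
proof -
  have "recip v + recip'' v = ((\<rho> v)\<^sup>2 + 2 * (\<rho>' v)\<^sup>2 - \<rho> v * \<rho>'' v) / \<rho> v ^ 3"
    unfolding recip_def recip''_def using pos[of v] by (simp add: field_simps power2_eq_square power3_eq_cube)
  then show ?thesis using curvature[of v] pos[of v] by simp
qed

text \<open>The graph of \<open>recip\<close> lies above its tangent sinusoid: the function \<open>q\<close> of the proof has derivative
\<open>(recip + recip'') t * sin (w - t)\<close>, and \<open>q v\<close> and \<open>q w\<close> are the two sides.\<close>

lemma tangent:
  assumes "v \<noteq> w" "\<bar>v - w\<bar> \<le> pi"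
  shows "recip v * cos (w - v) + recip' v * sin (w - v) < recip w"
proof -
  define q where "q t = recip t * cos (w - t) + recip' t * sin (w - t)" for t
  have q': "(q has_real_derivative (recip t + recip'' t) * sin (w - t)) (at t)" for t
    unfolding q_def[abs_def]
    by (auto intro!: derivative_eq_intros deriv_recip deriv_recip' simp: algebra_simps)
  have cont: "continuous_on S q" for S
    using q' by (meson DERIV_continuous continuous_at_imp_continuous_on)
  have "q v < q w"
  proof (cases "v < w")
    case True
    then show ?thesis
    proof (rule DERIV_pos_imp_increasing_open[OF _ _ cont])
      fix t assume "v < t" "t < w"
      then have "0 < (recip t + recip'' t) * sin (w - t)"
        using recip_curvature[of t] assms by (intro mult_pos_pos sin_gt_zero) auto
      then show "\<exists>y. (q has_real_derivative y) (at t) \<and> 0 < y" using q' by blast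
    qed
  next
    case False
    then have "w < v" using assms by auto
    then show ?thesis
    proof (rule DERIV_neg_imp_decreasing_open[OF _ _ cont])
      fix t assume "w < t" "t < v"
      then have "0 < (recip t + recip'' t) * sin (t - w)"
        using recip_curvature[of t] assms by (intro mult_pos_pos sin_gt_zero) auto
      also have "sin (t - w) = - sin (w - t)" by (metis minus_diff_eq sin_minus)
      finally have "(recip t + recip'' t) * sin (w - t) < 0" by simp
      then show "\<exists>y. (q has_real_derivative y) (at t) \<and> y < 0" using q' by blast
    qed
  qed
  then show ?thesis unfolding q_def by simp
qed

lemma support_polar: "support v (polar r w) = r * (recip v * cos (w - v) + recip' v * sin (w - v))"
  unfolding support_def by (simp add: cos_diff sin_diff algebra_simps)

lemma support_linear: "linear (support v)"
  by (rule linearI) (simp_all add: support_def algebra_simps)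

lemma support_self [simp]: "support v (polar (\<rho> v) v) = 1"
  using pos[of v] by (simp add: support_polar recip_def)

lemma support_lt_1:
  assumes "v \<noteq> w" "\<bar>v - w\<bar> \<le> pi"
  shows "support v (polar (\<rho> w) w) < 1"
proof -
  have "\<rho> w * (recip v * cos (w - v) + recip' v * sin (w - v)) < \<rho> w * recip w"
    using tangent[OF assms] pos[of w] by simp
  then show ?thesis using pos[of w] by (simp add: support_polar recip_def)
qed

lemma polar_mem_iff:
  assumes "0 < r" shows "polar r v \<in> L \<longleftrightarrow> r \<le> \<rho> v"
proof
  assume "polar r v \<in> L"
  then obtain r' w where w: "polar r v = polar r' w" "0 \<le> r'" "r' \<le> \<rho> w" by (auto simp: star_body_def)
  have "\<bar>r\<bar> = \<bar>r'\<bar>" using w(1) by (metis norm_polar)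
  then have r: "r' = r" using w assms by simp
  then have "cos v = cos w" "sin v = sin w" using w(1) assms by (auto simp: vec2_eq_iff)
  then obtain n where n: "v = w + 2 * pi * real_of_int n" using sin_cos_eq_iff by metis
  have nat: "\<rho> (w + 2 * pi * real k) = \<rho> w" for w k
  proof (induction k)
    case (Suc k)
    have "w + 2 * pi * real (Suc k) = (w + 2 * pi * real k) + 2 * pi" by (simp add: algebra_simps)
    then show ?case using Suc periodic2[of "w + 2 * pi * real k"] by (simp add: add.assoc)
  qed simp
  have "\<rho> v = \<rho> w"
    using n nat[of w "nat n"] nat[of v "nat (- n)"] by (cases "n \<ge> 0") auto
  then show "r \<le> \<rho> v" using w r by simp
next
  assume "r \<le> \<rho> v"
  then show "polar r v \<in> L" unfolding star_body_def using assms less_imp_le by blast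
qed

lemma support_le_1:
  assumes "y \<in> L" shows "support v y \<le> 1"
proof (cases "y = 0")
  case False
  then obtain w where w: "v - pi \<le> w" "w < v - pi + 2 * pi" "y = polar (norm y) w"
    using polar_exists by metis
  then have n: "norm y \<le> \<rho> w" using polar_mem_iff[of "norm y" w] False assms by simp
  have le: "support v (polar (\<rho> w) w) \<le> 1"
    using support_lt_1[of v w] w(1,2) by (cases "v = w") (auto simp: abs_le_iff)
  have "support v y = norm y / \<rho> w * support v (polar (\<rho> w) w)"
    using pos[of w] by (subst w(3)) (simp add: support_polar)
  also have "\<dots> \<le> 1"
    using n le pos[of w] by (metis divide_le_eq_1_pos divide_nonneg_pos dual_order.trans mult_left_le norm_ge_zero)
  finally show ?thesis .
qed (simp add: support_def)

lemma L_eq: "L = (\<Inter>v. {y. support v y \<le> 1})"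
proof (intro equalityI subsetI)
  fix y assume y: "y \<in> (\<Inter>v. {y. support v y \<le> 1})"
  show "y \<in> L"
  proof (cases "y = 0")
    case True
    then show ?thesis using pos[of 0] by (auto simp: star_body_def intro!: exI[of _ 0])
  next
    case False
    then obtain w where w: "y = polar (norm y) w" using polar_exists by metis
    have "support w (polar (norm y) w) \<le> 1" using y w by auto
    then have "norm y \<le> \<rho> w" using pos[of w] by (simp add: support_polar recip_def)
    then show ?thesis using w polar_mem_iff[of "norm y" w] False by simp
  qed
qed (use support_le_1 in auto)

lemma convex_L: "convex L"
  unfolding L_eq
proof (rule convex_INT)
  fix v
  show "convex {y. support v y \<le> 1}"
    using convex_linear_vimage[OF support_linear convex_real_interval(2)] by (auto simp: vimage_def)
qed

lemma closed_L: "closed L"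
  unfolding L_eq support_def by (intro closed_INT ballI closed_Collect_le continuous_intros)

lemma bounded_L: "bounded L"
proof -
  have "compact (\<rho> ` {0..2 * pi})"
    by (intro compact_continuous_image continuous_on_rho) auto
  then obtain B where B: "\<And>v. v \<in> {0..2 * pi} \<Longrightarrow> \<bar>\<rho> v\<bar> \<le> B"
    using compact_imp_bounded by (fastforce simp: bounded_iff)
  have "norm y \<le> B" if y: "y \<in> L" "y \<noteq> 0" for y
  proof -
    obtain w where w: "0 \<le> w" "w < 0 + 2 * pi" "y = polar (norm y) w"
      using polar_exists y by metis
    then show ?thesis using polar_mem_iff[of "norm y" w] y B[of w] by simp
  qed
  then show ?thesis by (intro boundedI[of _ "max 0 B"]) fastforce
qed

lemma compact_L: "compact L"
  using closed_L bounded_L compact_eq_bounded_closed by blast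

lemma uminus_L: "y \<in> L \<Longrightarrow> - y \<in> L"
  unfolding star_body_def using periodic by (fastforce simp flip: polar_plus_pi)

lemma support_ge: "y \<in> L \<Longrightarrow> - 1 \<le> support v y"
  using support_le_1[OF uminus_L, of y v] by (simp add: linear_neg[OF support_linear])

lemma boundary_mem: "polar (\<rho> v) v \<in> L"
  using pos[of v] less_imp_le unfolding star_body_def by blast

end

section \<open>The lens of two translates, and the covariogram along rays\<close>

text \<open>The planar cross product, the determinant of two vectors.\<close>

definition cross :: "real^2 \<Rightarrow> real^2 \<Rightarrow> real" where
  "cross p q = p $ 1 * q $ 2 - p $ 2 * q $ 1"

lemma cross_polar: "cross (polar r v) (polar r' w) = r * r' * sin (w - v)"
  by (simp add: cross_def sin_diff algebra_simps)

lemma cross_coords: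
  assumes "cross p q \<noteq> 0"
  shows "y = (cross y q / cross p q) *\<^sub>R p + (cross p y / cross p q) *\<^sub>R q"
  using assms unfolding vec2_eq_iff by (simp add: divide_simps) (simp add: cross_def algebra_simps)

lemma negligible_cross_line:
  assumes "p \<noteq> 0" shows "negligible {y. cross p y = c}"
proof -
  have "negligible {y :: real^2. vector [- p $ 2, p $ 1] \<bullet> y = c}"
    by (rule negligible_hyperplane) (use assms in \<open>auto simp: vec2_eq_iff\<close>)
  also have "{y :: real^2. vector [- p $ 2, p $ 1] \<bullet> y = c} = {y. cross p y = c}"
    by (auto simp: cross_def inner_vec_def sum_2)
  finally show ?thesis .
qed

lemma measure_uminus: "measure lebesgue (uminus ` S) = measure lebesgue (S :: (real^2) set)"
  using measure_lebesgue_affine[of "-1" 0 S] by simp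

context polar_convex
begin

text \<open>A point of \<open>L\<close> beyond the chord from \<open>p\<close> to \<open>q\<close> lies in the cone spanned by \<open>p\<close> and \<open>q\<close>, and its
translate by \<open>- (p + q)\<close> is still in \<open>L\<close>. The tangents at \<open>p\<close> and \<open>q\<close> bound the coordinates; the
translate is reached by convexity from the opposite chord, from \<open>- q\<close> to \<open>- p\<close>.\<close>

lemma beyond_chord:
  assumes ab: "\<alpha> < \<beta>" "\<beta> < \<alpha> + pi"
    and y: "y = c *\<^sub>R polar (\<rho> \<alpha>) \<alpha> + d *\<^sub>R polar (\<rho> \<beta>) \<beta>" "y \<in> L" "1 \<le> c + d"
  shows "0 \<le> c" "0 \<le> d" "y - (polar (\<rho> \<alpha>) \<alpha> + polar (\<rho> \<beta>) \<beta>) \<in> L"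
proof -
  let ?p = "polar (\<rho> \<alpha>) \<alpha>" and ?q = "polar (\<rho> \<beta>) \<beta>"
  have key: "c' - d' \<le> 1"
    if "v \<noteq> w" "\<bar>v - w\<bar> \<le> pi" "y = c' *\<^sub>R polar (\<rho> v) v + d' *\<^sub>R polar (\<rho> w) w" "1 \<le> c' + d'" for v w c' d'
  proof (rule ccontr)
    define k where "k = support v (polar (\<rho> w) w)"
    have "k < 1" "- 1 \<le> k"
      unfolding k_def using support_lt_1[OF that(1,2)] support_ge boundary_mem by auto
    assume "\<not> c' - d' \<le> 1"
    then have "0 < (c' - d' - 1) * (1 - k)" "0 \<le> (c' + d' - 1) * (1 + k)"
      using \<open>k < 1\<close> \<open>- 1 \<le> k\<close> that(4) by auto
    then have "1 < c' + d' * k" by (simp add: algebra_simps)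
    moreover have "support v y = c' + d' * k"
      using that(3) by (simp add: k_def linear_add[OF support_linear] linear_cmul[OF support_linear])
    ultimately show False using support_le_1[OF \<open>y \<in> L\<close>, of v] by simp
  qed
  have 1: "c - d \<le> 1" using ab y by (intro key[of \<alpha> \<beta>]) auto
  have 2: "d - c \<le> 1" using ab y by (intro key[of \<beta> \<alpha>]) auto
  show "0 \<le> c" "0 \<le> d" using 1 2 y by auto
  \<comment> \<open>\<open>y - x\<close> lies on the segment from a point of the opposite chord to \<open>y\<close>\<close>
  define b where "b = (c + d - 1) / 2"
  define k where "k = (c - d + 1) / 2"
  have k: "0 \<le> k" "k \<le> 1" and b: "0 \<le> b" using 1 2 y by (auto simp: k_def b_def)
  have "- ((1 - k) *\<^sub>R ?p + k *\<^sub>R ?q) \<in> L"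
    using k convex_L boundary_mem by (intro uminus_L) (auto simp: convex_def)
  then have "(1 / (b + 1)) *\<^sub>R (- ((1 - k) *\<^sub>R ?p + k *\<^sub>R ?q)) + (b / (b + 1)) *\<^sub>R y \<in> L" (is "?z \<in> L")
    using b y by (intro convexD[OF convex_L]) (auto simp: field_simps)
  also have "?z = y - (?p + ?q)"
  proof -
    have cd: "c = b + k" "d = b + 1 - k" by (simp_all add: b_def k_def field_simps)
    have "- ((1 - k) *\<^sub>R ?p + k *\<^sub>R ?q) + b *\<^sub>R y = (b + 1) *\<^sub>R (y - (?p + ?q))"
      by (simp add: y(1) cd algebra_simps)
    moreover have "?z = (1 / (b + 1)) *\<^sub>R (- ((1 - k) *\<^sub>R ?p + k *\<^sub>R ?q) + b *\<^sub>R y)"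
      by (simp add: algebra_simps)
    ultimately show ?thesis using b by simp
  qed
  finally show "y - (?p + ?q) \<in> L" .
qed

lemma cone_polar:
  assumes ab: "\<alpha> < \<beta>" "\<beta> < \<alpha> + pi" and y: "y \<noteq> 0" "0 \<le> cross y (polar 1 \<beta>)" "0 \<le> cross (polar 1 \<alpha>) y"
  obtains v where "\<alpha> \<le> v" "v \<le> \<beta>" "y = polar (norm y) v"
proof -
  obtain v where v: "\<alpha> \<le> v" "v < \<alpha> + 2 * pi" "y = polar (norm y) v" using polar_exists y(1) by metis
  have n: "norm y > 0" using y by simp
  have "cross y (polar 1 \<beta>) = norm y * sin (\<beta> - v)" "cross (polar 1 \<alpha>) y = norm y * sin (v - \<alpha>)"
    by (subst v(3), simp add: cross_polar)+
  then have s: "0 \<le> sin (\<beta> - v)" "0 \<le> sin (v - \<alpha>)" using y n by (auto simp: zero_le_mult_iff)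
  have "v - \<alpha> \<le> pi"
  proof (rule ccontr)
    assume "\<not> v - \<alpha> \<le> pi"
    then have "sin (v - \<alpha>) < 0" using v by (intro sin_lt_zero) auto
    then show False using s by simp
  qed
  have "v \<le> \<beta>"
  proof (rule ccontr)
    assume "\<not> v \<le> \<beta>"
    then have "0 < sin (v - \<beta>)" using \<open>v - \<alpha> \<le> pi\<close> ab by (intro sin_gt_zero) auto
    also have "sin (v - \<beta>) = - sin (\<beta> - v)" by (metis minus_diff_eq sin_minus)
    finally show False using s by simp
  qed
  then show ?thesis using that v by blast
qed

text \<open>The lens of \<open>L\<close> and its translate by \<open>p + q\<close> is a cap of \<open>L\<close> together with the reflection of this cap in the
midpoint of the chord, and a cap is a sector without the triangle \<open>0, p, q\<close>.\<close>

lemma measure_lens: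
  assumes ab: "\<alpha> < \<beta>" "\<beta> < \<alpha> + pi"
  defines "x \<equiv> polar (\<rho> \<alpha>) \<alpha> + polar (\<rho> \<beta>) \<beta>"
  shows "measure lebesgue (L \<inter> (\<lambda>y. y + x) ` L)
    = 2 * measure lebesgue (sector \<rho> \<alpha> \<beta>) - \<rho> \<alpha> * \<rho> \<beta> * sin (\<beta> - \<alpha>)"
proof -
  let ?p = "polar (\<rho> \<alpha>) \<alpha>" and ?q = "polar (\<rho> \<beta>) \<beta>" and ?\<mu> = "measure lebesgue"
  define \<kappa> where "\<kappa> = cross ?p ?q"
  have \<kappa>: "\<kappa> = \<rho> \<alpha> * \<rho> \<beta> * sin (\<beta> - \<alpha>)" unfolding \<kappa>_def cross_polar ..
  have \<kappa>_pos: "\<kappa> > 0" unfolding \<kappa> using pos ab by (intro mult_pos_pos sin_gt_zero) auto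
  define c where "c y = cross y ?q / \<kappa>" for y
  define d where "d y = cross ?p y / \<kappa>" for y
  have cd: "y = c y *\<^sub>R ?p + d y *\<^sub>R ?q" for y
    unfolding c_def d_def \<kappa>_def by (rule cross_coords) (use \<kappa>_pos in \<open>simp add: \<kappa>_def\<close>)
  have lin: "c (x - y) = 1 - c y" "d (x - y) = 1 - d y" for y
    using \<kappa>_pos unfolding c_def d_def x_def \<kappa>_def by (simp_all add: field_simps) (simp_all add: cross_def algebra_simps)
  have lin2: "c (a *\<^sub>R y + b *\<^sub>R z) = a * c y + b * c z" "d (a *\<^sub>R y + b *\<^sub>R z) = a * d y + b * d z"
    for a b y z
    unfolding c_def d_def by (simp_all add: cross_def field_simps flip: add_divide_distrib diff_divide_distrib)
  have line: "negligible {y. c y + d y = 1}"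
  proof (rule negligible_subset[OF negligible_cross_line[of "?q - ?p" "- \<kappa>"]])
    show "?q - ?p \<noteq> 0"
    proof
      assume "?q - ?p = 0"
      then have "\<kappa> = cross ?p ?p" unfolding \<kappa>_def by simp
      then show False using \<kappa>_pos by (simp add: cross_def)
    qed
    show "{y. c y + d y = 1} \<subseteq> {y. cross (?q - ?p) y = - \<kappa>}"
      using \<kappa>_pos by (auto simp: c_def d_def simp flip: add_divide_distrib)
         (auto simp: cross_def algebra_simps)
  qed
  define H where "H = {y. 1 \<le> c y + d y}"
  define C where "C = {y. 0 \<le> c y \<and> 0 \<le> d y}"
  have "closed H" "closed C"
    unfolding H_def C_def c_def d_def cross_def
    by (intro closed_Collect_le closed_Collect_conj continuous_intros; use \<kappa>_pos in simp)+
  have LH: "L \<inter> H \<in> lmeasurable" "L \<inter> C \<in> lmeasurable"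
    using compact_L \<open>closed H\<close> \<open>closed C\<close> by (auto intro!: lmeasurable_compact)
  \<comment> \<open>the part of the lens beyond the chord is the cap; the rest is the reflection of the cap in \<open>x / 2\<close>\<close>
  let ?R = "(\<lambda>y. x + y) ` uminus ` (L \<inter> H)"
  have lens: "L \<inter> (\<lambda>y. y + x) ` L = (L \<inter> H) \<union> ?R"
  proof (intro equalityI subsetI)
    fix y assume "y \<in> L \<inter> (\<lambda>y. y + x) ` L"
    then have y: "y \<in> L" "y - x \<in> L" by auto
    show "y \<in> (L \<inter> H) \<union> ?R"
    proof (cases "y \<in> H")
      case False
      then have "x - y \<in> H" unfolding H_def by (simp add: lin)
      moreover have "x - y \<in> L" using uminus_L[OF y(2)] by simp
      ultimately have "x + - (x - y) \<in> ?R" by blast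
      then show ?thesis by simp
    qed (use y in simp)
  next
    fix y assume "y \<in> (L \<inter> H) \<union> ?R"
    moreover have bey: "z - x \<in> L" if "z \<in> L \<inter> H" for z
      unfolding x_def using that beyond_chord(3)[OF ab cd] by (auto simp: H_def)
    moreover have "x - z - x \<in> L" "x - z \<in> L" if "z \<in> L \<inter> H" for z
      using that uminus_L[of z] uminus_L[OF bey[OF that]] by auto
    ultimately have "y \<in> L \<and> y - x \<in> L" by auto
    then show "y \<in> L \<inter> (\<lambda>y. y + x) ` L" by (auto intro: image_eqI[of _ _ "y - x"])
  qed
  have "?R \<in> lmeasurable"
    using LH(1) compact_L \<open>closed H\<close>
    by (intro lmeasurable_compact compact_continuous_image compact_Int_closed continuous_intros)
  moreover have "L \<inter> H \<inter> ?R \<subseteq> {y. c y + d y = 1}"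
  proof
    fix y assume "y \<in> L \<inter> H \<inter> ?R"
    then have "y \<in> H" "x - y \<in> H" by auto
    then show "y \<in> {y. c y + d y = 1}" by (auto simp: H_def lin)
  qed
  then have neg: "negligible (L \<inter> H \<inter> ?R)" using line negligible_subset by blast
  ultimately have lens2: "?\<mu> (L \<inter> (\<lambda>y. y + x) ` L) = ?\<mu> (L \<inter> H) + ?\<mu> (L \<inter> H)"
    unfolding lens using LH(1)
    by (simp add: measure_Un3 negligible_imp_measure0 measure_translation measure_uminus)
  \<comment> \<open>the part of \<open>L\<close> in the cone spanned by \<open>p\<close> and \<open>q\<close> is the cap together with the triangle\<close>
  let ?T = "convex hull {0, ?p, ?q}"
  have T: "?T = C \<inter> {y. c y + d y \<le> 1}"
  proof (intro equalityI subsetI)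
    have sum_le: "a * c y + b * c z + (a * d y + b * d z) \<le> 1"
      if "0 \<le> a" "0 \<le> b" "a + b = 1" "c y + d y \<le> 1" "c z + d z \<le> 1" for a b y z
      using convex_bound_le[OF that(4,5,1,2,3)] by (simp add: algebra_simps)
    have cv: "convex (C \<inter> {y. c y + d y \<le> 1})"
      unfolding convex_def C_def by (auto simp: lin2 intro!: add_nonneg_nonneg mult_nonneg_nonneg sum_le)
    moreover have "{0, ?p, ?q} \<subseteq> C \<inter> {y. c y + d y \<le> 1}"
      using \<kappa>_pos by (auto simp: C_def c_def d_def \<kappa>_def) (auto simp: cross_def)
    ultimately show "y \<in> C \<inter> {y. c y + d y \<le> 1}" if "y \<in> ?T" for y
      using that hull_minimal by (metis (no_types, lifting) subsetD)
    fix y assume y: "y \<in> C \<inter> {y. c y + d y \<le> 1}"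
    have "y = (1 - c y - d y) *\<^sub>R 0 + c y *\<^sub>R ?p + d y *\<^sub>R ?q" using cd[of y] by simp
    then show "y \<in> ?T" unfolding convex_hull_3 using y
      by (intro CollectI exI[of _ "1 - c y - d y"] exI[of _ "c y"] exI[of _ "d y"]) (auto simp: C_def)
  qed
  have TL: "?T \<subseteq> L"
    using boundary_mem convex_L pos[of 0] by (intro hull_minimal) (auto simp: star_body_def intro!: exI[of _ 0] less_imp_le)
  have "?\<mu> ?T = measure lborel ?T"
    by (intro measure_completion) (simp add: borel_closed compact_imp_closed finite_imp_compact_convex_hull)
  also have "\<dots> = \<kappa> / 2"
    using \<kappa>_pos unfolding content_triangle \<kappa>_def cross_def by (simp add: algebra_simps)
  finally have muT: "?\<mu> ?T = \<kappa> / 2" .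
  have T_meas: "?T \<in> lmeasurable"
    by (intro lmeasurable_compact finite_imp_compact_convex_hull) simp
  have "L \<inter> C = (L \<inter> H) \<union> ?T"
    using beyond_chord(1,2)[OF ab cd] TL unfolding T H_def C_def by auto
  moreover have "negligible (L \<inter> H \<inter> ?T)"
    by (rule negligible_subset[OF line]) (auto simp: T H_def)
  ultimately have LC: "?\<mu> (L \<inter> C) = ?\<mu> (L \<inter> H) + ?\<mu> ?T"
    using LH(1) T_meas by (simp add: measure_Un3 negligible_imp_measure0)
  have sec: "sector \<rho> \<alpha> \<beta> \<subseteq> L \<inter> C"
  proof
    fix y assume "y \<in> sector \<rho> \<alpha> \<beta>"
    then obtain r v where v: "y = polar r v" "\<alpha> \<le> v" "v < \<beta>" "0 < r" "r \<le> \<rho> v" by (auto simp: sector_def)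
    then have "0 \<le> sin (\<beta> - v)" "0 \<le> sin (v - \<alpha>)" using ab by (auto intro!: sin_ge_zero)
    then have "y \<in> C"
      using v(4) \<kappa>_pos pos[of \<alpha>] pos[of \<beta>] by (simp add: C_def c_def d_def v(1) cross_polar)
    then show "y \<in> L \<inter> C" using v polar_mem_iff by auto
  qed
  moreover have "L \<inter> C - sector \<rho> \<alpha> \<beta> \<subseteq> {y. cross (polar 1 \<beta>) y = 0}"
  proof
    fix y assume y: "y \<in> L \<inter> C - sector \<rho> \<alpha> \<beta>"
    show "y \<in> {y. cross (polar 1 \<beta>) y = 0}"
    proof (cases "y = 0")
      case False
      have "cross y ?q = \<rho> \<beta> * cross y (polar 1 \<beta>)" "cross ?p y = \<rho> \<alpha> * cross (polar 1 \<alpha>) y"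
        by (simp_all add: cross_def algebra_simps)
      then have "0 \<le> cross y (polar 1 \<beta>)" "0 \<le> cross (polar 1 \<alpha>) y"
        using y \<kappa>_pos pos[of \<alpha>] pos[of \<beta>] by (auto simp: C_def c_def d_def zero_le_divide_iff zero_le_mult_iff)
      then obtain v where v: "\<alpha> \<le> v" "v \<le> \<beta>" "y = polar (norm y) v"
        using cone_polar[OF ab False] by metis
      have "norm y \<le> \<rho> v" using y v(3) False polar_mem_iff[of "norm y" v] by auto
      then have "v = \<beta>" using y v False unfolding sector_def by fastforce
      then have "cross (polar 1 \<beta>) y = cross (polar 1 \<beta>) (polar (norm y) \<beta>)" using v(3) by simp
      then show ?thesis by (simp add: cross_polar)
    qed (simp add: cross_def)
  qed
  then have "negligible (L \<inter> C - sector \<rho> \<alpha> \<beta>)"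
    by (rule negligible_subset[rotated]) (rule negligible_cross_line, simp)
  ultimately have "?\<mu> (sector \<rho> \<alpha> \<beta>) = ?\<mu> (L \<inter> C)"
    by (intro measure_negligible_symdiff LH(2)) (simp add: Diff_eq_empty_iff[THEN iffD2])
  then show ?thesis using LC muT lens2 \<kappa> by simp
qed

text \<open>The covariogram of \<open>L\<close>. It decreases along rays, strictly so as long as it is positive: a decrement is the area of a set
that a translation moves into the set of any earlier decrement of the same length, so decrements do not increase, and
a vanishing one would persist and contradict boundedness.\<close>

definition cov :: "real^2 \<Rightarrow> real" where
  "cov x = measure lebesgue (L \<inter> (\<lambda>y. y + x) ` L)"

lemma overlap_eq: "L \<inter> (\<lambda>y. y + x) ` L = {y \<in> L. y - x \<in> L}"
  by (auto intro: image_eqI[of _ _ "_ - x"])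

lemma overlap_lmeasurable: "{y \<in> L. y - x \<in> L} \<in> lmeasurable"
  unfolding overlap_eq[symmetric]
  by (intro lmeasurable_compact compact_Int compact_L compact_continuous_image continuous_intros)

lemma cov_eq: "cov x = measure lebesgue {y \<in> L. y - x \<in> L}"
  unfolding cov_def overlap_eq ..

lemma segment_mem:
  assumes "y - a *\<^sub>R x \<in> L" "y - c *\<^sub>R x \<in> L" "a \<le> b" "b \<le> c"
  shows "y - b *\<^sub>R x \<in> L"
proof (cases "a = c")
  case False
  then have "a < c" using assms by simp
  define k where "k = (b - a) / (c - a)"
  have k: "0 \<le> k" "k \<le> 1" using assms \<open>a < c\<close> by (auto simp: k_def)
  have b: "b = (1 - k) * a + k * c"
    using \<open>a < c\<close> by (simp add: k_def divide_simps) (simp add: algebra_simps)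
  have "(1 - k) *\<^sub>R (y - a *\<^sub>R x) + k *\<^sub>R (y - c *\<^sub>R x) \<in> L"
    using k assms by (intro convexD[OF convex_L]) auto
  then show ?thesis by (simp add: b algebra_simps)
qed (use assms in auto)

lemma cov_decrement:
  assumes "0 \<le> a" "a \<le> b"
  shows "cov (a *\<^sub>R x) - cov (b *\<^sub>R x) =
    measure lebesgue {y \<in> L. y - a *\<^sub>R x \<in> L \<and> y - b *\<^sub>R x \<notin> L}"
    "{y \<in> L. y - a *\<^sub>R x \<in> L \<and> y - b *\<^sub>R x \<notin> L} \<in> lmeasurable"
proof -
  have sub: "{y \<in> L. y - b *\<^sub>R x \<in> L} \<subseteq> {y \<in> L. y - a *\<^sub>R x \<in> L}"
    using segment_mem[of _ 0 x b a] assms by auto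
  have eq: "{y \<in> L. y - a *\<^sub>R x \<in> L \<and> y - b *\<^sub>R x \<notin> L} = {y \<in> L. y - a *\<^sub>R x \<in> L} - {y \<in> L. y - b *\<^sub>R x \<in> L}"
    by auto
  show "cov (a *\<^sub>R x) - cov (b *\<^sub>R x) =
    measure lebesgue {y \<in> L. y - a *\<^sub>R x \<in> L \<and> y - b *\<^sub>R x \<notin> L}"
    unfolding eq cov_eq by (rule measurable_measure_Diff[symmetric, OF overlap_lmeasurable _ sub])
      (rule fmeasurableD[OF overlap_lmeasurable])
  show "{y \<in> L. y - a *\<^sub>R x \<in> L \<and> y - b *\<^sub>R x \<notin> L} \<in> lmeasurable"
    unfolding eq by (intro fmeasurable.Diff overlap_lmeasurable)
qed

lemma cov_mono:
  assumes "0 \<le> a" "a \<le> b" shows "cov (b *\<^sub>R x) \<le> cov (a *\<^sub>R x)"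
  using cov_decrement(1)[OF assms, of x] by (smt (verit) measure_nonneg)

lemma cov_decrement_antimono:
  assumes "0 \<le> a" "a \<le> b" "0 \<le> e"
  shows "cov ((a + e) *\<^sub>R x) - cov ((b + e) *\<^sub>R x) \<le> cov (a *\<^sub>R x) - cov (b *\<^sub>R x)"
proof -
  let ?V = "\<lambda>a b. {y \<in> L. y - a *\<^sub>R x \<in> L \<and> y - b *\<^sub>R x \<notin> L}"
  have "?V (a + e) (b + e) \<subseteq> (+) (e *\<^sub>R x) ` ?V a b"
  proof
    fix y assume y: "y \<in> ?V (a + e) (b + e)"
    then have "y - e *\<^sub>R x \<in> L" using segment_mem[of y 0 x "a + e" e] assms by auto
    then have "y - e *\<^sub>R x \<in> ?V a b" using y by (simp add: algebra_simps)
    then show "y \<in> (+) (e *\<^sub>R x) ` ?V a b" by (intro image_eqI[of _ _ "y - e *\<^sub>R x"]) auto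
  qed
  then have "measure lebesgue (?V (a + e) (b + e)) \<le> measure lebesgue ((+) (e *\<^sub>R x) ` ?V a b)"
    using cov_decrement(2) assms
    by (intro measure_mono_fmeasurable measurable_translation fmeasurableD) auto
  also have "\<dots> = measure lebesgue (?V a b)" by (rule measure_translation)
  finally show ?thesis using cov_decrement(1) assms by simp
qed

lemma cov_strict:
  assumes "x \<noteq> 0" "0 < cov x" "1 < b"
  shows "cov (b *\<^sub>R x) < cov x"
proof (rule ccontr)
  assume "\<not> cov (b *\<^sub>R x) < cov x"
  then have flat: "cov x - cov (b *\<^sub>R x) \<le> 0" by simp
  have lower: "cov x \<le> cov ((1 + real k * (b - 1)) *\<^sub>R x)" for k
  proof (induction k)
    case (Suc k)
    have "cov ((1 + real k * (b - 1)) *\<^sub>R x) - cov ((b + real k * (b - 1)) *\<^sub>R x) \<le> 0"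
      using cov_decrement_antimono[of 1 b "real k * (b - 1)" x] assms flat by simp
    then show ?case using Suc by (simp add: algebra_simps)
  qed simp
  obtain B where B: "\<And>y. y \<in> L \<Longrightarrow> norm y \<le> B" using bounded_L by (auto simp: bounded_iff)
  obtain k where k: "2 * B / (norm x * (b - 1)) < real k" using reals_Archimedean2 by blast
  have pos: "0 < norm x * (b - 1)" using assms by simp
  let ?a = "1 + real k * (b - 1)"
  have "{y \<in> L. y - ?a *\<^sub>R x \<in> L} = {}"
  proof (rule ccontr)
    assume "{y \<in> L. y - ?a *\<^sub>R x \<in> L} \<noteq> {}"
    then obtain y where "y \<in> L" "y - ?a *\<^sub>R x \<in> L" by blast
    then have "norm (?a *\<^sub>R x) \<le> 2 * B"
      using B[of y] B[of "y - ?a *\<^sub>R x"] norm_triangle_ineq4[of y "y - ?a *\<^sub>R x"] by simp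
    moreover have "norm (?a *\<^sub>R x) = norm x + real k * (norm x * (b - 1))"
    proof -
      have "0 < ?a" using assms by (intro add_pos_nonneg) auto
      then show ?thesis unfolding norm_scaleR by (simp add: algebra_simps)
    qed
    moreover have "2 * B < real k * (norm x * (b - 1))" using k pos by (simp add: pos_divide_less_eq)
    ultimately show False using norm_ge_zero[of x] by linarith
  qed
  then have "cov (?a *\<^sub>R x) = 0" unfolding cov_eq by (simp only: measure_empty)
  then show False using lower[of k] assms by simp
qed

end

section \<open>Area of a superlevel set of the covariogram\<close>

text \<open>A continuous map on a compact set is a quotient map onto its image.\<close>

lemma continuous_on_image_compact:
  fixes \<theta> :: "'a::t2_space \<Rightarrow> 'b::t2_space" and r :: "'b \<Rightarrow> 'c::topological_space"
  assumes "compact K" "continuous_on K \<theta>" "continuous_on K (\<lambda>x. r (\<theta> x))"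
  shows "continuous_on (\<theta> ` K) r"
proof -
  have K: "closed (\<theta> ` K)"
    using assms by (intro compact_imp_closed compact_continuous_image)
  have "closed (r -` B \<inter> \<theta> ` K)" if "closed B" for B
  proof -
    have "closed ((\<lambda>x. r (\<theta> x)) -` B \<inter> K)"
      using assms(3) that compact_imp_closed[OF assms(1)] continuous_on_closed_vimage by blast
    then have "compact ((\<lambda>x. r (\<theta> x)) -` B \<inter> K)"
      using assms(1) compact_Int_closed[of K] by (metis Int_left_absorb inf_commute)
    then have "closed (\<theta> ` ((\<lambda>x. r (\<theta> x)) -` B \<inter> K))"
      using assms(2) by (intro compact_imp_closed compact_continuous_image) (auto intro: continuous_on_subset)
    moreover have "\<theta> ` ((\<lambda>x. r (\<theta> x)) -` B \<inter> K) = r -` B \<inter> \<theta> ` K" by auto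
    ultimately show ?thesis by simp
  qed
  then show ?thesis using continuous_on_closed_vimage[OF K] by blast
qed

context polar_convex
begin

text \<open>A closed curve \<open>R, \<theta>\<close> in polar coordinates that winds once around the origin inside a level set of the covariogram
bounds the superlevel set. The angle \<open>\<theta>\<close> need not be monotone: by strict decrease along rays, the
radius is a function \<open>r\<close> of the angle alone, and the antiderivative of \<open>r\<^sup>2 / 2\<close> is composed with \<open>\<theta>\<close>.\<close>

lemma measure_superlevel_cov:
  assumes cont: "continuous_on {a..b} R" and R: "\<And>\<phi>. \<phi> \<in> {a..b} \<Longrightarrow> 0 < R \<phi>"
    and \<theta>: "\<And>\<phi>. \<phi> \<in> {a..b} \<Longrightarrow> (\<theta> has_real_derivative \<theta>' \<phi>) (at \<phi> within {a..b})"
    and ab: "a \<le> b" "\<theta> b = \<theta> a + 2 * pi"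
    and level: "\<And>\<phi>. \<phi> \<in> {a..b} \<Longrightarrow> cov (polar (R \<phi>) (\<theta> \<phi>)) = \<kappa>" "0 < \<kappa>"
    and V: "\<And>\<phi>. \<phi> \<in> {a..b} \<Longrightarrow> (V has_real_derivative (R \<phi>)\<^sup>2 * \<theta>' \<phi> / 2) (at \<phi> within {a..b})"
  shows "measure lebesgue {x. \<kappa> \<le> cov x} = V b - V a"
proof -
  let ?C = "{x. \<kappa> \<le> cov x}"
  define r where "r t = Sup {s. 0 \<le> s \<and> polar s t \<in> ?C}" for t
  have mem: "polar s (\<theta> \<phi>) \<in> ?C \<longleftrightarrow> s \<le> R \<phi>" if "\<phi> \<in> {a..b}" "0 \<le> s" for s \<phi>
  proof -
    let ?x = "polar (R \<phi>) (\<theta> \<phi>)"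
    have eq: "polar s (\<theta> \<phi>) = (s / R \<phi>) *\<^sub>R ?x" using R[OF that(1)] by (simp add: polar_scale)
    show ?thesis
    proof (cases "s \<le> R \<phi>")
      case True
      then have "cov (1 *\<^sub>R ?x) \<le> cov ((s / R \<phi>) *\<^sub>R ?x)"
        using R[OF that(1)] that(2) by (intro cov_mono) auto
      then show ?thesis using True level(1)[OF that(1)] eq by simp
    next
      case False
      then have "cov ((s / R \<phi>) *\<^sub>R ?x) < cov ?x"
        using R[OF that(1)] level(1)[OF that(1)] level(2) by (intro cov_strict) auto
      then show ?thesis using False level(1)[OF that(1)] eq by simp
    qed
  qed
  have r: "r (\<theta> \<phi>) = R \<phi>" if "\<phi> \<in> {a..b}" for \<phi>
  proof -
    have "{s. 0 \<le> s \<and> polar s (\<theta> \<phi>) \<in> ?C} = {0..R \<phi>}" using mem[OF that] by auto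
    then show ?thesis using R[OF that] by (simp add: r_def)
  qed
  have \<theta>_cont: "continuous_on {a..b} \<theta>"
    using \<theta> by (meson DERIV_continuous continuous_on_eq_continuous_within)
  have r_cont: "continuous_on (\<theta> ` {a..b}) r"
    using cont r by (intro continuous_on_image_compact \<theta>_cont) (auto cong: continuous_on_cong_simp)
  have "connected (\<theta> ` {a..b})" "compact (\<theta> ` {a..b})"
    by (intro connected_continuous_image compact_continuous_image \<theta>_cont; simp)+
  then obtain c d where cd: "\<theta> ` {a..b} = {c..d}" using connected_compact_interval_1 by metis
  have end_mem: "\<theta> a \<in> {c..d}" "\<theta> b \<in> {c..d}" unfolding cd[symmetric] using ab(1) by auto
  have "continuous_on {c..d} (\<lambda>t. (r t)\<^sup>2 / 2)"
    by (intro continuous_intros r_cont[unfolded cd]) simp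
  then obtain M where "\<And>t. t \<in> {c..d} \<Longrightarrow> (M has_vector_derivative (r t)\<^sup>2 / 2) (at t within {c..d})"
    using antiderivative_continuous by metis
  then have M: "(M has_real_derivative (r t)\<^sup>2 / 2) (at t within {c..d})" if "t \<in> {c..d}" for t
    using that by (simp add: has_real_derivative_iff_has_vector_derivative)
  have sub: "{\<theta> a..\<theta> a + 2 * pi} \<subseteq> {c..d}" using end_mem ab by auto
  have r_pos: "0 < r t" if "t \<in> {c..d}" for t
    using that r R unfolding cd[symmetric] by fastforce
  have "\<exists>k. \<forall>\<phi>\<in>{a..b}. M (\<theta> \<phi>) - V \<phi> = k"
  proof (rule has_field_derivative_zero_constant)
    fix \<phi> assume \<phi>: "\<phi> \<in> {a..b}"
    have "(M \<circ> \<theta> has_real_derivative (r (\<theta> \<phi>))\<^sup>2 / 2 * \<theta>' \<phi>) (at \<phi> within {a..b})"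
      using \<phi> cd by (intro DERIV_image_chain \<theta>) (auto intro!: M)
    then have "((\<lambda>\<phi>. M (\<theta> \<phi>)) has_real_derivative (R \<phi>)\<^sup>2 * \<theta>' \<phi> / 2) (at \<phi> within {a..b})"
      using r[OF \<phi>] by (simp add: o_def)
    from DERIV_diff[OF this V[OF \<phi>]] show "((\<lambda>\<phi>. M (\<theta> \<phi>) - V \<phi>) has_real_derivative 0) (at \<phi> within {a..b})"
      by simp
  qed simp
  then obtain k where "\<forall>\<phi>\<in>{a..b}. M (\<theta> \<phi>) - V \<phi> = k" ..
  then have "M (\<theta> b) - V b = M (\<theta> a) - V a" using ab(1) by auto
  moreover have "measure lebesgue (sector r (\<theta> a) (\<theta> a + 2 * pi)) = M (\<theta> a + 2 * pi) - M (\<theta> a)"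
  proof (rule measure_sector)
    show "continuous_on {\<theta> a..\<theta> a + 2 * pi} r"
      using r_cont sub unfolding cd by (rule continuous_on_subset)
    show "(M has_real_derivative (r v)\<^sup>2 / 2) (at v within {\<theta> a..\<theta> a + 2 * pi})"
      if "v \<in> {\<theta> a..\<theta> a + 2 * pi}" for v
      using M[of v] sub that by (meson DERIV_subset subsetD)
  qed (use r_pos sub in \<open>auto intro: less_imp_le\<close>)
  moreover have "measure lebesgue ?C = measure lebesgue (sector r (\<theta> a) (\<theta> a + 2 * pi))"
  proof (rule measure_negligible_symdiff)
    show "sector r (\<theta> a) (\<theta> a + 2 * pi) \<in> lmeasurable"
      using r_cont sub r_pos unfolding cd
      by (intro sector_lmeasurable) (auto intro: continuous_on_subset less_imp_le)
    have "sector r (\<theta> a) (\<theta> a + 2 * pi) \<subseteq> ?C"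
    proof
      fix x assume "x \<in> sector r (\<theta> a) (\<theta> a + 2 * pi)"
      then obtain s t where s: "x = polar s t" "t \<in> {\<theta> a..\<theta> a + 2 * pi}" "0 < s" "s \<le> r t"
        by (auto simp: sector_def)
      then obtain \<phi> where "\<phi> \<in> {a..b}" "t = \<theta> \<phi>" using sub cd by blast
      then show "x \<in> ?C" using s mem[of \<phi> s] r[of \<phi>] by auto
    qed
    moreover have "?C - sector r (\<theta> a) (\<theta> a + 2 * pi) \<subseteq> {0}"
    proof (rule ccontr)
      assume "\<not> ?C - sector r (\<theta> a) (\<theta> a + 2 * pi) \<subseteq> {0}"
      then obtain x where x: "x \<in> ?C" "x \<notin> sector r (\<theta> a) (\<theta> a + 2 * pi)" "x \<noteq> 0" by blast
      then obtain t where t: "\<theta> a \<le> t" "t < \<theta> a + 2 * pi" "x = polar (norm x) t"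
        using polar_exists by metis
      then have "t \<in> {\<theta> a..\<theta> a + 2 * pi}" by auto
      then obtain \<phi> where \<phi>: "\<phi> \<in> {a..b}" "t = \<theta> \<phi>" using sub cd by blast
      then have "norm x \<le> r t" using x(1) t(3) mem[of \<phi> "norm x"] r[of \<phi>] by auto
      then have "x \<in> sector r (\<theta> a) (\<theta> a + 2 * pi)"
        unfolding sector_def using t x(3) by (intro CollectI exI[of _ "norm x"] exI[of _ t]) auto
      then show False using x by simp
    qed
    ultimately show "negligible (sector r (\<theta> a) (\<theta> a + 2 * pi) - ?C \<union> (?C - sector r (\<theta> a) (\<theta> a + 2 * pi)))"
      by (intro negligible_subset[OF negligible_sing[of 0]]) auto
  qed
  ultimately show ?thesis using ab by simp
qed

end

section \<open>Implicit functions of one variable with two parameters\<close>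

text \<open>The derivative of an implicit function already known to be continuous.\<close>

lemma implicit_has_derivative:
  fixes E :: "real \<Rightarrow> real \<Rightarrow> real" and H :: "real \<Rightarrow> real"
  assumes zero: "\<forall>\<^sub>F \<tau> in nhds \<tau>0. E \<tau> (H \<tau>) = 0"
    and H: "isCont H \<tau>0"
    and E\<tau>: "((\<lambda>\<tau>. E \<tau> (H \<tau>0)) has_real_derivative e) (at \<tau>0)"
    and Eh: "\<And>\<tau> h. (E \<tau> has_real_derivative Eh \<tau> h) (at h)"
    and cont: "continuous_on UNIV (\<lambda>(\<tau>, h). Eh \<tau> h)"
    and nz: "Eh \<tau>0 (H \<tau>0) \<noteq> 0"
  shows "(H has_real_derivative - e / Eh \<tau>0 (H \<tau>0)) (at \<tau>0)"
proof -
  have "\<exists>\<xi>. \<bar>\<xi> - H \<tau>0\<bar> \<le> \<bar>H \<tau> - H \<tau>0\<bar> \<and> E \<tau> (H \<tau>) - E \<tau> (H \<tau>0) = Eh \<tau> \<xi> * (H \<tau> - H \<tau>0)" for \<tau>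
  proof -
    consider "H \<tau> = H \<tau>0" | "H \<tau>0 < H \<tau>" | "H \<tau> < H \<tau>0" by linarith
    then show ?thesis
    proof cases
      case 2
      from MVT2[OF 2 Eh[of \<tau>]] obtain z where "H \<tau>0 < z" "z < H \<tau>" "E \<tau> (H \<tau>) - E \<tau> (H \<tau>0) = (H \<tau> - H \<tau>0) * Eh \<tau> z" by auto
      then show ?thesis by (intro exI[of _ z]) auto
    next
      case 3
      from MVT2[OF 3 Eh[of \<tau>]] obtain z where "H \<tau> < z" "z < H \<tau>0" "E \<tau> (H \<tau>0) - E \<tau> (H \<tau>) = (H \<tau>0 - H \<tau>) * Eh \<tau> z" by auto
      then show ?thesis by (intro exI[of _ z]) (auto simp: algebra_simps)
    qed auto
  qed
  then obtain \<xi> where \<xi>: "\<bar>\<xi> \<tau> - H \<tau>0\<bar> \<le> \<bar>H \<tau> - H \<tau>0\<bar>"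
    "E \<tau> (H \<tau>) - E \<tau> (H \<tau>0) = Eh \<tau> (\<xi> \<tau>) * (H \<tau> - H \<tau>0)" for \<tau> by metis
  have "((\<lambda>\<tau>. H \<tau> - H \<tau>0) \<longlongrightarrow> 0) (at \<tau>0)"
    using H unfolding isCont_def by (simp add: LIM_zero_iff)
  then have "((\<lambda>\<tau>. \<xi> \<tau> - H \<tau>0) \<longlongrightarrow> 0) (at \<tau>0)"
    by (rule Lim_null_comparison[rotated, OF tendsto_rabs_zero]) (use \<xi>(1) in auto)
  then have "((\<lambda>\<tau>. (\<tau>, \<xi> \<tau>)) \<longlongrightarrow> (\<tau>0, H \<tau>0)) (at \<tau>0)"
    by (intro tendsto_Pair tendsto_ident_at) (simp add: LIM_zero_iff)
  moreover have "isCont (\<lambda>(\<tau>, h). Eh \<tau> h) (\<tau>0, H \<tau>0)"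
    using cont by (simp add: continuous_on_eq_continuous_at)
  ultimately have lim: "((\<lambda>\<tau>. Eh \<tau> (\<xi> \<tau>)) \<longlongrightarrow> Eh \<tau>0 (H \<tau>0)) (at \<tau>0)"
    using isCont_tendsto_compose by fastforce
  have lim2: "((\<lambda>\<tau>. - ((E \<tau> (H \<tau>0) - E \<tau>0 (H \<tau>0)) / (\<tau> - \<tau>0)) / Eh \<tau> (\<xi> \<tau>)) \<longlongrightarrow> - e / Eh \<tau>0 (H \<tau>0)) (at \<tau>0)"
    using E\<tau> lim nz unfolding has_field_derivative_iff by (intro tendsto_divide tendsto_minus)
  have "E \<tau>0 (H \<tau>0) = 0" using zero by (rule eventually_nhds_x_imp_x)
  have ev1: "\<forall>\<^sub>F \<tau> in at \<tau>0. Eh \<tau> (\<xi> \<tau>) \<noteq> 0"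
    using lim nz by (rule tendsto_imp_eventually_ne)
  have ev2: "\<forall>\<^sub>F \<tau> in at \<tau>0. E \<tau> (H \<tau>) = 0"
    using zero by (simp add: eventually_nhds_conv_at)
  have "\<forall>\<^sub>F \<tau> in at \<tau>0. - ((E \<tau> (H \<tau>0) - E \<tau>0 (H \<tau>0)) / (\<tau> - \<tau>0)) / Eh \<tau> (\<xi> \<tau>)
      = (H \<tau> - H \<tau>0) / (\<tau> - \<tau>0)"
    using ev1 ev2
  proof eventually_elim
    case (elim \<tau>)
    then have "- E \<tau> (H \<tau>0) / Eh \<tau> (\<xi> \<tau>) = H \<tau> - H \<tau>0"
      using \<xi>(2)[of \<tau>] by (simp add: divide_eq_eq mult.commute)
    then show ?case
      using \<open>E \<tau>0 (H \<tau>0) = 0\<close> by (metis (no_types, lifting) diff_zero divide_divide_eq_left' divide_divide_eq_left minus_divide_left)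
  qed
  with lim2 show ?thesis
    unfolding has_field_derivative_iff by (rule Lim_transform_eventually)
qed

text \<open>Solutions \<open>h = H \<phi> s\<close> of \<open>E \<phi> h s = 0\<close> near \<open>h = h0\<close>, \<open>s = 0\<close>, for all \<open>\<phi>\<close> in a compact set with
a common range \<open>|s| \<le> \<sigma>\<close>. Continuity of \<open>H\<close> holds because its graph is closed in a compact set.\<close>

lemma implicit_function_exists:
  fixes E Eh :: "real \<Rightarrow> real \<Rightarrow> real \<Rightarrow> real"
  assumes "compact K"
    and contE: "continuous_on UNIV (\<lambda>(\<phi>, h, s). E \<phi> h s)"
    and contEh: "continuous_on UNIV (\<lambda>(\<phi>, h, s). Eh \<phi> h s)"
    and Eh: "\<And>\<phi> h s. ((\<lambda>h. E \<phi> h s) has_real_derivative Eh \<phi> h s) (at h)"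
    and E0: "\<And>\<phi>. \<phi> \<in> K \<Longrightarrow> E \<phi> h0 0 = 0" and Eh0: "\<And>\<phi>. \<phi> \<in> K \<Longrightarrow> 0 < Eh \<phi> h0 0"
    and "0 < \<eta>0"
  obtains \<sigma> \<eta> H where "0 < \<sigma>" "0 < \<eta>" "\<eta> \<le> \<eta>0"
    "\<And>\<phi> h s. \<phi> \<in> K \<Longrightarrow> \<bar>s\<bar> \<le> \<sigma> \<Longrightarrow> \<bar>h - h0\<bar> \<le> \<eta> \<Longrightarrow> 0 < Eh \<phi> h s"
    "\<And>\<phi> s. \<phi> \<in> K \<Longrightarrow> \<bar>s\<bar> \<le> \<sigma> \<Longrightarrow> \<bar>H \<phi> s - h0\<bar> \<le> \<eta> \<and> E \<phi> (H \<phi> s) s = 0"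
    "\<And>\<phi> h s. \<phi> \<in> K \<Longrightarrow> \<bar>s\<bar> \<le> \<sigma> \<Longrightarrow> \<bar>h - h0\<bar> \<le> \<eta> \<Longrightarrow> E \<phi> h s = 0 \<Longrightarrow> h = H \<phi> s"
    "continuous_on (K \<times> {-\<sigma>..\<sigma>}) (\<lambda>(\<phi>, s). H \<phi> s)"
proof -
  have tube: "\<exists>d>0. \<forall>\<phi>\<in>K. \<forall>h s. \<bar>h - h1\<bar> + \<bar>s\<bar> < d \<longrightarrow> 0 < F \<phi> h s"
    if F: "continuous_on UNIV (\<lambda>(\<phi>, h, s). F \<phi> h s :: real)" and pos: "\<And>\<phi>. \<phi> \<in> K \<Longrightarrow> 0 < F \<phi> h1 0" for F :: "real \<Rightarrow> real \<Rightarrow> real \<Rightarrow> real" and h1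
  proof -
    define A where "A = (\<lambda>\<phi>. (\<phi>, h1, 0 :: real)) ` K"
    define B where "B = {p. (\<lambda>(\<phi>, h, s). F \<phi> h s) p \<le> 0}"
    have cl: "closed B" unfolding B_def
      by (intro closed_Collect_le F continuous_on_const)
    moreover have "compact A" unfolding A_def
      by (intro compact_continuous_image continuous_intros \<open>compact K\<close>)
    moreover have "A \<inter> B = {}" using pos unfolding A_def B_def by force
    ultimately obtain d where d: "d > 0" "\<And>x y. x \<in> A \<Longrightarrow> y \<in> B \<Longrightarrow> d \<le> dist x y"
      using separate_compact_closed[of A B] by blast
    have "0 < F \<phi> h s" if "\<phi> \<in> K" "\<bar>h - h1\<bar> + \<bar>s\<bar> < d" for \<phi> h s
    proof (rule ccontr)
      assume "\<not> 0 < F \<phi> h s"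
      then have "(\<phi>, h, s) \<in> B" "(\<phi>, h1, 0) \<in> A" using that(1) by (auto simp: A_def B_def)
      then have "d \<le> dist (\<phi>, h1, 0) (\<phi>, h, s)" using d(2) by blast
      also have "\<dots> \<le> \<bar>h - h1\<bar> + \<bar>s\<bar>"
        using sqrt_sum_squares_le_sum_abs[of "h1 - h" s] by (simp add: dist_Pair_Pair dist_real_def abs_minus_commute)
      finally show False using that(2) by simp
    qed
    then show ?thesis using d(1) by blast
  qed
  obtain d1 where d1: "d1 > 0" "\<And>\<phi> h s. \<phi> \<in> K \<Longrightarrow> \<bar>h - h0\<bar> + \<bar>s\<bar> < d1 \<Longrightarrow> 0 < Eh \<phi> h s"
    using tube[OF contEh Eh0] by blast
  define \<eta> where "\<eta> = min \<eta>0 (d1 / 3)"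
  have \<eta>: "0 < \<eta>" "\<eta> \<le> \<eta>0" "\<eta> \<le> d1 / 3" using d1(1) \<open>0 < \<eta>0\<close> by (auto simp: \<eta>_def)
  have mono: "E \<phi> h s < E \<phi> h' s"
    if "\<phi> \<in> K" "\<bar>s\<bar> \<le> d1 / 3" "\<bar>h - h0\<bar> \<le> \<eta>" "\<bar>h' - h0\<bar> \<le> \<eta>" "h < h'" for \<phi> h h' s
    using that(5)
  proof (rule DERIV_pos_imp_increasing)
    fix x assume "h \<le> x" "x \<le> h'"
    then have "\<bar>x - h0\<bar> + \<bar>s\<bar> < d1" using that \<eta> d1(1) by (auto simp: abs_le_iff)
    then show "\<exists>y. ((\<lambda>h. E \<phi> h s) has_real_derivative y) (at x) \<and> 0 < y" using Eh d1(2) that(1) by blast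
  qed
  have "0 < E \<phi> (h0 + \<eta>) 0" "0 < - E \<phi> (h0 - \<eta>) 0" if "\<phi> \<in> K" for \<phi>
    using mono[OF that, of 0 h0 "h0 + \<eta>"] mono[OF that, of 0 "h0 - \<eta>" h0] \<eta> d1(1) E0[OF that] by auto
  moreover have "continuous_on UNIV (\<lambda>(\<phi>, h, s). - E \<phi> h s)"
    using continuous_on_minus[OF contE] by (simp add: case_prod_beta')
  ultimately obtain d2 d3 where d2: "d2 > 0" "\<And>\<phi> h s. \<phi> \<in> K \<Longrightarrow> \<bar>h - (h0 + \<eta>)\<bar> + \<bar>s\<bar> < d2 \<Longrightarrow> 0 < E \<phi> h s"
    and d3: "d3 > 0" "\<And>\<phi> h s. \<phi> \<in> K \<Longrightarrow> \<bar>h - (h0 - \<eta>)\<bar> + \<bar>s\<bar> < d3 \<Longrightarrow> 0 < - E \<phi> h s"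
    using tube[OF contE, of "h0 + \<eta>"] tube[of "\<lambda>\<phi> h s. - E \<phi> h s" "h0 - \<eta>"] by metis
  define \<sigma> where "\<sigma> = min (d1 / 3) (min (d2 / 2) (d3 / 2))"
  have \<sigma>: "0 < \<sigma>" "\<sigma> \<le> d1 / 3" "\<sigma> < d2" "\<sigma> < d3" using d1 d2 d3 by (auto simp: \<sigma>_def)
  have "\<exists>h. \<bar>h - h0\<bar> \<le> \<eta> \<and> E \<phi> h s = 0" if "\<phi> \<in> K" "\<bar>s\<bar> \<le> \<sigma>" for \<phi> s
  proof -
    have "\<exists>h\<ge>h0 - \<eta>. h \<le> h0 + \<eta> \<and> E \<phi> h s = 0"
    proof (rule IVT)
      show "E \<phi> (h0 - \<eta>) s \<le> 0" "0 \<le> E \<phi> (h0 + \<eta>) s"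
        using d2(2)[OF that(1), of "h0 + \<eta>" s] d3(2)[OF that(1), of "h0 - \<eta>" s] that(2) \<sigma> by auto
      show "h0 - \<eta> \<le> h0 + \<eta>" using \<eta> by simp
      show "\<forall>x. h0 - \<eta> \<le> x \<and> x \<le> h0 + \<eta> \<longrightarrow> isCont (\<lambda>h. E \<phi> h s) x"
        using Eh DERIV_isCont by blast
    qed
    then obtain h where "h0 - \<eta> \<le> h" "h \<le> h0 + \<eta>" "E \<phi> h s = 0" by blast
    then show ?thesis by (intro exI[of _ h]) (auto simp: abs_le_iff)
  qed
  then obtain H where H: "\<And>\<phi> s. \<phi> \<in> K \<Longrightarrow> \<bar>s\<bar> \<le> \<sigma> \<Longrightarrow> \<bar>H \<phi> s - h0\<bar> \<le> \<eta> \<and> E \<phi> (H \<phi> s) s = 0" by metis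
  have uniq: "h = H \<phi> s" if "\<phi> \<in> K" "\<bar>s\<bar> \<le> \<sigma>" "\<bar>h - h0\<bar> \<le> \<eta>" "E \<phi> h s = 0" for \<phi> h s
    using mono[OF that(1), of s h "H \<phi> s"] mono[OF that(1), of s "H \<phi> s" h] H[OF that(1,2)] that \<sigma>
    by (cases h "H \<phi> s" rule: linorder_cases) auto
  have "continuous_on (K \<times> {-\<sigma>..\<sigma>}) (\<lambda>(\<phi>, s). H \<phi> s)"
  proof (rule continuous_from_closed_graph)
    show "compact {h0 - \<eta>..h0 + \<eta>}" by simp
    show "(\<lambda>(\<phi>, s). H \<phi> s) \<in> K \<times> {-\<sigma>..\<sigma>} \<rightarrow> {h0 - \<eta>..h0 + \<eta>}"
      using H by (fastforce simp: abs_le_iff)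
    have "(\<lambda>x. (x, (\<lambda>(\<phi>, s). H \<phi> s) x)) ` (K \<times> {-\<sigma>..\<sigma>})
      = ((K \<times> {-\<sigma>..\<sigma>}) \<times> {h0 - \<eta>..h0 + \<eta>}) \<inter> {p. E (fst (fst p)) (snd p) (snd (fst p)) = 0}"
    proof (intro equalityI subsetI)
      fix p assume "p \<in> (\<lambda>x. (x, (\<lambda>(\<phi>, s). H \<phi> s) x)) ` (K \<times> {-\<sigma>..\<sigma>})"
      then obtain \<phi> s where "p = ((\<phi>, s), H \<phi> s)" "\<phi> \<in> K" "\<bar>s\<bar> \<le> \<sigma>" by (auto simp: abs_le_iff)
      with H[OF this(2,3)] show "p \<in> ((K \<times> {-\<sigma>..\<sigma>}) \<times> {h0 - \<eta>..h0 + \<eta>}) \<inter> {p. E (fst (fst p)) (snd p) (snd (fst p)) = 0}"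
        by (auto simp: abs_le_iff)
    next
      fix p assume "p \<in> ((K \<times> {-\<sigma>..\<sigma>}) \<times> {h0 - \<eta>..h0 + \<eta>}) \<inter> {p. E (fst (fst p)) (snd p) (snd (fst p)) = 0}"
      then obtain \<phi> s h where p: "p = ((\<phi>, s), h)" "\<phi> \<in> K" "\<bar>s\<bar> \<le> \<sigma>" "\<bar>h - h0\<bar> \<le> \<eta>" "E \<phi> h s = 0"
        by (cases p) (fastforce simp: abs_le_iff)
      with uniq[OF p(2-5)] show "p \<in> (\<lambda>x. (x, (\<lambda>(\<phi>, s). H \<phi> s) x)) ` (K \<times> {-\<sigma>..\<sigma>})"
        by (auto intro!: image_eqI[of _ _ "(\<phi>, s)"])
    qed
    moreover have "continuous_on UNIV (\<lambda>p. E (fst (fst p)) (snd p) (snd (fst p)))"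
      using continuous_on_compose2[OF contE, of UNIV "\<lambda>p. (fst (fst p), snd p, snd (fst p))"]
      by (simp add: continuous_intros)
    then have "closed {p. E (fst (fst p)) (snd p) (snd (fst p)) = 0}"
      by (intro closed_Collect_eq continuous_on_const)
    moreover have "closed ((K \<times> {-\<sigma>..\<sigma>}) \<times> {h0 - \<eta>..h0 + \<eta>})"
      by (intro closed_Times compact_imp_closed[OF \<open>compact K\<close>]) auto
    ultimately show "closed ((\<lambda>x. (x, (\<lambda>(\<phi>, s). H \<phi> s) x)) ` (K \<times> {-\<sigma>..\<sigma>}))"
      by (simp only: closed_Int)
  qed
  moreover have "0 < Eh \<phi> h s" if "\<phi> \<in> K" "\<bar>s\<bar> \<le> \<sigma>" "\<bar>h - h0\<bar> \<le> \<eta>" for \<phi> h s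
    using d1(2)[OF that(1), of h s] that \<sigma> \<eta> d1(1) by linarith
  ultimately show ?thesis using that[of \<sigma> \<eta> H] \<sigma>(1) \<eta>(1,2) H uniq by blast
qed

section \<open>Second variation of an integral along an implicit function\<close>

text \<open>The functions at hand are quadratic in \<open>s\<close>, with coefficients that are products of a function of \<open>\<phi>\<close>
(\<open>c 1\<close>, \<open>c 2\<close> or \<open>1\<close>) and a function of \<open>h\<close> (\<open>f 0\<close> to \<open>f 3\<close>). Differentiating in \<open>h\<close> means
differentiating the \<open>f i\<close>; \<open>quad_s\<close> and \<open>quad_ss\<close> are the first two partial derivatives in \<open>s\<close>.\<close>

definition quad :: "(nat \<Rightarrow> real \<Rightarrow> real) \<Rightarrow> (nat \<Rightarrow> real \<Rightarrow> real) \<Rightarrow> real \<Rightarrow> real \<Rightarrow> real \<Rightarrow> real" where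
  "quad c f \<phi> h s = f 0 h + s * (c 1 \<phi> * f 1 h) + s\<^sup>2 * (f 2 h + c 2 \<phi> * f 3 h)"

definition quad_s :: "(nat \<Rightarrow> real \<Rightarrow> real) \<Rightarrow> (nat \<Rightarrow> real \<Rightarrow> real) \<Rightarrow> real \<Rightarrow> real \<Rightarrow> real \<Rightarrow> real" where
  "quad_s c f \<phi> h s = c 1 \<phi> * f 1 h + 2 * s * (f 2 h + c 2 \<phi> * f 3 h)"

definition quad_ss :: "(nat \<Rightarrow> real \<Rightarrow> real) \<Rightarrow> (nat \<Rightarrow> real \<Rightarrow> real) \<Rightarrow> real \<Rightarrow> real \<Rightarrow> real" where
  "quad_ss c f \<phi> h = 2 * (f 2 h + c 2 \<phi> * f 3 h)"

lemma quad_chain: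
  assumes f: "\<And>i h. (f i has_real_derivative f' i h) (at h)"
    and h: "(h has_real_derivative h') (at s)"
  shows "((\<lambda>s. quad c f \<phi> (h s) s) has_real_derivative quad c f' \<phi> (h s) s * h' + quad_s c f \<phi> (h s) s) (at s)"
    and "((\<lambda>s. quad_s c f \<phi> (h s) s) has_real_derivative quad_s c f' \<phi> (h s) s * h' + quad_ss c f \<phi> (h s)) (at s)"
proof -
  note D = DERIV_chain2[OF f h]
  show "((\<lambda>s. quad c f \<phi> (h s) s) has_real_derivative quad c f' \<phi> (h s) s * h' + quad_s c f \<phi> (h s) s) (at s)"
    unfolding quad_def quad_s_def
    by (rule derivative_eq_intros D refl)+ (simp add: algebra_simps)
  show "((\<lambda>s. quad_s c f \<phi> (h s) s) has_real_derivative quad_s c f' \<phi> (h s) s * h' + quad_ss c f \<phi> (h s)) (at s)"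
    unfolding quad_ss_def quad_s_def
    by (rule derivative_eq_intros D refl)+ (simp add: algebra_simps)
qed

lemma quad_deriv_h:
  assumes f: "\<And>i h. (f i has_real_derivative f' i h) (at h)"
  shows "((\<lambda>h. quad c f \<phi> h s) has_real_derivative quad c f' \<phi> h s) (at h)"
  unfolding quad_def by (rule derivative_eq_intros f refl)+ (simp add: algebra_simps)

lemma continuous_on_quad:
  fixes X :: "'a :: t2_space set"
  assumes c: "\<And>i. continuous_on UNIV (c i)" and f: "\<And>i. continuous_on UNIV (f i)"
    and X: "continuous_on X \<phi>" "continuous_on X h" "continuous_on X s"
  shows "continuous_on X (\<lambda>x. quad c f (\<phi> x) (h x) (s x))"
    "continuous_on X (\<lambda>x. quad_s c f (\<phi> x) (h x) (s x))"
    "continuous_on X (\<lambda>x. quad_ss c f (\<phi> x) (h x))"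
  unfolding quad_def quad_s_def quad_ss_def
  by (intro continuous_intros X continuous_on_compose2[OF c X(1)] continuous_on_compose2[OF f X(2)] subset_UNIV)+

lemma isCont_section:
  fixes H :: "real \<Rightarrow> real \<Rightarrow> real"
  assumes "continuous_on (K \<times> {-\<sigma>..\<sigma>}) (\<lambda>(\<phi>, s). H \<phi> s)"
  shows "\<phi> \<in> K \<Longrightarrow> \<bar>s\<bar> < \<sigma> \<Longrightarrow> isCont (H \<phi>) s"
    and "\<phi> \<in> interior K \<Longrightarrow> \<bar>s\<bar> \<le> \<sigma> \<Longrightarrow> isCont (\<lambda>\<phi>. H \<phi> s) \<phi>"
proof -
  assume \<phi>: "\<phi> \<in> K" and s: "\<bar>s\<bar> < \<sigma>"
  have "continuous_on {-\<sigma>..\<sigma>} (\<lambda>s. (\<lambda>(\<phi>, s). H \<phi> s) (\<phi>, s))"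
    by (rule continuous_on_compose2[OF assms]) (use \<phi> in \<open>auto intro!: continuous_intros\<close>)
  moreover have "s \<in> interior {-\<sigma>..\<sigma>}" using s by (auto simp: interior_atLeastAtMost_real abs_less_iff)
  ultimately show "isCont (H \<phi>) s" using continuous_on_interior by fastforce
next
  assume \<phi>: "\<phi> \<in> interior K" and s: "\<bar>s\<bar> \<le> \<sigma>"
  have "continuous_on K (\<lambda>\<phi>. (\<lambda>(\<phi>, s). H \<phi> s) (\<phi>, s))"
    by (rule continuous_on_compose2[OF assms]) (use s in \<open>auto intro!: continuous_intros simp: abs_le_iff\<close>)
  then show "isCont (\<lambda>\<phi>. H \<phi> s) \<phi>" using continuous_on_interior \<phi> by fastforce
qed

text \<open>First and second derivative at \<open>s = 0\<close> of the integral over \<open>\<phi>\<close> of \<open>quad c j\<close> along the solution \<open>H\<close> of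
\<open>quad c e = 0\<close>; \<open>h1\<close> and \<open>h2\<close> are the first two derivatives of \<open>H\<close> in \<open>s\<close> at \<open>s = 0\<close>, where \<open>H\<close> is the
constant \<open>h0\<close>.\<close>

lemma integral_along_implicit:
  fixes c e e' e'' j j' j'' :: "nat \<Rightarrow> real \<Rightarrow> real" and H :: "real \<Rightarrow> real \<Rightarrow> real"
  assumes c: "\<And>i. continuous_on UNIV (c i)"
    and e: "\<And>i h. (e i has_real_derivative e' i h) (at h)" "\<And>i h. (e' i has_real_derivative e'' i h) (at h)"
      "\<And>i. continuous_on UNIV (e'' i)"
    and j: "\<And>i h. (j i has_real_derivative j' i h) (at h)" "\<And>i h. (j' i has_real_derivative j'' i h) (at h)"
      "\<And>i. continuous_on UNIV (j'' i)"
    and \<sigma>: "0 < \<sigma>"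
    and H: "\<And>\<phi> s. \<phi> \<in> {a..b} \<Longrightarrow> \<bar>s\<bar> \<le> \<sigma> \<Longrightarrow> quad c e \<phi> (H \<phi> s) s = 0"
      "\<And>\<phi> s. \<phi> \<in> {a..b} \<Longrightarrow> \<bar>s\<bar> \<le> \<sigma> \<Longrightarrow> 0 < quad c e' \<phi> (H \<phi> s) s"
      "continuous_on ({a..b} \<times> {-\<sigma>..\<sigma>}) (\<lambda>(\<phi>, s). H \<phi> s)"
      "\<And>\<phi>. \<phi> \<in> {a..b} \<Longrightarrow> H \<phi> 0 = h0"
  defines "h1 \<equiv> \<lambda>\<phi>. - (c 1 \<phi> * e 1 h0) / e' 0 h0"
  defines "h2 \<equiv> \<lambda>\<phi>. - (quad_ss c e \<phi> h0 + 2 * (c 1 \<phi> * e' 1 h0) * h1 \<phi> + e'' 0 h0 * (h1 \<phi>)\<^sup>2) / e' 0 h0"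
  shows "\<exists>A'. (\<forall>s. \<bar>s\<bar> < \<sigma> \<longrightarrow> ((\<lambda>s. integral {a..b} (\<lambda>\<phi>. quad c j \<phi> (H \<phi> s) s)) has_real_derivative A' s) (at s))
    \<and> A' 0 = integral {a..b} (\<lambda>\<phi>. j' 0 h0 * h1 \<phi> + c 1 \<phi> * j 1 h0)
    \<and> (A' has_real_derivative integral {a..b} (\<lambda>\<phi>. j' 0 h0 * h2 \<phi> + j'' 0 h0 * (h1 \<phi>)\<^sup>2
         + 2 * (c 1 \<phi> * j' 1 h0) * h1 \<phi> + quad_ss c j \<phi> h0)) (at 0)"
proof -
  let ?U = "{-\<sigma><..<\<sigma>}"
  have c_e: "\<And>i. continuous_on UNIV (e i)" "\<And>i. continuous_on UNIV (e' i)" "\<And>i. continuous_on UNIV (j i)" "\<And>i. continuous_on UNIV (j' i)"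
    using e(1,2) j(1,2) by (meson DERIV_continuous continuous_at_imp_continuous_on)+
  define D where "D \<phi> s = quad c e' \<phi> (H \<phi> s) s" for \<phi> s
  define H1 where "H1 \<phi> s = - quad_s c e \<phi> (H \<phi> s) s / D \<phi> s" for \<phi> s
  define H2 where "H2 \<phi> s = - ((quad_s c e' \<phi> (H \<phi> s) s * H1 \<phi> s + quad_ss c e \<phi> (H \<phi> s)) * D \<phi> s
      - quad_s c e \<phi> (H \<phi> s) s * (quad c e'' \<phi> (H \<phi> s) s * H1 \<phi> s + quad_s c e' \<phi> (H \<phi> s) s)) / (D \<phi> s * D \<phi> s)" for \<phi> s
  define J1 where "J1 \<phi> s = quad c j' \<phi> (H \<phi> s) s * H1 \<phi> s + quad_s c j \<phi> (H \<phi> s) s" for \<phi> s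
  define J2 where "J2 \<phi> s = (quad c j'' \<phi> (H \<phi> s) s * H1 \<phi> s + quad_s c j' \<phi> (H \<phi> s) s) * H1 \<phi> s
      + quad c j' \<phi> (H \<phi> s) s * H2 \<phi> s + (quad_s c j' \<phi> (H \<phi> s) s * H1 \<phi> s + quad_ss c j \<phi> (H \<phi> s))" for \<phi> s
  have D_pos: "0 < D \<phi> s" if "\<phi> \<in> {a..b}" "s \<in> ?U" for \<phi> s
    using H(2)[of \<phi> s] that by (simp add: D_def abs_le_iff)
  have dH: "(H \<phi> has_real_derivative H1 \<phi> s) (at s)" if \<phi>: "\<phi> \<in> {a..b}" and s: "s \<in> ?U" for \<phi> s
    unfolding H1_def D_def
  proof (rule implicit_has_derivative[where E = "\<lambda>s h. quad c e \<phi> h s" and Eh = "\<lambda>s h. quad c e' \<phi> h s"])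
    have "\<forall>\<^sub>F \<tau> in nhds s. \<tau> \<in> ?U" using s by (intro eventually_nhds_in_open) auto
    then show "\<forall>\<^sub>F \<tau> in nhds s. quad c e \<phi> (H \<phi> \<tau>) \<tau> = 0"
      by eventually_elim (use H(1) \<phi> in \<open>auto simp: abs_le_iff\<close>)
    show "isCont (H \<phi>) s" using isCont_section(1)[OF H(3)] \<phi> s by (auto simp: abs_less_iff)
    show "((\<lambda>\<tau>. quad c e \<phi> (H \<phi> s) \<tau>) has_real_derivative quad_s c e \<phi> (H \<phi> s) s) (at s)"
      using quad_chain(1)[of e e', OF e(1) DERIV_const, where c=c and \<phi>=\<phi> and s=s] by simp
    show "((\<lambda>h. quad c e \<phi> h \<tau>) has_real_derivative quad c e' \<phi> h \<tau>) (at h)" for \<tau> h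
      by (rule quad_deriv_h[of e e', OF e(1)])
    show "continuous_on UNIV (\<lambda>(\<tau>, h). quad c e' \<phi> h \<tau>)"
      unfolding case_prod_beta by (intro continuous_on_quad c c_e continuous_intros)
    show "quad c e' \<phi> (H \<phi> s) s \<noteq> 0" using D_pos[OF that] by (simp add: D_def)
  qed
  have dD: "((\<lambda>s. D \<phi> s) has_real_derivative (quad c e'' \<phi> (H \<phi> s) s * H1 \<phi> s + quad_s c e' \<phi> (H \<phi> s) s)) (at s)"
    if "\<phi> \<in> {a..b}" "s \<in> ?U" for \<phi> s
    unfolding D_def by (rule quad_chain(1)[of e' e'', OF e(2) dH[OF that]])
  have dH1: "((\<lambda>s. H1 \<phi> s) has_real_derivative H2 \<phi> s) (at s)" if "\<phi> \<in> {a..b}" "s \<in> ?U" for \<phi> s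
  proof -
    have "D \<phi> s \<noteq> 0" using D_pos[OF that] by simp
    note der = DERIV_divide[OF DERIV_minus[OF quad_chain(2)[of e e', OF e(1) dH[OF that], where c=c and \<phi>=\<phi>]] dD[OF that] this]
    have eq: "H1 \<phi> = (\<lambda>s. - quad_s c e \<phi> (H \<phi> s) s / D \<phi> s)" by (simp add: H1_def fun_eq_iff)
    show ?thesis
      by (subst eq, rule DERIV_cong[OF der], unfold H2_def, rule arg_cong2[of _ _ _ _ "(/)"])
         (simp_all add: algebra_simps)
  qed
  have dJ: "((\<lambda>s. quad c j \<phi> (H \<phi> s) s) has_real_derivative J1 \<phi> s) (at s)" if "\<phi> \<in> {a..b}" "s \<in> ?U" for \<phi> s
    unfolding J1_def by (rule quad_chain(1)[of j j', OF j(1) dH[OF that]])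
  have dJ1: "((\<lambda>s. J1 \<phi> s) has_real_derivative J2 \<phi> s) (at s)" if "\<phi> \<in> {a..b}" "s \<in> ?U" for \<phi> s
    unfolding J1_def J2_def
    by (rule DERIV_cong, rule DERIV_add, rule DERIV_mult, rule quad_chain(1)[of j' j'', OF j(2) dH[OF that]],
        rule dH1[OF that], rule quad_chain(2)[of j j', OF j(1) dH[OF that]]) (simp add: algebra_simps)
  let ?X = "?U \<times> {a..b}"
  have cX: "continuous_on ?X fst" "continuous_on ?X snd" by (intro continuous_intros)+
  have cH: "continuous_on ?X (\<lambda>x. H (snd x) (fst x))"
  proof -
    have "continuous_on ?X (\<lambda>x. (\<lambda>(\<phi>, s). H \<phi> s) (snd x, fst x))"
      by (rule continuous_on_compose2[OF H(3)]) (auto intro!: continuous_intros)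
    then show ?thesis by simp
  qed
  note cq = continuous_on_quad[OF c _ cX(2) cH cX(1)]
  have cD: "continuous_on ?X (\<lambda>x. D (snd x) (fst x))" unfolding D_def by (intro cq c_e)
  have nz: "\<forall>x\<in>?X. D (snd x) (fst x) \<noteq> 0" using D_pos by force
  have cH1: "continuous_on ?X (\<lambda>x. H1 (snd x) (fst x))" unfolding H1_def
    by (intro continuous_intros cq cD c_e nz)
  have cH2: "continuous_on ?X (\<lambda>x. H2 (snd x) (fst x))" unfolding H2_def
    by (intro continuous_intros cq cD cH1 c_e e(3)) (use nz in simp)
  have cJ: "continuous_on ?X (\<lambda>x. quad c j (snd x) (H (snd x) (fst x)) (fst x))" by (intro cq c_e)
  have cJ1: "continuous_on ?X (\<lambda>x. J1 (snd x) (fst x))" unfolding J1_def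
    by (intro continuous_intros cq cH1 c_e)
  have cJ2: "continuous_on ?X (\<lambda>x. J2 (snd x) (fst x))" unfolding J2_def
    by (intro continuous_intros cq cH1 cH2 c_e j(3))
  have int: "(\<lambda>\<phi>. F (s, \<phi>)) integrable_on cbox a b" if "continuous_on ?X F" "s \<in> ?U" for F :: "real \<times> real \<Rightarrow> real" and s
    by (intro integrable_continuous continuous_on_compose2[OF that(1)] continuous_intros) (use that in auto)
  define A' where "A' s = integral {a..b} (\<lambda>\<phi>. J1 \<phi> s)" for s
  have leib: "((\<lambda>s. integral (cbox a b) (\<lambda>\<phi>. f \<phi> s)) has_real_derivative integral (cbox a b) (\<lambda>\<phi>. f' \<phi> s)) (at s)"
    if "\<And>\<phi> s. \<phi> \<in> {a..b} \<Longrightarrow> s \<in> ?U \<Longrightarrow> (f \<phi> has_real_derivative f' \<phi> s) (at s)"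
      "continuous_on ?X (\<lambda>x. f (snd x) (fst x))" "continuous_on ?X (\<lambda>x. f' (snd x) (fst x))" "s \<in> ?U"
    for f f' :: "real \<Rightarrow> real \<Rightarrow> real" and s
  proof -
    have "((\<lambda>s. integral (cbox a b) (\<lambda>\<phi>. f \<phi> s)) has_real_derivative integral (cbox a b) (\<lambda>\<phi>. f' \<phi> s)) (at s within ?U)"
    proof (rule leibniz_rule_field_derivative)
      show "(\<lambda>\<phi>. f \<phi> s) integrable_on cbox a b" if "s \<in> ?U" for s
        using int[OF \<open>continuous_on ?X (\<lambda>x. f (snd x) (fst x))\<close> that] by simp
    qed (use that in \<open>auto simp: case_prod_beta intro: has_field_derivative_at_within\<close>)
    then show ?thesis using that(4) at_within_open[of s ?U] by simp
  qed
  have 1: "((\<lambda>s. integral {a..b} (\<lambda>\<phi>. quad c j \<phi> (H \<phi> s) s)) has_real_derivative A' s) (at s)" if "\<bar>s\<bar> < \<sigma>" for s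
    using leib[of "\<lambda>\<phi> s. quad c j \<phi> (H \<phi> s) s" J1 s, OF dJ cJ cJ1] that by (auto simp: A'_def abs_less_iff)
  have 2: "(A' has_real_derivative integral {a..b} (\<lambda>\<phi>. J2 \<phi> 0)) (at 0)"
    using leib[of J1 J2 0, OF dJ1 cJ1 cJ2] \<sigma> by (simp add: A'_def[abs_def])
  have z: "H1 \<phi> 0 = h1 \<phi>" "D \<phi> 0 = e' 0 h0" "e' 0 h0 \<noteq> 0" if "\<phi> \<in> {a..b}" for \<phi>
    using H(4)[OF that] D_pos[OF that, of 0] \<sigma> by (auto simp: H1_def D_def h1_def quad_def quad_s_def)
  have z2: "H2 \<phi> 0 = h2 \<phi>" if "\<phi> \<in> {a..b}" for \<phi>
  proof -
    have "c 1 \<phi> * e 1 h0 = - h1 \<phi> * e' 0 h0" unfolding h1_def using z(3)[OF that] by simp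
    then show ?thesis
      unfolding H2_def h2_def using H(4)[OF that] z[OF that]
      by (simp add: quad_def quad_s_def divide_simps) (simp add: algebra_simps power2_eq_square)
  qed
  have "A' 0 = integral {a..b} (\<lambda>\<phi>. j' 0 h0 * h1 \<phi> + c 1 \<phi> * j 1 h0)"
    unfolding A'_def by (rule integral_cong) (simp add: J1_def z H(4) quad_def quad_s_def)
  moreover have "integral {a..b} (\<lambda>\<phi>. J2 \<phi> 0) = integral {a..b} (\<lambda>\<phi>. j' 0 h0 * h2 \<phi> + j'' 0 h0 * (h1 \<phi>)\<^sup>2
         + 2 * (c 1 \<phi> * j' 1 h0) * h1 \<phi> + quad_ss c j \<phi> h0)"
    by (rule integral_cong) (simp add: J2_def z z2 H(4) quad_def quad_s_def power2_eq_square algebra_simps)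
  ultimately show ?thesis using 1 2 by (intro exI[of _ A']) auto
qed

section \<open>The perturbed discs\<close>

text \<open>The radial function of the disc perturbed by a cosine wave of amplitude \<open>s\<close>.\<close>

definition wave :: "real \<Rightarrow> real \<Rightarrow> real \<Rightarrow> real" where
  "wave N s v = 1 + s * cos (N * v)"

text \<open>The functions of \<open>\<phi>\<close> that occur: the constant \<open>1\<close>, \<open>cos(N \<phi>)\<close> and \<open>cos(2 N \<phi>)\<close> for \<open>i = 0, 1, 2\<close>.\<close>

definition harmonics :: "real \<Rightarrow> nat \<Rightarrow> real \<Rightarrow> real" where
  "harmonics N i \<phi> = cos (real i * N * \<phi>)"

lemma cos_sin_periodic:
  assumes "N = 4 * real m"
  shows "cos (N * (v + pi)) = cos (N * v)" "sin (N * (v + pi)) = sin (N * v)"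
proof -
  have "N * (v + pi) = N * v + 2 * pi * of_int (2 * int m)" using assms by (simp add: algebra_simps)
  then show "cos (N * (v + pi)) = cos (N * v)" "sin (N * (v + pi)) = sin (N * v)"
    using cos_int_2pin[of "2 * int m"] sin_int_2pin[of "2 * int m"] by (simp_all add: cos_add sin_add)
qed

text \<open>The smallness condition on \<open>s\<close> gives \<open>|\<rho>''| \<le> |s| N\<^sup>2 < 1 - |s| \<le> \<rho>\<close>, which forces positive curvature.\<close>

lemma wave_polar_convex:
  assumes N: "N = 4 * real m" and s: "\<bar>s\<bar> * (1 + N\<^sup>2) < 1"
  shows "polar_convex (wave N s) (\<lambda>v. - s * N * sin (N * v)) (\<lambda>v. - s * N\<^sup>2 * cos (N * v))"
proof
  fix v
  have c: "\<bar>s * cos (N * v)\<bar> \<le> \<bar>s\<bar>" unfolding abs_mult by (simp add: mult_left_le)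
  have sN: "\<bar>s\<bar> * N\<^sup>2 < 1 - \<bar>s\<bar>" using s by (simp add: algebra_simps)
  show "wave N s (v + pi) = wave N s v" unfolding wave_def cos_sin_periodic[OF N] ..
  have low: "1 - \<bar>s\<bar> \<le> wave N s v" unfolding wave_def using c by linarith
  have "0 \<le> \<bar>s\<bar> * N\<^sup>2" by simp
  then show pos: "0 < wave N s v" using low sN by linarith
  show "(wave N s has_real_derivative - s * N * sin (N * v)) (at v)"
    unfolding wave_def[abs_def] by (rule derivative_eq_intros refl)+ simp
  show "((\<lambda>v. - s * N * sin (N * v)) has_real_derivative - s * N\<^sup>2 * cos (N * v)) (at v)"
    by (rule derivative_eq_intros refl)+ (simp add: power2_eq_square)
  have "- s * N\<^sup>2 * cos (N * v) \<le> \<bar>s * cos (N * v)\<bar> * N\<^sup>2"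
    using mult_right_mono[of "- (s * cos (N * v))" "\<bar>s * cos (N * v)\<bar>" "N\<^sup>2"] by (simp add: algebra_simps)
  also have "\<dots> \<le> \<bar>s\<bar> * N\<^sup>2" using c by (rule mult_right_mono) simp
  also have "\<dots> < wave N s v" using sN low by linarith
  finally have "wave N s v * (- s * N\<^sup>2 * cos (N * v)) < wave N s v * wave N s v" using pos by (rule mult_strict_left_mono)
  also have "\<dots> \<le> (wave N s v)\<^sup>2 + 2 * (- s * N * sin (N * v))\<^sup>2" by (simp add: power2_eq_square)
  finally show "wave N s v * (- s * N\<^sup>2 * cos (N * v)) < (wave N s v)\<^sup>2 + 2 * (- s * N * sin (N * v))\<^sup>2" .
qed

text \<open>An antiderivative of half the square of \<open>wave\<close>.\<close>

definition wave_area :: "real \<Rightarrow> real \<Rightarrow> real \<Rightarrow> real" where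
  "wave_area N s v = (v + 2 * s * sin (N * v) / N + s\<^sup>2 * (v / 2 + sin (2 * N * v) / (4 * N))) / 2"

lemma wave_area_deriv:
  assumes "N \<noteq> 0"
  shows "(wave_area N s has_real_derivative (wave N s v)\<^sup>2 / 2) (at v within S)"
proof -
  have "cos (2 * N * v) = 2 * (cos (N * v))\<^sup>2 - 1" using cos_double_cos[of "N * v"] by (simp add: mult.assoc)
  then have eq: "(1 + 2 * s * (cos (N * v) * N) / N + s\<^sup>2 * (1 / 2 + cos (2 * N * v) * (2 * N) / (4 * N))) / 2
      = (wave N s v)\<^sup>2 / 2"
    using assms by (simp add: wave_def) (simp add: power2_eq_square field_simps)
  have "(wave_area N s has_real_derivative
      (1 + 2 * s * (cos (N * v) * N) / N + s\<^sup>2 * (1 / 2 + cos (2 * N * v) * (2 * N) / (4 * N))) / 2) (at v within S)"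
    unfolding wave_area_def[abs_def]
    by (rule DERIV_cong, (rule DERIV_cdivide DERIV_add DERIV_cmult DERIV_chain2[OF DERIV_sin] DERIV_ident)+) simp
  then show ?thesis unfolding eq .
qed

text \<open>The coefficients of the defect \<open>level\<close>: covariogram minus \<open>\<delta>\<close> times the area of the body.\<close>

definition level_coeff :: "real \<Rightarrow> real \<Rightarrow> nat \<Rightarrow> real \<Rightarrow> real" where
  "level_coeff N \<delta> i h =
    (if i = 0 then 2 * h - sin (2 * h) - \<delta> * pi
     else if i = 1 then 4 * sin (N * h) / N - 2 * cos (N * h) * sin (2 * h)
     else if i = 2 then h - cos (2 * N * h) * sin (2 * h) / 2 - \<delta> * pi / 2
     else sin (2 * N * h) / (2 * N) - sin (2 * h) / 2)"

abbreviation "level N \<delta> \<equiv> quad (harmonics N) (level_coeff N \<delta>)"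

text \<open>The sum of the boundary points at angles \<open>\<phi> - h\<close> and \<open>\<phi> + h\<close>.\<close>

definition wave_point :: "real \<Rightarrow> real \<Rightarrow> real \<Rightarrow> real \<Rightarrow> real^2" where
  "wave_point N s \<phi> h = polar (wave N s (\<phi> - h)) (\<phi> - h) + polar (wave N s (\<phi> + h)) (\<phi> + h)"

lemma measure_wave_body:
  assumes N: "N = 4 * real m" "m \<ge> 1" and s: "\<bar>s\<bar> * (1 + N\<^sup>2) < 1"
  shows "measure lebesgue (star_body (wave N s)) = pi * (1 + s\<^sup>2 / 2)"
proof -
  interpret polar_convex "wave N s" "\<lambda>v. - s * N * sin (N * v)" "\<lambda>v. - s * N\<^sup>2 * cos (N * v)"
    by (rule wave_polar_convex[OF N(1) s])
  let ?S = "sector (wave N s) 0 (2 * pi)"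
  have "?S \<subseteq> L" using polar_mem_iff by (auto simp: sector_def)
  moreover have "L - ?S \<subseteq> {0}"
  proof
    fix x assume x: "x \<in> L - ?S"
    show "x \<in> {0}"
    proof (rule ccontr)
      assume "x \<notin> {0}"
      then obtain v where v: "0 \<le> v" "v < 0 + 2 * pi" "x = polar (norm x) v" using polar_exists[of x 0] by auto
      then have "norm x \<le> wave N s v" using x polar_mem_iff[of "norm x" v] \<open>x \<notin> {0}\<close> by auto
      then have "x \<in> ?S" unfolding sector_def using v \<open>x \<notin> {0}\<close>
        by (intro CollectI exI[of _ "norm x"] exI[of _ v]) auto
      then show False using x by simp
    qed
  qed
  ultimately have "measure lebesgue L = measure lebesgue ?S"
    by (intro measure_negligible_symdiff sector_lmeasurable continuous_on_rho negligible_subset[OF negligible_sing[of 0]])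
       (use pos in \<open>auto intro: less_imp_le\<close>)
  also have "\<dots> = wave_area N s (2 * pi) - wave_area N s 0"
    using N pos by (intro measure_sector continuous_on_rho wave_area_deriv) (auto intro: less_imp_le)
  also have "\<dots> = pi * (1 + s\<^sup>2 / 2)"
  proof -
    have "sin (N * (2 * pi)) = 0" "sin (2 * N * (2 * pi)) = 0"
      using sin_npi2[of "8 * m"] sin_npi2[of "16 * m"] N by (simp_all add: mult.commute mult.left_commute)
    then show ?thesis unfolding wave_area_def by (simp add: field_simps)
  qed
  finally show ?thesis .
qed

lemma cov_wave_point:
  assumes N: "N = 4 * real m" "m \<ge> 1" and s: "\<bar>s\<bar> * (1 + N\<^sup>2) < 1" and h: "0 < h" "h < pi / 2"
  shows "polar_convex.cov (wave N s) (wave_point N s \<phi> h)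
    = \<delta> * measure lebesgue (star_body (wave N s)) + level N \<delta> \<phi> h s"
proof -
  interpret polar_convex "wave N s" "\<lambda>v. - s * N * sin (N * v)" "\<lambda>v. - s * N\<^sup>2 * cos (N * v)"
    by (rule wave_polar_convex[OF N(1) s])
  have "cov (wave_point N s \<phi> h) = 2 * measure lebesgue (sector (wave N s) (\<phi> - h) (\<phi> + h))
      - wave N s (\<phi> - h) * wave N s (\<phi> + h) * sin ((\<phi> + h) - (\<phi> - h))"
    unfolding cov_def wave_point_def using h by (intro measure_lens) auto
  also have "measure lebesgue (sector (wave N s) (\<phi> - h) (\<phi> + h)) = wave_area N s (\<phi> + h) - wave_area N s (\<phi> - h)"
    using N pos h by (intro measure_sector continuous_on_rho wave_area_deriv) (auto intro: less_imp_le)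
  finally have 1: "cov (wave_point N s \<phi> h) = 2 * (wave_area N s (\<phi> + h) - wave_area N s (\<phi> - h))
      - wave N s (\<phi> - h) * wave N s (\<phi> + h) * sin (2 * h)" by simp
  have tr: "sin (N * (\<phi> + h)) - sin (N * (\<phi> - h)) = 2 * cos (N * \<phi>) * sin (N * h)"
    "sin (2 * N * (\<phi> + h)) - sin (2 * N * (\<phi> - h)) = 2 * cos (2 * N * \<phi>) * sin (2 * N * h)"
    by (simp_all add: algebra_simps sin_add sin_diff)
  have "2 * (wave_area N s (\<phi> + h) - wave_area N s (\<phi> - h)) =
    2 * h + 2 * s * (sin (N * (\<phi> + h)) - sin (N * (\<phi> - h))) / N
     + s\<^sup>2 * (h + (sin (2 * N * (\<phi> + h)) - sin (2 * N * (\<phi> - h))) / (4 * N))"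
    using N unfolding wave_area_def by (simp add: field_simps)
  also have "\<dots> = 2 * h + 4 * s * cos (N * \<phi>) * sin (N * h) / N
     + s\<^sup>2 * (h + cos (2 * N * \<phi>) * sin (2 * N * h) / (2 * N))"
    unfolding tr by simp
  finally have 2: "2 * (wave_area N s (\<phi> + h) - wave_area N s (\<phi> - h)) = \<dots>" .
  have "cos (N * (\<phi> - h)) + cos (N * (\<phi> + h)) = 2 * cos (N * \<phi>) * cos (N * h)"
    "cos (N * (\<phi> - h)) * cos (N * (\<phi> + h)) = (cos (2 * N * \<phi>) + cos (2 * N * h)) / 2"
    using cos_times_cos[of "N * (\<phi> - h)" "N * (\<phi> + h)"]
    by (simp_all add: algebra_simps cos_add cos_diff)
  moreover have "wave N s (\<phi> - h) * wave N s (\<phi> + h) = 1 + s * (cos (N * (\<phi> - h)) + cos (N * (\<phi> + h)))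
      + s\<^sup>2 * (cos (N * (\<phi> - h)) * cos (N * (\<phi> + h)))"
    unfolding wave_def by (simp add: algebra_simps power2_eq_square)
  ultimately have 3: "wave N s (\<phi> - h) * wave N s (\<phi> + h) = 1 + s * (2 * cos (N * \<phi>) * cos (N * h))
      + s\<^sup>2 * ((cos (2 * N * \<phi>) + cos (2 * N * h)) / 2)" by simp
  have "real 2 * N * \<phi> = 2 * N * \<phi>" "real 1 * N * \<phi> = N * \<phi>" by simp_all
  then show ?thesis
    unfolding 1 2 3 measure_wave_body[OF N s] quad_def harmonics_def level_coeff_def
    using N by (simp add: field_simps)
qed

section \<open>The area swept by the level curve\<close>

text \<open>The coordinates \<open>curve_x\<close> and \<open>curve_y\<close> of \<open>wave_point\<close> in the orthonormal frame rotated by \<open>\<phi>\<close>.\<close>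

definition curve_x :: "real \<Rightarrow> real \<Rightarrow> real \<Rightarrow> real \<Rightarrow> real" where
  "curve_x N s \<phi> h = 2 * cos h * (1 + s * cos (N * \<phi>) * cos (N * h))"

definition curve_y :: "real \<Rightarrow> real \<Rightarrow> real \<Rightarrow> real \<Rightarrow> real" where
  "curve_y N s \<phi> h = - 2 * s * sin (N * \<phi>) * sin (N * h) * sin h"

lemma polar_frame:
  assumes "0 < X"
  shows "polar (sqrt (X\<^sup>2 + Y\<^sup>2)) (\<phi> + arctan (Y / X)) = polar X \<phi> + polar Y (\<phi> + pi / 2)"
proof -
  have "sqrt (X\<^sup>2 + Y\<^sup>2) = X * sqrt (1 + (Y / X)\<^sup>2)"
  proof -
    have "X\<^sup>2 + Y\<^sup>2 = X\<^sup>2 * (1 + (Y / X)\<^sup>2)" using assms by (simp add: field_simps)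
    then show ?thesis using assms by (simp add: real_sqrt_mult)
  qed
  moreover have "0 < sqrt (1 + (Y / X)\<^sup>2)" by (simp add: add_pos_nonneg)
  ultimately have eqs: "sqrt (X\<^sup>2 + Y\<^sup>2) * cos (arctan (Y / X)) = X" "sqrt (X\<^sup>2 + Y\<^sup>2) * sin (arctan (Y / X)) = Y"
    using assms by (simp_all add: cos_arctan sin_arctan)
  have rot: "polar r (\<phi> + t) = polar (r * cos t) \<phi> + polar (r * sin t) (\<phi> + pi / 2)" for r t
    by (simp add: vec2_eq_iff cos_add sin_add algebra_simps)
  show ?thesis using eqs rot[of "sqrt (X\<^sup>2 + Y\<^sup>2)" "arctan (Y / X)"] by (simp only:)
qed

lemma wave_point_frame:
  "wave_point N s \<phi> h = polar (curve_x N s \<phi> h) \<phi> + polar (curve_y N s \<phi> h) (\<phi> + pi / 2)"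
  unfolding wave_point_def wave_def curve_x_def curve_y_def
  by (simp add: vec2_eq_iff cos_add sin_add cos_diff sin_diff algebra_simps)

text \<open>For \<open>N > 2\<close>, an antiderivative of \<open>N cos(N h) sin h cos h + sin(N h)\<close>.\<close>

definition drift :: "real \<Rightarrow> real \<Rightarrow> real" where
  "drift N h = N * (cos ((N - 2) * h) / (N - 2) - cos ((N + 2) * h) / (N + 2)) / 4 - cos (N * h) / N"

lemma drift_deriv:
  assumes "N > 2"
  shows "(drift N has_real_derivative N * cos (N * h) * sin h * cos h + sin (N * h)) (at h)"
proof -
  have d: "(drift N has_real_derivative N * (- sin ((N - 2) * h) * (N - 2) / (N - 2) - - sin ((N + 2) * h) * (N + 2) / (N + 2)) / 4
     - - sin (N * h) * N / N) (at h)"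
    unfolding drift_def[abs_def]
    by (rule DERIV_cong, (rule DERIV_cdivide DERIV_add DERIV_diff DERIV_cmult DERIV_chain2[OF DERIV_cos] DERIV_ident)+) simp
  have e1: "N * (- sin ((N - 2) * h) * (N - 2) / (N - 2) - - sin ((N + 2) * h) * (N + 2) / (N + 2)) / 4
     - - sin (N * h) * N / N = N * (sin (N * h + 2 * h) - sin (N * h - 2 * h)) / 4 + sin (N * h)"
  proof -
    have c: "x * k / k = x" if "k \<noteq> 0" for x k :: real using that by simp
    have "N - 2 \<noteq> 0" "N + 2 \<noteq> 0" "N \<noteq> 0" using assms by auto
    note this[THEN c]
    then show ?thesis by (simp only: left_diff_distrib distrib_right) simp
  qed
  have e2: "sin (N * h + 2 * h) - sin (N * h - 2 * h) = 4 * cos (N * h) * sin h * cos h"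
    by (simp add: sin_add sin_diff sin_double)
  show ?thesis using d unfolding e1 e2 by (simp add: mult.assoc)
qed

text \<open>The coefficients of the area integrand that remains after the exact derivative of \<open>sweep_potential\<close> is subtracted.\<close>

definition area_coeff :: "real \<Rightarrow> nat \<Rightarrow> real \<Rightarrow> real" where
  "area_coeff N i h =
    (if i = 0 then 2 + 2 * cos (2 * h)
     else if i = 1 then 4 * (1 + cos (2 * h)) * cos (N * h) - 2 * N * sin (N * h) * sin (2 * h) + 4 * N * drift N h
     else if i = 2 then 1 + cos (2 * h) * cos (2 * N * h) - N * sin (2 * N * h) * sin (2 * h)
     else 1 + N\<^sup>2 + (1 - N\<^sup>2) * cos (2 * h))"

text \<open>An antiderivative in \<open>h\<close>, for fixed \<open>\<phi>\<close>, of the coefficient of \<open>h'\<close> in the cross product of the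
curve and its velocity. It vanishes at \<open>\<phi> = 0\<close>.\<close>

definition sweep_potential :: "real \<Rightarrow> real \<Rightarrow> real \<Rightarrow> real \<Rightarrow> real" where
  "sweep_potential N s \<phi> h = - 4 * s * sin (N * \<phi>) * (drift N h + s * cos (N * \<phi>) * (N * (sin h)\<^sup>2 / 2 + (sin (N * h))\<^sup>2 / (2 * N)))"

text \<open>With \<open>a, b\<close>, \<open>C, S\<close> and \<open>c, \<sigma>\<close> for the cosines and sines of \<open>N \<phi>\<close>, \<open>N h\<close> and \<open>h\<close>: the coefficient of \<open>h'\<close> in the
cross product of the curve and its velocity.\<close>

lemma chord_identity:
  fixes b a C S c \<sigma> N s :: real
  assumes "c\<^sup>2 + \<sigma>\<^sup>2 = 1" "C\<^sup>2 + S\<^sup>2 = 1"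
  shows "2 * c * (1 + s * a * C) * (- 2 * s * b * (N * C * \<sigma> + S * c))
    - (- 2 * s * b * S * \<sigma>) * (- 2 * \<sigma> * (1 + s * a * C) - 2 * c * s * a * (N * S))
    = - 4 * s * b * (N * C * \<sigma> * c + S + s * a * (N * \<sigma> * c + S * C))"
  using assms by algebra

text \<open>In the same notation, with \<open>P\<close> for the value of \<open>drift\<close>: the part of the cross product without \<open>h'\<close>, minus the partial derivative
in \<open>\<phi>\<close> of \<open>sweep_potential\<close>, expressed by \<open>area_coeff\<close>.\<close>

lemma angle_identity:
  fixes b a C S c \<sigma> N s P NM :: real
  assumes "c\<^sup>2 + \<sigma>\<^sup>2 = 1" "C\<^sup>2 + S\<^sup>2 = 1" "a\<^sup>2 + b\<^sup>2 = 1"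
    and "NM = N\<^sup>2 * \<sigma>\<^sup>2 + S\<^sup>2"
  shows "(2 * c * (1 + s * a * C))\<^sup>2 + (- 2 * s * b * S * \<sigma>)\<^sup>2
     + (2 * c * (1 + s * a * C)) * (- 2 * s * (N * a) * S * \<sigma>)
     - (- 2 * s * b * S * \<sigma>) * (- 2 * c * s * (N * b) * C)
     + (4 * s * N * a * P + 2 * s\<^sup>2 * (a\<^sup>2 - b\<^sup>2) * NM)
    = (2 + 2 * (c\<^sup>2 - \<sigma>\<^sup>2)) + s * (a * (4 * (1 + (c\<^sup>2 - \<sigma>\<^sup>2)) * C - 2 * N * S * (2 * \<sigma> * c) + 4 * N * P))
     + s\<^sup>2 * (1 + (c\<^sup>2 - \<sigma>\<^sup>2) * (C\<^sup>2 - S\<^sup>2) - N * (2 * S * C) * (2 * \<sigma> * c)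
        + (a\<^sup>2 - b\<^sup>2) * (1 + N\<^sup>2 + (1 - N\<^sup>2) * (c\<^sup>2 - \<sigma>\<^sup>2)))"
  using assms by algebra

lemma sweep_potential_deriv:
  assumes N: "N > 2" and h: "(h has_real_derivative D) (at \<phi> within T)"
  shows "((\<lambda>\<phi>. sweep_potential N s \<phi> (h \<phi>)) has_real_derivative
     - (4 * s * N * cos (N * \<phi>) * drift N (h \<phi>)
        + 2 * s\<^sup>2 * ((cos (N * \<phi>))\<^sup>2 - (sin (N * \<phi>))\<^sup>2) * (N\<^sup>2 * (sin (h \<phi>))\<^sup>2 + (sin (N * h \<phi>))\<^sup>2))
     + - 4 * s * sin (N * \<phi>) * (N * cos (N * h \<phi>) * sin (h \<phi>) * cos (h \<phi>) + sin (N * h \<phi>)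
        + s * cos (N * \<phi>) * (N * sin (h \<phi>) * cos (h \<phi>) + sin (N * h \<phi>) * cos (N * h \<phi>))) * D) (at \<phi> within T)"
proof -
  have M: "((\<lambda>\<phi>. N * (sin (h \<phi>))\<^sup>2 / 2 + (sin (N * h \<phi>))\<^sup>2 / (2 * N)) has_real_derivative
     (N * sin (h \<phi>) * cos (h \<phi>) + sin (N * h \<phi>) * cos (N * h \<phi>)) * D) (at \<phi> within T)"
    using N by (auto intro!: derivative_eq_intros h simp: field_simps power2_eq_square)
  note P = DERIV_chain2[OF drift_deriv[OF N] h]
  have "((\<lambda>\<phi>. sweep_potential N s \<phi> (h \<phi>)) has_real_derivative
     - 4 * s * (cos (N * \<phi>) * N) * (drift N (h \<phi>) + s * cos (N * \<phi>) * (N * (sin (h \<phi>))\<^sup>2 / 2 + (sin (N * h \<phi>))\<^sup>2 / (2 * N)))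
     + (- 4 * s * sin (N * \<phi>)) * ((N * cos (N * h \<phi>) * sin (h \<phi>) * cos (h \<phi>) + sin (N * h \<phi>)) * D
       + (s * (- sin (N * \<phi>) * N) * (N * (sin (h \<phi>))\<^sup>2 / 2 + (sin (N * h \<phi>))\<^sup>2 / (2 * N))
         + s * cos (N * \<phi>) * ((N * sin (h \<phi>) * cos (h \<phi>) + sin (N * h \<phi>) * cos (N * h \<phi>)) * D)))) (at \<phi> within T)"
    unfolding sweep_potential_def
    by (rule DERIV_cong, rule DERIV_mult, rule DERIV_cmult, rule DERIV_chain2[OF DERIV_sin], rule DERIV_cmult, rule DERIV_ident,
      rule DERIV_add, rule P, rule DERIV_mult, rule DERIV_cmult, rule DERIV_chain2[OF DERIV_cos], rule DERIV_cmult, rule DERIV_ident, rule M)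
      (simp add: algebra_simps)
  then show ?thesis
    by (rule DERIV_cong) (use N in \<open>simp add: field_simps power2_eq_square\<close>)
qed

lemma harmonics_1_2:
  "harmonics N 1 \<phi> = cos (N * \<phi>)" "harmonics N 2 \<phi> = (cos (N * \<phi>))\<^sup>2 - (sin (N * \<phi>))\<^sup>2"
  using cos_double[of "N * \<phi>"] by (simp_all add: harmonics_def mult.assoc)

text \<open>The cross product of the curve and its velocity, for any differentiable \<open>h\<close>, is an integrand free of \<open>h'\<close> plus an
exact derivative.\<close>

lemma swept_area:
  fixes N s :: real
  assumes N: "N > 2" and h: "(h has_real_derivative D) (at \<phi> within T)"
  defines "X \<equiv> \<lambda>\<phi>. curve_x N s \<phi> (h \<phi>)" and "Y \<equiv> \<lambda>\<phi>. curve_y N s \<phi> (h \<phi>)"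
  shows "\<exists>X' Y' W'. (X has_real_derivative X') (at \<phi> within T) \<and> (Y has_real_derivative Y') (at \<phi> within T)
    \<and> ((\<lambda>\<phi>. sweep_potential N s \<phi> (h \<phi>)) has_real_derivative W') (at \<phi> within T)
    \<and> (X \<phi>)\<^sup>2 + (Y \<phi>)\<^sup>2 + X \<phi> * Y' - Y \<phi> * X' = quad (harmonics N) (area_coeff N) \<phi> (h \<phi>) s + W'"
proof -
  let ?a = "cos (N * \<phi>)" and ?b = "sin (N * \<phi>)" and ?C = "cos (N * h \<phi>)" and ?S = "sin (N * h \<phi>)"
    and ?c = "cos (h \<phi>)" and ?s = "sin (h \<phi>)"
  let ?Xp = "- 2 * ?c * s * (N * ?b) * ?C" and ?Xh = "- 2 * ?s * (1 + s * ?a * ?C) - 2 * ?c * s * ?a * (N * ?S)"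
  let ?Yp = "- 2 * s * (N * ?a) * ?S * ?s" and ?Yh = "- 2 * s * ?b * (N * ?C * ?s + ?S * ?c)"
  have X': "(X has_real_derivative ?Xp + ?Xh * D) (at \<phi> within T)"
    unfolding X_def curve_x_def
    by (rule derivative_eq_intros h refl)+ (simp add: algebra_simps)
  have Y': "(Y has_real_derivative ?Yp + ?Yh * D) (at \<phi> within T)"
    unfolding Y_def curve_y_def
    by (rule derivative_eq_intros h refl)+ (simp add: algebra_simps)
  let ?W = "- (4 * s * N * ?a * drift N (h \<phi>) + 2 * s\<^sup>2 * (?a\<^sup>2 - ?b\<^sup>2) * (N\<^sup>2 * ?s\<^sup>2 + ?S\<^sup>2))
     + - 4 * s * ?b * (N * ?C * ?s * ?c + ?S + s * ?a * (N * ?s * ?c + ?S * ?C)) * D"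
  have "(X \<phi>)\<^sup>2 + (Y \<phi>)\<^sup>2 + X \<phi> * (?Yp + ?Yh * D) - Y \<phi> * (?Xp + ?Xh * D)
    = ((X \<phi>)\<^sup>2 + (Y \<phi>)\<^sup>2 + X \<phi> * ?Yp - Y \<phi> * ?Xp) + (X \<phi> * ?Yh - Y \<phi> * ?Xh) * D"
    by (simp only: algebra_simps)
  also have "X \<phi> * ?Yh - Y \<phi> * ?Xh = - 4 * s * ?b * (N * ?C * ?s * ?c + ?S + s * ?a * (N * ?s * ?c + ?S * ?C))"
    unfolding X_def Y_def curve_x_def curve_y_def by (rule chord_identity) simp_all
  also have "(X \<phi>)\<^sup>2 + (Y \<phi>)\<^sup>2 + X \<phi> * ?Yp - Y \<phi> * ?Xp
     = quad (harmonics N) (area_coeff N) \<phi> (h \<phi>) s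
       - (4 * s * N * ?a * drift N (h \<phi>) + 2 * s\<^sup>2 * (?a\<^sup>2 - ?b\<^sup>2) * (N\<^sup>2 * ?s\<^sup>2 + ?S\<^sup>2))"
  proof -
    have d: "cos (2 * h \<phi>) = ?c\<^sup>2 - ?s\<^sup>2" "sin (2 * h \<phi>) = 2 * ?s * ?c"
      "cos (2 * N * h \<phi>) = ?C\<^sup>2 - ?S\<^sup>2" "sin (2 * N * h \<phi>) = 2 * ?S * ?C"
      using cos_double[of "h \<phi>"] sin_double[of "h \<phi>"] cos_double[of "N * h \<phi>"] sin_double[of "N * h \<phi>"]
      by (simp_all add: mult.assoc)
    have "quad (harmonics N) (area_coeff N) \<phi> (h \<phi>) s
      = (2 + 2 * (?c\<^sup>2 - ?s\<^sup>2)) + s * (?a * (4 * (1 + (?c\<^sup>2 - ?s\<^sup>2)) * ?C - 2 * N * ?S * (2 * ?s * ?c) + 4 * N * drift N (h \<phi>)))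
     + s\<^sup>2 * (1 + (?c\<^sup>2 - ?s\<^sup>2) * (?C\<^sup>2 - ?S\<^sup>2) - N * (2 * ?S * ?C) * (2 * ?s * ?c)
        + (?a\<^sup>2 - ?b\<^sup>2) * (1 + N\<^sup>2 + (1 - N\<^sup>2) * (?c\<^sup>2 - ?s\<^sup>2)))"
      unfolding quad_def area_coeff_def harmonics_1_2 d by simp
    also have "\<dots> = ((X \<phi>)\<^sup>2 + (Y \<phi>)\<^sup>2 + X \<phi> * ?Yp - Y \<phi> * ?Xp)
      + (4 * s * N * ?a * drift N (h \<phi>) + 2 * s\<^sup>2 * (?a\<^sup>2 - ?b\<^sup>2) * (N\<^sup>2 * ?s\<^sup>2 + ?S\<^sup>2))"
      unfolding X_def Y_def curve_x_def curve_y_def by (rule angle_identity[symmetric]) simp_all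
    finally show ?thesis by simp
  qed
  finally have "(X \<phi>)\<^sup>2 + (Y \<phi>)\<^sup>2 + X \<phi> * (?Yp + ?Yh * D) - Y \<phi> * (?Xp + ?Xh * D)
      = quad (harmonics N) (area_coeff N) \<phi> (h \<phi>) s + ?W" by simp
  then show ?thesis using X' Y' sweep_potential_deriv[OF N h, of s] by blast
qed

text \<open>The derivatives \<open>level_coeff_d\<close>, \<open>area_coeff_d\<close> and second derivatives \<open>level_coeff_dd\<close>, \<open>area_coeff_dd\<close> of the
coefficients.\<close>

definition level_coeff_d :: "real \<Rightarrow> nat \<Rightarrow> real \<Rightarrow> real" where
  "level_coeff_d N i h =
    (if i = 0 then 2 - 2 * cos (2 * h)
     else if i = 1 then 4 * cos (N * h) + 2 * N * sin (N * h) * sin (2 * h) - 4 * cos (N * h) * cos (2 * h)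
     else if i = 2 then 1 + N * sin (2 * N * h) * sin (2 * h) - cos (2 * N * h) * cos (2 * h)
     else cos (2 * N * h) - cos (2 * h))"

definition level_coeff_dd :: "real \<Rightarrow> nat \<Rightarrow> real \<Rightarrow> real" where
  "level_coeff_dd N i h =
    (if i = 0 then 4 * sin (2 * h)
     else if i = 1 then - 4 * N * sin (N * h) + (2 * N\<^sup>2 + 8) * cos (N * h) * sin (2 * h) + 8 * N * sin (N * h) * cos (2 * h)
     else if i = 2 then (2 * N\<^sup>2 + 2) * cos (2 * N * h) * sin (2 * h) + 4 * N * sin (2 * N * h) * cos (2 * h)
     else - 2 * N * sin (2 * N * h) + 2 * sin (2 * h))"

definition area_coeff_d :: "real \<Rightarrow> nat \<Rightarrow> real \<Rightarrow> real" where
  "area_coeff_d N i h =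
    (if i = 0 then - 4 * sin (2 * h)
     else if i = 1 then - 8 * (sin (2 * h) * cos (N * h) + N * cos (2 * h) * sin (N * h))
     else if i = 2 then - (2 + 2 * N\<^sup>2) * sin (2 * h) * cos (2 * N * h) - 4 * N * cos (2 * h) * sin (2 * N * h)
     else - 2 * (1 - N\<^sup>2) * sin (2 * h))"

definition area_coeff_dd :: "real \<Rightarrow> nat \<Rightarrow> real \<Rightarrow> real" where
  "area_coeff_dd N i h =
    (if i = 0 then - 8 * cos (2 * h)
     else if i = 1 then - 8 * ((2 + N\<^sup>2) * cos (2 * h) * cos (N * h) - 3 * N * sin (2 * h) * sin (N * h))
     else if i = 2 then - (4 + 12 * N\<^sup>2) * cos (2 * h) * cos (2 * N * h) + (12 * N + 4 * N ^ 3) * sin (2 * h) * sin (2 * N * h)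
     else - 4 * (1 - N\<^sup>2) * cos (2 * h))"

lemma nat_cases4:
  obtains "(i::nat) = 0" | "i = 1" | "i = 2" | "i \<noteq> 0" "i \<noteq> 1" "i \<noteq> 2"
  by blast

lemma level_coeff_deriv:
  assumes "N \<noteq> 0"
  shows "(level_coeff N \<delta> i has_real_derivative level_coeff_d N i h) (at h)"
  unfolding level_coeff_def[abs_def] level_coeff_d_def using assms
  by (cases rule: nat_cases4[of i]) (auto intro!: derivative_eq_intros simp: field_simps)

lemma level_coeff_deriv2: "(level_coeff_d N i has_real_derivative level_coeff_dd N i h) (at h)"
  unfolding level_coeff_d_def[abs_def] level_coeff_dd_def
  by (cases rule: nat_cases4[of i]) (auto intro!: derivative_eq_intros simp: algebra_simps power2_eq_square)

lemma area_coeff_deriv: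
  assumes "N > 2"
  shows "(area_coeff N i has_real_derivative area_coeff_d N i h) (at h)"
proof (cases rule: nat_cases4[of i])
  case 2
  have "N * cos (N * h) * sin h * cos h = N * cos (N * h) * sin (2 * h) / 2" by (simp add: sin_double)
  then have d: "(drift N has_real_derivative N * cos (N * h) * sin (2 * h) / 2 + sin (N * h)) (at h)"
    using drift_deriv[OF assms, of h] by (simp only:)
  have "((\<lambda>h. 4 * (1 + cos (2 * h)) * cos (N * h) - 2 * N * sin (N * h) * sin (2 * h) + 4 * N * drift N h) has_real_derivative
     - 8 * (sin (2 * h) * cos (N * h) + N * cos (2 * h) * sin (N * h))) (at h)"
    by (rule derivative_eq_intros d refl)+ (simp add: field_simps)
  then show ?thesis unfolding area_coeff_def[abs_def] area_coeff_d_def 2 by simp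
qed (unfold area_coeff_def[abs_def] area_coeff_d_def,
     auto intro!: derivative_eq_intros simp: algebra_simps power2_eq_square)

lemma area_coeff_deriv2: "(area_coeff_d N i has_real_derivative area_coeff_dd N i h) (at h)"
  unfolding area_coeff_d_def[abs_def] area_coeff_dd_def
  by (cases rule: nat_cases4[of i]) (auto intro!: derivative_eq_intros simp: algebra_simps power2_eq_square power3_eq_cube)

lemma coeff_dd_continuous:
  "continuous_on UNIV (level_coeff_dd N i)" "continuous_on UNIV (area_coeff_dd N i)" "continuous_on UNIV (harmonics N i)"
  unfolding level_coeff_dd_def[abs_def] area_coeff_dd_def[abs_def] harmonics_def[abs_def]
  by (cases rule: nat_cases4[of i]; simp; intro continuous_intros)+

lemma conv_body_wave:
  assumes N: "N = 4 * real m" and s: "\<bar>s\<bar> * (1 + N\<^sup>2) < 1"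
  shows "conv_body \<delta> (star_body (wave N s)) = {x. \<delta> * measure lebesgue (star_body (wave N s)) \<le> polar_convex.cov (wave N s) x}"
proof -
  interpret polar_convex "wave N s" "\<lambda>v. - s * N * sin (N * v)" "\<lambda>v. - s * N\<^sup>2 * cos (N * v)"
    by (rule wave_polar_convex[OF N s])
  show ?thesis unfolding conv_body_def cov_def ..
qed

lemma measure_conv_body_wave:
  fixes h :: "real \<Rightarrow> real"
  assumes N: "N = 4 * real m" "m \<ge> 1" and s: "\<bar>s\<bar> * (1 + N\<^sup>2) < 1" and \<delta>: "0 < \<delta>"
    and h: "\<And>\<phi>. \<phi> \<in> {0..2 * pi} \<Longrightarrow> \<exists>D. (h has_real_derivative D) (at \<phi>)"
    "\<And>\<phi>. \<phi> \<in> {0..2 * pi} \<Longrightarrow> 0 < h \<phi> \<and> h \<phi> < pi / 2"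
    "\<And>\<phi>. \<phi> \<in> {0..2 * pi} \<Longrightarrow> level N \<delta> \<phi> (h \<phi>) s = 0"
    "h (2 * pi) = h 0"
  shows "measure lebesgue (conv_body \<delta> (star_body (wave N s)))
    = integral {0..2 * pi} (\<lambda>\<phi>. quad (harmonics N) (area_coeff N) \<phi> (h \<phi>) s) / 2"
proof -
  let ?I = "{0..2 * pi}"
  interpret polar_convex "wave N s" "\<lambda>v. - s * N * sin (N * v)" "\<lambda>v. - s * N\<^sup>2 * cos (N * v)"
    by (rule wave_polar_convex[OF N(1) s])
  have N2: "N > 2" using N by simp
  have s1: "\<bar>s\<bar> < 1" using s mult_nonneg_nonneg[OF abs_ge_zero[of s] zero_le_power2[of N]] by (simp only: distrib_left)
  define \<kappa> where "\<kappa> = \<delta> * measure lebesgue L"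
  have \<kappa>: "0 < \<kappa>" unfolding \<kappa>_def measure_wave_body[OF N s] using \<delta> by (simp add: add_pos_nonneg)
  define X where "X \<phi> = curve_x N s \<phi> (h \<phi>)" for \<phi>
  define Y where "Y \<phi> = curve_y N s \<phi> (h \<phi>)" for \<phi>
  define J where "J \<phi> = quad (harmonics N) (area_coeff N) \<phi> (h \<phi>) s" for \<phi>
  define P where "P \<phi> x' y' w' \<longleftrightarrow> (X has_real_derivative x') (at \<phi> within ?I) \<and> (Y has_real_derivative y') (at \<phi> within ?I)
    \<and> ((\<lambda>\<phi>. sweep_potential N s \<phi> (h \<phi>)) has_real_derivative w') (at \<phi> within ?I)
    \<and> (X \<phi>)\<^sup>2 + (Y \<phi>)\<^sup>2 + X \<phi> * y' - Y \<phi> * x' = J \<phi> + w'" for \<phi> x' y' w'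
  have "\<exists>x' y' w'. P \<phi> x' y' w'" if \<phi>: "\<phi> \<in> ?I" for \<phi>
  proof -
    obtain D where "(h has_real_derivative D) (at \<phi>)" using h(1)[OF \<phi>] by blast
    from swept_area[where s = s and T = ?I, OF N2 has_field_derivative_at_within[OF this]]
    show ?thesis unfolding P_def X_def[abs_def] Y_def[abs_def] J_def .
  qed
  then obtain X' Y' W' where P: "\<And>\<phi>. \<phi> \<in> ?I \<Longrightarrow> P \<phi> (X' \<phi>) (Y' \<phi>) (W' \<phi>)"
    by metis
  have X': "(X has_real_derivative X' \<phi>) (at \<phi> within ?I)"
    and Y': "(Y has_real_derivative Y' \<phi>) (at \<phi> within ?I)"
    and W': "((\<lambda>\<phi>. sweep_potential N s \<phi> (h \<phi>)) has_real_derivative W' \<phi>) (at \<phi> within ?I)"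
    and key: "(X \<phi>)\<^sup>2 + (Y \<phi>)\<^sup>2 + X \<phi> * Y' \<phi> - Y \<phi> * X' \<phi> = J \<phi> + W' \<phi>"
    if "\<phi> \<in> ?I" for \<phi>
    using P[OF that] unfolding P_def by auto
  have X_pos: "0 < X \<phi>" if "\<phi> \<in> ?I" for \<phi>
  proof -
    have "\<bar>s * cos (N * \<phi>) * cos (N * h \<phi>)\<bar> \<le> \<bar>s\<bar> * 1 * 1"
      unfolding abs_mult by (intro mult_mono) auto
    then have "0 < 1 + s * cos (N * \<phi>) * cos (N * h \<phi>)" using s1 by linarith
    moreover have "0 < cos (h \<phi>)" using h(2)[OF that] by (intro cos_gt_zero) auto
    ultimately show ?thesis unfolding X_def curve_x_def by simp
  qed
  define R where "R \<phi> = sqrt ((X \<phi>)\<^sup>2 + (Y \<phi>)\<^sup>2)" for \<phi>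
  define \<theta> where "\<theta> \<phi> = \<phi> + arctan (Y \<phi> / X \<phi>)" for \<phi>
  have point: "polar (R \<phi>) (\<theta> \<phi>) = wave_point N s \<phi> (h \<phi>)" if "\<phi> \<in> ?I" for \<phi>
    unfolding R_def \<theta>_def wave_point_frame
    using polar_frame[OF X_pos[OF that], of "Y \<phi>" \<phi>] unfolding X_def Y_def .
  have hcont: "continuous_on ?I h"
    using h(1) by (meson DERIV_isCont continuous_at_imp_continuous_on)
  have coeff_cont: "continuous_on UNIV (area_coeff N i)" for i
    using area_coeff_deriv[OF N2] by (meson DERIV_isCont continuous_at_imp_continuous_on)
  have Jcont: "continuous_on ?I J" unfolding J_def
    by (intro continuous_on_quad coeff_dd_continuous coeff_cont hcont continuous_intros)
  then obtain G where "\<And>\<phi>. \<phi> \<in> ?I \<Longrightarrow> (G has_vector_derivative J \<phi>) (at \<phi> within ?I)"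
    using antiderivative_continuous by metis
  then have G: "(G has_real_derivative J \<phi>) (at \<phi> within ?I)" if "\<phi> \<in> ?I" for \<phi>
    using that by (simp add: has_real_derivative_iff_has_vector_derivative)
  define V where "V \<phi> = (G \<phi> + sweep_potential N s \<phi> (h \<phi>)) / 2" for \<phi>
  have per: "cos (N * (2 * pi)) = 1" "sin (N * (2 * pi)) = 0"
    using cos_npi[of "8 * m"] sin_npi[of "8 * m"] N(1) by (simp_all add: mult.commute mult.left_commute)
  have "measure lebesgue {x. \<kappa> \<le> cov x} = V (2 * pi) - V 0"
  proof (rule measure_superlevel_cov[where R = R and \<theta> = \<theta> and V = V and a = 0 and b = "2 * pi" and
      \<theta>' = "\<lambda>\<phi>. 1 + (X \<phi> * Y' \<phi> - Y \<phi> * X' \<phi>) / ((X \<phi>)\<^sup>2 + (Y \<phi>)\<^sup>2)"])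
    show "continuous_on ?I R" unfolding R_def
      using X' Y' by (intro continuous_intros) (meson DERIV_continuous continuous_on_eq_continuous_within)+
    show "0 < R \<phi>" if "\<phi> \<in> ?I" for \<phi>
      using X_pos[OF that] unfolding R_def by (simp add: add_pos_nonneg)
    show "(\<theta> has_real_derivative 1 + (X \<phi> * Y' \<phi> - Y \<phi> * X' \<phi>) / ((X \<phi>)\<^sup>2 + (Y \<phi>)\<^sup>2)) (at \<phi> within ?I)"
      if \<phi>: "\<phi> \<in> ?I" for \<phi>
    proof -
      have "(\<theta> has_real_derivative 1 + inverse (1 + (Y \<phi> / X \<phi>)\<^sup>2) * ((Y' \<phi> * X \<phi> - Y \<phi> * X' \<phi>) / (X \<phi> * X \<phi>))) (at \<phi> within ?I)"
        unfolding \<theta>_def[abs_def] using X_pos[OF \<phi>]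
        by (intro DERIV_add DERIV_ident DERIV_chain2[OF DERIV_arctan] DERIV_divide X'[OF \<phi>] Y'[OF \<phi>]) simp
      moreover have "1 + (Y \<phi> / X \<phi>)\<^sup>2 = ((X \<phi>)\<^sup>2 + (Y \<phi>)\<^sup>2) / (X \<phi> * X \<phi>)"
        using X_pos[OF \<phi>] by (simp add: field_simps power2_eq_square)
      then have "inverse (1 + (Y \<phi> / X \<phi>)\<^sup>2) * ((Y' \<phi> * X \<phi> - Y \<phi> * X' \<phi>) / (X \<phi> * X \<phi>))
          = (X \<phi> * Y' \<phi> - Y \<phi> * X' \<phi>) / ((X \<phi>)\<^sup>2 + (Y \<phi>)\<^sup>2)"
        using X_pos[OF \<phi>] by (simp add: mult.commute)
      ultimately show ?thesis by simp
    qed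
    show "\<theta> (2 * pi) = \<theta> 0 + 2 * pi"
      unfolding \<theta>_def X_def Y_def curve_x_def curve_y_def h(4) per by simp
    show "cov (polar (R \<phi>) (\<theta> \<phi>)) = \<kappa>" if "\<phi> \<in> ?I" for \<phi>
      unfolding point[OF that] \<kappa>_def using cov_wave_point[OF N s, of "h \<phi>" \<phi> \<delta>] h(2,3)[OF that] by simp
    show "(V has_real_derivative (R \<phi>)\<^sup>2 * (1 + (X \<phi> * Y' \<phi> - Y \<phi> * X' \<phi>) / ((X \<phi>)\<^sup>2 + (Y \<phi>)\<^sup>2)) / 2) (at \<phi> within ?I)"
      if \<phi>: "\<phi> \<in> ?I" for \<phi>
    proof -
      have "(V has_real_derivative (J \<phi> + W' \<phi>) / 2) (at \<phi> within ?I)"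
        unfolding V_def[abs_def] by (intro DERIV_cdivide DERIV_add G W' \<phi>)
      moreover have p: "0 < (X \<phi>)\<^sup>2 + (Y \<phi>)\<^sup>2" using X_pos[OF \<phi>] by (simp add: add_pos_nonneg)
      have "(R \<phi>)\<^sup>2 = (X \<phi>)\<^sup>2 + (Y \<phi>)\<^sup>2" unfolding R_def using p by simp
      then have "(R \<phi>)\<^sup>2 * (1 + (X \<phi> * Y' \<phi> - Y \<phi> * X' \<phi>) / ((X \<phi>)\<^sup>2 + (Y \<phi>)\<^sup>2)) = J \<phi> + W' \<phi>"
        using p by (simp add: distrib_left flip: key[OF \<phi>])
      ultimately show ?thesis by simp
    qed
  qed (use \<kappa> in auto)
  also have "V (2 * pi) - V 0 = (G (2 * pi) - G 0) / 2"
    unfolding V_def sweep_potential_def per by (simp add: diff_divide_distrib)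
  also have "(J has_integral (G (2 * pi) - G 0)) ?I"
    using G by (intro fundamental_theorem_of_calculus) (simp_all add: has_real_derivative_iff_has_vector_derivative)
  then have "G (2 * pi) - G 0 = integral ?I J" by (simp add: integral_unique)
  finally show ?thesis unfolding conv_body_wave[OF N(1) s] \<kappa>_def J_def .
qed

section \<open>The second variation of the area\<close>

text \<open>Two unit discs at distance \<open>2 cos h0\<close> overlap in the area \<open>\<delta> \<pi>\<close>.\<close>

lemma exists_half_angle:
  assumes "0 < \<delta>" "\<delta> < 1"
  obtains h0 where "0 < h0" "h0 < pi / 2" "2 * h0 - sin (2 * h0) = \<delta> * pi"
proof -
  have "\<exists>h\<ge>0. h \<le> pi / 2 \<and> 2 * h - sin (2 * h) = \<delta> * pi"
    by (rule IVT) (use assms in \<open>auto intro!: continuous_intros\<close>)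
  then obtain h where h: "0 \<le> h" "h \<le> pi / 2" "2 * h - sin (2 * h) = \<delta> * pi" by blast
  moreover have "h \<noteq> 0" using h(3) assms by auto
  moreover have "h \<noteq> pi / 2"
  proof
    assume "h = pi / 2"
    then have "2 * h = pi" by simp
    then have "\<delta> * pi = 1 * pi" using h(3) by (simp only: sin_pi)
    then show False using assms by simp
  qed
  ultimately show ?thesis using that[of h] by auto
qed

text \<open>The quotient on the right is \<open>S / (N \<sigma>\<^sup>2) - C c / \<sigma>\<close>, where \<open>N = 4 m\<close>, \<open>\<sigma>, c\<close> are sine and cosine of
\<open>h0\<close> and \<open>S, C\<close> those of \<open>N h0\<close>. If \<open>N h0\<close> is close to a multiple of \<open>\<pi>\<close>, then \<open>S\<close> is small and \<open>|C|\<close> is not.\<close>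

lemma exists_resonant_frequency:
  assumes h0: "0 < h0" "h0 < pi / 2"
  obtains m :: nat where "m \<ge> 1"
    "(sin (4 * real m * h0))\<^sup>2 < (level_coeff (4 * real m) \<delta> 1 h0 / level_coeff_d (4 * real m) 0 h0)\<^sup>2"
proof -
  define \<sigma> where "\<sigma> = sin h0"
  define c where "c = cos h0"
  have pos: "0 < \<sigma>" "0 < c" unfolding \<sigma>_def c_def using h0 by (auto intro: sin_gt_zero cos_gt_zero)
  have le1: "\<sigma> \<le> 1" "c \<le> 1" unfolding \<sigma>_def c_def by auto
  \<comment> \<open>with \<open>|S| < \<epsilon>\<close> and \<open>|C| \<ge> 1 / 2\<close>, the quotient exceeds \<open>4 \<epsilon> - \<epsilon>\<close> in absolute value\<close>
  define \<epsilon> where "\<epsilon> = \<sigma> * c / 8"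
  have "\<sigma> * c \<le> 1" using le1 pos by (simp add: mult_le_one)
  then have \<epsilon>: "0 < \<epsilon>" "\<epsilon> \<le> 1 / 8" unfolding \<epsilon>_def using pos by auto
  obtain K :: nat where K: "pi / \<epsilon> < real K" using reals_Archimedean2 by blast
  have "0 < pi / \<epsilon>" using \<epsilon> by simp
  then have "K > 0" using K by (cases K) auto
  obtain k j where kj: "0 < k" "\<bar>of_int k * (4 * h0 / pi) - of_int j\<bar> < 1 / real K"
    using Dirichlet_approx[OF \<open>K > 0\<close>] by metis
  define m where "m = nat k"
  have m: "m \<ge> 1" "real m = of_int k" using kj(1) by (auto simp: m_def)
  define t where "t = 4 * real m * h0 - of_int j * pi"
  have "t = pi * (of_int k * (4 * h0 / pi) - of_int j)"
    unfolding t_def m(2) by (simp add: field_simps)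
  then have "\<bar>t\<bar> = pi * \<bar>of_int k * (4 * h0 / pi) - of_int j\<bar>"
    by (simp only: abs_mult) simp
  also have "\<dots> < pi * (1 / real K)" using kj(2) by (intro mult_strict_left_mono) auto
  also have "\<dots> < \<epsilon>" using K \<open>K > 0\<close> \<epsilon> by (simp add: field_simps)
  finally have t: "\<bar>t\<bar> < \<epsilon>" .
  define S where "S = sin (4 * real m * h0)"
  define C where "C = cos (4 * real m * h0)"
  have "S = sin (t + of_int j * pi)" unfolding S_def t_def by simp
  then have "\<bar>S\<bar> = \<bar>sin t\<bar> * \<bar>cos (of_int j * pi)\<bar>" using sin_npi_int[of j]
    by (simp add: sin_add abs_mult mult.commute)
  also have "\<dots> \<le> \<bar>sin t\<bar> * 1" by (intro mult_left_mono) auto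
  also have "\<dots> \<le> \<bar>t\<bar>" by (simp add: abs_sin_x_le_abs_x)
  finally have S: "\<bar>S\<bar> < \<epsilon>" using t by simp
  have "1 / 4 \<le> C\<^sup>2"
  proof -
    have "S\<^sup>2 \<le> (1 / 8)\<^sup>2" using S \<epsilon> by (intro power2_le_iff_abs_le[THEN iffD2]) auto
    moreover have "S\<^sup>2 + C\<^sup>2 = 1" unfolding S_def C_def by simp
    ultimately show ?thesis by (simp add: power2_eq_square)
  qed
  then have C: "1 / 2 \<le> \<bar>C\<bar>" using abs_le_square_iff[of "1 / 2" C] by (simp add: power2_eq_square)
  define r where "r = level_coeff (4 * real m) \<delta> 1 h0 / level_coeff_d (4 * real m) 0 h0"
  have c2: "1 - cos (2 * h0) = 2 * \<sigma>\<^sup>2" unfolding \<sigma>_def cos_double_sin by simp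
  have "\<sigma>\<^sup>2 * r = S / (4 * real m) - C * \<sigma> * c"
  proof -
    have d0: "level_coeff_d (4 * real m) 0 h0 = 4 * \<sigma>\<^sup>2" using c2 by (simp add: level_coeff_d_def)
    have e1: "level_coeff (4 * real m) \<delta> 1 h0 = 4 * (S / (4 * real m) - C * \<sigma> * c)"
      unfolding level_coeff_def S_def C_def \<sigma>_def c_def sin_double by simp
    show ?thesis unfolding r_def d0 e1 using pos by simp
  qed
  moreover have "\<bar>C * \<sigma> * c\<bar> \<ge> 1 / 2 * (\<sigma> * c)"
    using mult_right_mono[OF C, of "\<sigma> * c"] pos by (simp add: abs_mult)
  moreover have "\<bar>S / (4 * real m)\<bar> \<le> \<bar>S\<bar>"
    using m(1) by (simp add: abs_divide divide_le_eq mult_le_cancel_left1)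
  ultimately have "\<bar>\<sigma>\<^sup>2 * r\<bar> \<ge> 4 * \<epsilon> - \<epsilon>" using S unfolding \<epsilon>_def by linarith
  moreover have "\<bar>\<sigma>\<^sup>2 * r\<bar> \<le> \<bar>r\<bar>"
    using le1 pos by (simp add: abs_mult mult_left_le_one_le power_le_one)
  ultimately have "\<bar>S\<bar> < \<bar>r\<bar>" using S \<epsilon> by linarith
  then have "S\<^sup>2 < r\<^sup>2" by (metis abs_ge_zero power2_abs power_strict_mono zero_less_numeral)
  then show ?thesis using that[OF m(1)] unfolding S_def r_def by blast
qed

text \<open>The algebra of the second variation: \<open>c, \<sigma>\<close> are cosine and sine of \<open>h0\<close>, \<open>C, S\<close> those of \<open>N h0\<close>, \<open>k\<close> is minus the amplitude of
the first-order change of \<open>h\<close>, and \<open>q\<close> is the quotient of the leading derivatives of area integrand and level.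
The terms of positive order in \<open>N\<close> cancel.\<close>

lemma second_variation_identity:
  fixes c \<sigma> C S N k q :: real
  assumes "c\<^sup>2 + \<sigma>\<^sup>2 = 1" "C\<^sup>2 + S\<^sup>2 = 1" "k * (N * \<sigma>\<^sup>2) = S - N * C * \<sigma> * c" "q * \<sigma> = - 2 * c"
  shows "2 * (1 + (c\<^sup>2 - \<sigma>\<^sup>2) * (C\<^sup>2 - S\<^sup>2) - N * (2 * S * C) * (2 * \<sigma> * c))
    - 2 * q * (\<sigma> * c * (2 * S\<^sup>2)) + q * ((8 * C * \<sigma>\<^sup>2 + 4 * N * S * \<sigma> * c) * k - (8 * \<sigma> * c) * k\<^sup>2 / 2)
    + (- 8 * (c\<^sup>2 - \<sigma>\<^sup>2)) * k\<^sup>2 / 2 - (- 8 * (2 * \<sigma> * c * C + N * (c\<^sup>2 - \<sigma>\<^sup>2) * S)) * k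
    = 4 * (c\<^sup>2 - S\<^sup>2 + k\<^sup>2)"
proof -
  have q: "q * (\<sigma> * x) = - 2 * c * x" for x using assms(4) by (metis mult.assoc)
  have "q * (\<sigma> * c * (2 * S\<^sup>2)) = - 4 * c\<^sup>2 * S\<^sup>2"
    using q[of "c * (2 * S\<^sup>2)"] by (simp add: algebra_simps power2_eq_square)
  moreover have "q * ((8 * C * \<sigma>\<^sup>2 + 4 * N * S * \<sigma> * c) * k - (8 * \<sigma> * c) * k\<^sup>2 / 2)
     = - 2 * c * ((8 * C * \<sigma> + 4 * N * S * c) * k - 4 * c * k\<^sup>2)"
    using q[of "(8 * C * \<sigma> + 4 * N * S * c) * k - 4 * c * k\<^sup>2"] by (simp add: algebra_simps power2_eq_square)
  ultimately show ?thesis using assms(1-3) by algebra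
qed

lemma trig_integrals:
  assumes N: "N = 4 * real m" "m \<ge> 1"
  shows "((\<lambda>\<phi>. \<alpha> + \<beta> * (harmonics N 1 \<phi>)\<^sup>2 + \<gamma> * harmonics N 2 \<phi>) has_integral pi * (2 * \<alpha> + \<beta>)) {0..2 * pi}"
    "((\<lambda>\<phi>. \<gamma> * harmonics N 1 \<phi>) has_integral 0) {0..2 * pi}"
proof -
  have N0: "N \<noteq> 0" using N by simp
  have per: "sin (N * (2 * pi)) = 0" "sin (2 * N * (2 * pi)) = 0"
    using sin_npi[of "8 * m"] sin_npi[of "16 * m"] N(1) by (simp_all add: mult.commute mult.left_commute)
  let ?F = "\<lambda>\<phi>. (\<alpha> + \<beta> / 2) * \<phi> + (\<beta> / 2 + \<gamma>) / (2 * N) * sin (2 * N * \<phi>)"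
  have "((\<lambda>\<phi>. \<alpha> + \<beta> / 2 + (\<beta> / 2 + \<gamma>) * cos (2 * N * \<phi>)) has_integral ?F (2 * pi) - ?F 0) {0..2 * pi}"
  proof (rule fundamental_theorem_of_calculus)
    fix x
    have "(?F has_real_derivative (\<alpha> + \<beta> / 2) * 1 + (\<beta> / 2 + \<gamma>) / (2 * N) * (cos (2 * N * x) * (2 * N))) (at x within {0..2 * pi})"
      by (rule DERIV_cong, (rule DERIV_add DERIV_cmult DERIV_chain2[OF DERIV_sin] DERIV_ident)+) simp
    then show "(?F has_vector_derivative \<alpha> + \<beta> / 2 + (\<beta> / 2 + \<gamma>) * cos (2 * N * x)) (at x within {0..2 * pi})"
      using N0 by (simp add: has_real_derivative_iff_has_vector_derivative)
  qed simp
  moreover have "\<alpha> + \<beta> / 2 + (\<beta> / 2 + \<gamma>) * cos (2 * N * \<phi>) = \<alpha> + \<beta> * (harmonics N 1 \<phi>)\<^sup>2 + \<gamma> * harmonics N 2 \<phi>" for \<phi>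
  proof -
    have sq: "(cos (N * \<phi>))\<^sup>2 = (1 + cos (2 * N * \<phi>)) / 2" using cos_double_cos[of "N * \<phi>"] by (simp add: mult.assoc)
    show ?thesis unfolding harmonics_def of_nat_numeral of_nat_1 mult_1_left sq by (simp add: field_simps)
  qed
  moreover have "?F (2 * pi) - ?F 0 = pi * (2 * \<alpha> + \<beta>)" unfolding per by (simp add: algebra_simps)
  ultimately show "((\<lambda>\<phi>. \<alpha> + \<beta> * (harmonics N 1 \<phi>)\<^sup>2 + \<gamma> * harmonics N 2 \<phi>) has_integral pi * (2 * \<alpha> + \<beta>)) {0..2 * pi}"
    by simp
  let ?G = "\<lambda>\<phi>. \<gamma> / N * sin (N * \<phi>)"
  have "((\<lambda>\<phi>. \<gamma> * cos (N * \<phi>)) has_integral ?G (2 * pi) - ?G 0) {0..2 * pi}"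
  proof (rule fundamental_theorem_of_calculus)
    fix x
    have "(?G has_real_derivative \<gamma> / N * (cos (N * x) * N)) (at x within {0..2 * pi})"
      by (rule DERIV_cong, (rule DERIV_cmult DERIV_chain2[OF DERIV_sin] DERIV_ident)+) simp
    then show "(?G has_vector_derivative \<gamma> * cos (N * x)) (at x within {0..2 * pi})"
      using N0 by (simp add: has_real_derivative_iff_has_vector_derivative)
  qed simp
  then show "((\<lambda>\<phi>. \<gamma> * harmonics N 1 \<phi>) has_integral 0) {0..2 * pi}"
    unfolding per by (simp add: harmonics_def)
qed

lemma level_phi_deriv:
  "\<exists>D. ((\<lambda>\<phi>. level N \<delta> \<phi> h s) has_real_derivative D) (at \<phi>)"
proof -
  have "\<exists>D. (harmonics N i has_real_derivative D) (at \<phi>)" for i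
    unfolding harmonics_def[abs_def] by (rule exI) (rule derivative_eq_intros refl)+
  then obtain d1 d2 where "(harmonics N 1 has_real_derivative d1) (at \<phi>)" "(harmonics N 2 has_real_derivative d2) (at \<phi>)"
    by metis
  then show ?thesis unfolding quad_def by (intro exI) (rule derivative_eq_intros refl | assumption)+
qed

lemma area_second_derivative:
  assumes N: "N = 4 * real m" "m \<ge> 1" and \<delta>: "0 < \<delta>"
    and h0: "0 < h0" "h0 < pi / 2" "2 * h0 - sin (2 * h0) = \<delta> * pi"
  defines "A \<equiv> \<lambda>s. measure lebesgue (conv_body \<delta> (star_body (wave N s)))"
    and "k \<equiv> level_coeff N \<delta> 1 h0 / level_coeff_d N 0 h0"
  shows "A 0 = 4 * pi * (cos h0)\<^sup>2"
    "\<exists>A'. (\<forall>\<^sub>F s in nhds 0. (A has_real_derivative A' s) (at s)) \<and> A' 0 = 0 \<and>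
      (A' has_real_derivative 4 * pi * ((cos h0)\<^sup>2 - (sin (N * h0))\<^sup>2 + k\<^sup>2)) (at 0)"
proof -
  have N2: "N > 2" "N \<noteq> 0" using N by auto
  let ?c = "harmonics N" and ?e = "level_coeff N \<delta>" and ?e' = "level_coeff_d N" and ?e'' = "level_coeff_dd N"
  let ?j = "area_coeff N" and ?j' = "area_coeff_d N" and ?j'' = "area_coeff_dd N"
  \<comment> \<open>a compact interval with \<open>{0..2 * pi}\<close> in its interior, so that \<open>H\<close> is differentiable in \<open>\<phi>\<close> at the end points\<close>
  define K where "K = {-1..(7::real)}"
  define \<eta>0 where "\<eta>0 = min (h0 / 2) ((pi / 2 - h0) / 2)"
  have \<eta>0: "0 < \<eta>0" "\<And>h. \<bar>h - h0\<bar> \<le> \<eta>0 \<Longrightarrow> 0 < h \<and> h < pi / 2"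
    using h0 unfolding \<eta>0_def by (auto simp: abs_le_iff min_def split: if_splits)
  have coeff_cont: "continuous_on UNIV (?e i)" "continuous_on UNIV (?e' i)" for i
    using level_coeff_deriv[OF N2(2)] level_coeff_deriv2 by (meson DERIV_isCont continuous_at_imp_continuous_on)+
  note cq = continuous_on_quad(1)[OF coeff_dd_continuous(3)]
  have e0: "?e 0 h0 = 0" using h0 by (simp add: level_coeff_def)
  have "cos (2 * h0) < 1" using h0 cos_monotone_0_pi[of 0 "2 * h0"] by simp
  then have e0': "0 < ?e' 0 h0" by (simp add: level_coeff_d_def)
  obtain \<sigma> \<eta> H where \<sigma>: "0 < \<sigma>" and \<eta>: "0 < \<eta>" "\<eta> \<le> \<eta>0"
    and Epos: "\<And>\<phi> h s. \<phi> \<in> K \<Longrightarrow> \<bar>s\<bar> \<le> \<sigma> \<Longrightarrow> \<bar>h - h0\<bar> \<le> \<eta> \<Longrightarrow> 0 < quad ?c ?e' \<phi> h s"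
    and H: "\<And>\<phi> s. \<phi> \<in> K \<Longrightarrow> \<bar>s\<bar> \<le> \<sigma> \<Longrightarrow> \<bar>H \<phi> s - h0\<bar> \<le> \<eta> \<and> quad ?c ?e \<phi> (H \<phi> s) s = 0"
    and uniq: "\<And>\<phi> h s. \<phi> \<in> K \<Longrightarrow> \<bar>s\<bar> \<le> \<sigma> \<Longrightarrow> \<bar>h - h0\<bar> \<le> \<eta> \<Longrightarrow> quad ?c ?e \<phi> h s = 0 \<Longrightarrow> h = H \<phi> s"
    and Hcont: "continuous_on (K \<times> {-\<sigma>..\<sigma>}) (\<lambda>(\<phi>, s). H \<phi> s)"
  proof (rule implicit_function_exists[where K = K and E = "quad ?c ?e" and Eh = "quad ?c ?e'" and ?h0.0 = h0 and ?\<eta>0.0 = \<eta>0])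
    show "continuous_on UNIV (\<lambda>(\<phi>, h, s). quad ?c ?e \<phi> h s)" "continuous_on UNIV (\<lambda>(\<phi>, h, s). quad ?c ?e' \<phi> h s)"
      unfolding case_prod_beta by (intro cq coeff_cont continuous_intros)+
    show "((\<lambda>h. quad ?c ?e \<phi> h s) has_real_derivative quad ?c ?e' \<phi> h s) (at h)" for \<phi> h s
      by (rule quad_deriv_h[OF level_coeff_deriv[OF N2(2)]])
  qed (use e0 e0' \<eta>0(1) in \<open>auto simp: quad_def K_def\<close>)
  \<comment> \<open>for \<open>|s| \<le> \<sigma>'\<close> the perturbed disc is also convex\<close>
  define \<sigma>' where "\<sigma>' = min \<sigma> (1 / (2 * (1 + N\<^sup>2)))"
  have pN: "0 < 1 + N\<^sup>2" by (simp add: add_pos_nonneg)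
  have \<sigma>': "0 < \<sigma>'" "\<sigma>' \<le> \<sigma>" unfolding \<sigma>'_def using \<sigma> pN by auto
  have small: "\<bar>s\<bar> * (1 + N\<^sup>2) < 1" if "\<bar>s\<bar> \<le> \<sigma>'" for s
  proof -
    have "\<bar>s\<bar> \<le> 1 / (2 * (1 + N\<^sup>2))" using that unfolding \<sigma>'_def by simp
    then have "\<bar>s\<bar> * (1 + N\<^sup>2) \<le> 1 / (2 * (1 + N\<^sup>2)) * (1 + N\<^sup>2)" using pN by (intro mult_right_mono) auto
    also have "\<dots> = 1 / 2" using pN by simp
    finally show ?thesis by simp
  qed
  have "2 * pi < 7" using pi_less_4 pi_approx by simp
  then have sub: "{0..2 * pi} \<subseteq> K" "{0..2 * pi} \<subseteq> interior K" unfolding K_def by (auto simp: interior_atLeastAtMost_real)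
  have H0: "H \<phi> 0 = h0" if "\<phi> \<in> K" for \<phi>
    using uniq[OF that, of 0 h0] \<sigma> \<eta> e0 by (simp add: quad_def)
  have Hphi: "\<exists>D. ((\<lambda>\<phi>. H \<phi> s) has_real_derivative D) (at \<phi>)" if \<phi>: "\<phi> \<in> interior K" and s: "\<bar>s\<bar> \<le> \<sigma>" for \<phi> s
  proof -
    obtain d where d: "((\<lambda>\<tau>. quad ?c ?e \<tau> (H \<phi> s) s) has_real_derivative d) (at \<phi>)"
      using level_phi_deriv by blast
    have \<phi>K: "\<phi> \<in> K" using \<phi> interior_subset by blast
    have "((\<lambda>\<phi>. H \<phi> s) has_real_derivative - d / quad ?c ?e' \<phi> (H \<phi> s) s) (at \<phi>)"
    proof (rule implicit_has_derivative[where E = "\<lambda>\<phi> h. quad ?c ?e \<phi> h s" and Eh = "\<lambda>\<phi> h. quad ?c ?e' \<phi> h s"])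
      have "\<forall>\<^sub>F \<tau> in nhds \<phi>. \<tau> \<in> interior K" using \<phi> by (intro eventually_nhds_in_open) auto
      then show "\<forall>\<^sub>F \<tau> in nhds \<phi>. quad ?c ?e \<tau> (H \<tau> s) s = 0"
        by eventually_elim (use H s interior_subset in blast)
      show "isCont (\<lambda>\<phi>. H \<phi> s) \<phi>" by (rule isCont_section(2)[OF Hcont \<phi> s])
      show "((\<lambda>\<tau>. quad ?c ?e \<tau> (H \<phi> s) s) has_real_derivative d) (at \<phi>)" by (rule d)
      show "((\<lambda>h. quad ?c ?e \<tau> h s) has_real_derivative quad ?c ?e' \<tau> h s) (at h)" for \<tau> h
        by (rule quad_deriv_h[OF level_coeff_deriv[OF N2(2)]])
      show "continuous_on UNIV (\<lambda>(\<tau>, h). quad ?c ?e' \<tau> h s)"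
        unfolding case_prod_beta by (intro cq coeff_cont continuous_intros)
      show "quad ?c ?e' \<phi> (H \<phi> s) s \<noteq> 0" using Epos[OF \<phi>K s] H[OF \<phi>K s] by fastforce
    qed
    then show ?thesis by blast
  qed
  have per: "harmonics N i (2 * pi) = harmonics N i 0" for i
    using cos_npi[of "8 * m * i"] N(1) by (simp add: harmonics_def mult.commute mult.left_commute)
  have K2: "0 \<in> K" "2 * pi \<in> K" using sub by auto
  have A_eq: "A s = integral {0..2 * pi} (\<lambda>\<phi>. quad ?c ?j \<phi> (H \<phi> s) s) / 2" if s: "\<bar>s\<bar> \<le> \<sigma>'" for s
    unfolding A_def
  proof (rule measure_conv_body_wave[OF N small[OF s] \<delta>])
    have s': "\<bar>s\<bar> \<le> \<sigma>" using s \<sigma>' by simp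
    show "\<exists>D. ((\<lambda>\<phi>. H \<phi> s) has_real_derivative D) (at \<phi>)" if "\<phi> \<in> {0..2 * pi}" for \<phi>
      using Hphi s' that sub by blast
    show "0 < H \<phi> s \<and> H \<phi> s < pi / 2" "level N \<delta> \<phi> (H \<phi> s) s = 0" if "\<phi> \<in> {0..2 * pi}" for \<phi>
      using H[of \<phi> s] s' that sub \<eta>(2) \<eta>0(2)[of "H \<phi> s"] by auto
    have "quad ?c ?e (2 * pi) (H 0 s) s = quad ?c ?e 0 (H 0 s) s" unfolding quad_def per ..
    then show "H (2 * pi) s = H 0 s"
      using uniq[OF K2(2) s', of "H 0 s"] H[OF K2(1) s'] by simp
  qed
  define h1 where "h1 \<phi> = - (?c 1 \<phi> * ?e 1 h0) / ?e' 0 h0" for \<phi>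
  define h2 where "h2 \<phi> = - (quad_ss ?c ?e \<phi> h0 + 2 * (?c 1 \<phi> * ?e' 1 h0) * h1 \<phi> + ?e'' 0 h0 * (h1 \<phi>)\<^sup>2) / ?e' 0 h0" for \<phi>
  have "\<exists>B. (\<forall>s. \<bar>s\<bar> < \<sigma> \<longrightarrow> ((\<lambda>s. integral {0..2 * pi} (\<lambda>\<phi>. quad ?c ?j \<phi> (H \<phi> s) s)) has_real_derivative B s) (at s))
    \<and> B 0 = integral {0..2 * pi} (\<lambda>\<phi>. ?j' 0 h0 * h1 \<phi> + ?c 1 \<phi> * ?j 1 h0)
    \<and> (B has_real_derivative integral {0..2 * pi} (\<lambda>\<phi>. ?j' 0 h0 * h2 \<phi> + ?j'' 0 h0 * (h1 \<phi>)\<^sup>2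
         + 2 * (?c 1 \<phi> * ?j' 1 h0) * h1 \<phi> + quad_ss ?c ?j \<phi> h0)) (at 0)"
    unfolding h2_def h1_def
  proof (rule integral_along_implicit[OF coeff_dd_continuous(3) level_coeff_deriv[OF N2(2)] level_coeff_deriv2 coeff_dd_continuous(1)
        area_coeff_deriv[OF N2(1)] area_coeff_deriv2 coeff_dd_continuous(2) \<sigma>])
    show "quad ?c ?e \<phi> (H \<phi> s) s = 0" "0 < quad ?c ?e' \<phi> (H \<phi> s) s" if "\<phi> \<in> {0..2 * pi}" "\<bar>s\<bar> \<le> \<sigma>" for \<phi> s
      using H[of \<phi> s] Epos[of \<phi> s "H \<phi> s"] that sub by auto
    show "continuous_on ({0..2 * pi} \<times> {-\<sigma>..\<sigma>}) (\<lambda>(\<phi>, s). H \<phi> s)"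
      by (rule continuous_on_subset[OF Hcont]) (use sub in auto)
    show "H \<phi> 0 = h0" if "\<phi> \<in> {0..2 * pi}" for \<phi> using H0 that sub by auto
  qed
  then obtain B where B: "\<And>s. \<bar>s\<bar> < \<sigma> \<Longrightarrow> ((\<lambda>s. integral {0..2 * pi} (\<lambda>\<phi>. quad ?c ?j \<phi> (H \<phi> s) s)) has_real_derivative B s) (at s)"
    and B0: "B 0 = integral {0..2 * pi} (\<lambda>\<phi>. ?j' 0 h0 * h1 \<phi> + ?c 1 \<phi> * ?j 1 h0)"
    and B': "(B has_real_derivative integral {0..2 * pi} (\<lambda>\<phi>. ?j' 0 h0 * h2 \<phi> + ?j'' 0 h0 * (h1 \<phi>)\<^sup>2
         + 2 * (?c 1 \<phi> * ?j' 1 h0) * h1 \<phi> + quad_ss ?c ?j \<phi> h0)) (at 0)" by blast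
  have h1: "h1 \<phi> = - k * ?c 1 \<phi>" for \<phi> unfolding h1_def k_def by simp
  define q where "q = ?j' 0 h0 / ?e' 0 h0"
  have B0': "B 0 = 0"
  proof -
    have "(\<lambda>\<phi>. ?j' 0 h0 * h1 \<phi> + ?c 1 \<phi> * ?j 1 h0) = (\<lambda>\<phi>. (?j 1 h0 - ?j' 0 h0 * k) * ?c 1 \<phi>)"
      unfolding h1 by (simp add: algebra_simps)
    with B0 have "B 0 = integral {0..2 * pi} (\<lambda>\<phi>. (?j 1 h0 - ?j' 0 h0 * k) * ?c 1 \<phi>)" by (simp only:)
    also have "\<dots> = 0" by (rule integral_unique[OF trig_integrals(2)[OF N]])
    finally show ?thesis .
  qed
  define \<alpha> where "\<alpha> = 2 * ?j 2 h0 - 2 * q * ?e 2 h0"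
  define \<beta> where "\<beta> = q * (2 * ?e' 1 h0 * k - ?e'' 0 h0 * k\<^sup>2) + ?j'' 0 h0 * k\<^sup>2 - 2 * ?j' 1 h0 * k"
  define \<gamma> where "\<gamma> = 2 * ?j 3 h0 - 2 * q * ?e 3 h0"
  have jq: "?j' 0 h0 * h2 \<phi> = - q * (quad_ss ?c ?e \<phi> h0 + 2 * (?c 1 \<phi> * ?e' 1 h0) * h1 \<phi> + ?e'' 0 h0 * (h1 \<phi>)\<^sup>2)" for \<phi>
    unfolding h2_def q_def
    by (simp only: times_divide_eq_right times_divide_eq_left mult_minus_left mult_minus_right minus_divide_left)
  have "(\<lambda>\<phi>. ?j' 0 h0 * h2 \<phi> + ?j'' 0 h0 * (h1 \<phi>)\<^sup>2 + 2 * (?c 1 \<phi> * ?j' 1 h0) * h1 \<phi> + quad_ss ?c ?j \<phi> h0)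
     = (\<lambda>\<phi>. \<alpha> + \<beta> * (?c 1 \<phi>)\<^sup>2 + \<gamma> * ?c 2 \<phi>)"
    unfolding jq h1 \<alpha>_def \<beta>_def \<gamma>_def quad_ss_def by (simp add: fun_eq_iff algebra_simps power2_eq_square)
  then have B'': "(B has_real_derivative pi * (2 * \<alpha> + \<beta>)) (at 0)"
    using B' trig_integrals(1)[OF N, of \<alpha> \<beta> \<gamma>] by (simp add: integral_unique)
  have val: "pi * (2 * \<alpha> + \<beta>) / 2 = 4 * pi * ((cos h0)\<^sup>2 - (sin (N * h0))\<^sup>2 + k\<^sup>2)"
  proof -
    let ?c = "cos h0" and ?s = "sin h0" and ?C = "cos (N * h0)" and ?S = "sin (N * h0)"
    have d: "cos (2 * h0) = ?c\<^sup>2 - ?s\<^sup>2" "sin (2 * h0) = 2 * ?s * ?c"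
      "cos (2 * N * h0) = ?C\<^sup>2 - ?S\<^sup>2" "sin (2 * N * h0) = 2 * ?S * ?C"
      using cos_double[of h0] sin_double[of h0] cos_double[of "N * h0"] sin_double[of "N * h0"]
      by (simp_all add: mult.assoc)
    have one: "?c\<^sup>2 + ?s\<^sup>2 = 1" "?C\<^sup>2 + ?S\<^sup>2 = 1" by simp_all
    have s0: "?s \<noteq> 0" using h0 sin_gt_zero[of h0] by simp
    have ed: "?e' 0 h0 = 4 * ?s\<^sup>2"
    proof -
      have "?e' 0 h0 = 2 - 2 * (?c\<^sup>2 - ?s\<^sup>2)" unfolding level_coeff_d_def d by simp
      then show ?thesis using one(1) by algebra
    qed
    have e1: "?e 1 h0 = 4 * (?S / N - ?C * ?s * ?c)" unfolding level_coeff_def d by simp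
    have kN: "k * (N * ?s\<^sup>2) = ?S - N * ?C * ?s * ?c"
      unfolding k_def ed e1 using s0 N2 by (simp add: field_simps)
    have qs: "q * ?s = - 2 * ?c"
      unfolding q_def ed using s0 by (simp add: area_coeff_d_def d power2_eq_square)
    have e2: "?e 2 h0 = ?s * ?c * (2 * ?S\<^sup>2)"
    proof -
      have "?e 2 h0 = (2 * h0 - \<delta> * pi) / 2 - (?C\<^sup>2 - ?S\<^sup>2) * (2 * ?s * ?c) / 2"
        unfolding level_coeff_def d by simp
      also have "2 * h0 - \<delta> * pi = 2 * ?s * ?c" using h0(3) unfolding d by linarith
      finally show ?thesis using one(2) by algebra
    qed
    have e1': "?e' 1 h0 = 8 * ?C * ?s\<^sup>2 + 4 * N * ?S * ?s * ?c"
    proof -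
      have "?e' 1 h0 = 4 * ?C + 2 * N * ?S * (2 * ?s * ?c) - 4 * ?C * (?c\<^sup>2 - ?s\<^sup>2)"
        unfolding level_coeff_d_def d by simp
      then show ?thesis using one(1) by algebra
    qed
    have "2 * \<alpha> + \<beta> = 2 * (2 * ?j 2 h0 - 2 * q * ?e 2 h0 + q * (?e' 1 h0 * k - ?e'' 0 h0 * k\<^sup>2 / 2)
        + ?j'' 0 h0 * k\<^sup>2 / 2 - ?j' 1 h0 * k)"
      unfolding \<alpha>_def \<beta>_def by (simp add: algebra_simps)
    also have "2 * ?j 2 h0 - 2 * q * ?e 2 h0 + q * (?e' 1 h0 * k - ?e'' 0 h0 * k\<^sup>2 / 2)
        + ?j'' 0 h0 * k\<^sup>2 / 2 - ?j' 1 h0 * k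
      = 2 * (1 + (?c\<^sup>2 - ?s\<^sup>2) * (?C\<^sup>2 - ?S\<^sup>2) - N * (2 * ?S * ?C) * (2 * ?s * ?c))
    - 2 * q * (?s * ?c * (2 * ?S\<^sup>2)) + q * ((8 * ?C * ?s\<^sup>2 + 4 * N * ?S * ?s * ?c) * k - (8 * ?s * ?c) * k\<^sup>2 / 2)
    + (- 8 * (?c\<^sup>2 - ?s\<^sup>2)) * k\<^sup>2 / 2 - (- 8 * (2 * ?s * ?c * ?C + N * (?c\<^sup>2 - ?s\<^sup>2) * ?S)) * k"
      unfolding e2 e1' by (simp add: area_coeff_def area_coeff_d_def area_coeff_dd_def level_coeff_dd_def d)
    also have "\<dots> = 4 * (?c\<^sup>2 - ?S\<^sup>2 + k\<^sup>2)" by (rule second_variation_identity[OF one kN qs])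
    finally show ?thesis by simp
  qed
  have near: "\<forall>\<^sub>F s in nhds 0. \<bar>s\<bar> < \<sigma>'"
    using eventually_nhds_in_open[of "{-\<sigma>'<..<\<sigma>'}" 0] \<sigma>'(1) by (auto elim!: eventually_mono)
  have derA: "(A has_real_derivative B s / 2) (at s)" if s: "\<bar>s\<bar> < \<sigma>'" for s
  proof -
    have der: "((\<lambda>s. integral {0..2 * pi} (\<lambda>\<phi>. quad ?c ?j \<phi> (H \<phi> s) s) / 2) has_real_derivative B s / 2) (at s)"
      using B[of s] s \<sigma>' by (intro DERIV_cdivide) auto
    have "\<forall>\<^sub>F t in nhds s. \<bar>t\<bar> < \<sigma>'"
      using eventually_nhds_in_open[of "{-\<sigma>'<..<\<sigma>'}" s] s by (auto elim!: eventually_mono simp: abs_less_iff)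
    then have ev: "\<forall>\<^sub>F t in nhds s. A t = integral {0..2 * pi} (\<lambda>\<phi>. quad ?c ?j \<phi> (H \<phi> t) t) / 2"
      by eventually_elim (use A_eq in auto)
    from DERIV_cong_ev[OF refl this refl] show ?thesis using der by (rule iffD2)
  qed
  show "\<exists>A'. (\<forall>\<^sub>F s in nhds 0. (A has_real_derivative A' s) (at s)) \<and> A' 0 = 0 \<and>
      (A' has_real_derivative 4 * pi * ((cos h0)\<^sup>2 - (sin (N * h0))\<^sup>2 + k\<^sup>2)) (at 0)"
  proof (intro exI[of _ "\<lambda>s. B s / 2"] conjI)
    show "\<forall>\<^sub>F s in nhds 0. (A has_real_derivative B s / 2) (at s)"
      using near by eventually_elim (rule derA)
    show "((\<lambda>s. B s / 2) has_real_derivative 4 * pi * ((cos h0)\<^sup>2 - (sin (N * h0))\<^sup>2 + k\<^sup>2)) (at 0)"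
      using DERIV_cdivide[OF B'', of 2] unfolding val .
  qed (simp add: B0')
  have "integral {0..2 * pi} (\<lambda>\<phi>. quad ?c ?j \<phi> (H \<phi> 0) 0) = integral {0..2 * pi} (\<lambda>\<phi>. ?j 0 h0)"
    by (rule integral_cong) (use H0 sub in \<open>auto simp: quad_def\<close>)
  then have "A 0 = integral {0..2 * pi} (\<lambda>\<phi>. ?j 0 h0) / 2"
    using A_eq[of 0] \<sigma>'(1) by simp
  also have "\<dots> = pi * ?j 0 h0" by simp
  finally show "A 0 = 4 * pi * (cos h0)\<^sup>2"
    unfolding area_coeff_def cos_double_cos by (simp add: algebra_simps)
qed

section \<open>Normalization and the conclusion\<close>

lemma measure_scale: "measure lebesgue ((\<lambda>x. c *\<^sub>R x) ` S) = c\<^sup>2 * measure lebesgue (S :: (real^2) set)"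
  using measure_lebesgue_affine[of c 0 S] by simp

lemma measure_conv_body_scale:
  assumes "c \<noteq> 0"
  shows "measure lebesgue (conv_body \<delta> ((\<lambda>x. c *\<^sub>R x) ` L)) = c\<^sup>2 * measure lebesgue (conv_body \<delta> L)"
proof -
  let ?f = "\<lambda>x :: real^2. c *\<^sub>R x"
  have inj: "inj ?f" using assms by (auto intro: injI)
  have "?f ` L \<inter> (\<lambda>y. y + ?f z) ` ?f ` L = ?f ` (L \<inter> (\<lambda>y. y + z) ` L)" for z
    unfolding image_Int[OF inj] by (simp add: image_image scaleR_add_right)
  then have iff: "?f z \<in> conv_body \<delta> (?f ` L) \<longleftrightarrow> z \<in> conv_body \<delta> L" for z
    using assms unfolding conv_body_def by (simp add: measure_scale)
  have "conv_body \<delta> (?f ` L) = ?f ` conv_body \<delta> L"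
  proof (intro equalityI subsetI)
    fix x assume x: "x \<in> conv_body \<delta> (?f ` L)"
    have "x = ?f (x /\<^sub>R c)" using assms by simp
    then show "x \<in> ?f ` conv_body \<delta> L" using x iff by (metis imageI)
  qed (use iff in blast)
  then show ?thesis by (simp add: measure_scale)
qed

text \<open>The relative area of the convolution body is invariant under scaling.\<close>

lemma measure_conv_body_normalized:
  assumes "c > 0" "measure lebesgue L > 0"
  shows "measure lebesgue (conv_body \<delta> (normalized ((\<lambda>x. c *\<^sub>R x) ` L)))
    = measure lebesgue (conv_body \<delta> L) / measure lebesgue L"
proof -
  define d where "d = c / sqrt (c\<^sup>2 * measure lebesgue L)"
  have "normalized ((\<lambda>x. c *\<^sub>R x) ` L) = (\<lambda>x. d *\<^sub>R x) ` L"
    unfolding normalized_def measure_scale d_def by (simp add: image_image divide_inverse mult.commute)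
  moreover have "d \<noteq> 0" "d\<^sup>2 = 1 / measure lebesgue L"
    using assms by (simp_all add: d_def power_divide)
  ultimately show ?thesis by (simp add: measure_conv_body_scale)
qed

lemma perturbed_disc_eq:
  assumes N: "N = 4 * real m" and t: "\<bar>t\<bar> < 1" and s: "s = t / (2 + t)" "\<bar>s\<bar> * (1 + N\<^sup>2) < 1"
  shows "perturbed_disc (K_cos m) t = (\<lambda>x. (1 + t / 2) *\<^sub>R x) ` star_body (wave N s)"
proof -
  interpret polar_convex "wave N s" "\<lambda>v. - s * N * sin (N * v)" "\<lambda>v. - s * N\<^sup>2 * cos (N * v)"
    by (rule wave_polar_convex[OF N s(2)])
  let ?a = "1 + t / 2"
  have a: "0 < ?a" using t by auto
  have radial: "1 + t * (cos (2 * real m * v))\<^sup>2 = ?a * wave N s v" for v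
  proof -
    have "(cos (2 * real m * v))\<^sup>2 = (1 + cos (N * v)) / 2"
      using cos_double_cos[of "2 * real m * v"] N by (simp add: mult.assoc)
    moreover have "?a * s = t / 2" using t by (simp add: s(1) field_simps)
    then have "?a * wave N s v = ?a + t / 2 * cos (N * v)" unfolding wave_def by (simp add: distrib_left mult.assoc[symmetric])
    ultimately show ?thesis by (simp add: field_simps)
  qed
  have mem: "x \<in> perturbed_disc (K_cos m) t \<longleftrightarrow> x /\<^sub>R ?a \<in> star_body (wave N s)" for x
  proof (cases "x = 0")
    case True
    then show ?thesis using pos[of 0] by (auto simp: perturbed_disc_def radial_set_of_def star_body_def intro!: exI[of _ 0] less_imp_le)
  next
    case False
    then obtain v where v: "0 \<le> v" "v < 0 + 2 * pi" "x = polar (norm x) v" using polar_exists by metis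
    have u: "x /\<^sub>R norm x = vector [cos v, sin v]"
      using False by (subst v(3)) (simp add: polar_def)
    have sph: "x /\<^sub>R norm x \<in> sphere 0 1" using False by simp
    have "x \<in> perturbed_disc (K_cos m) t \<longleftrightarrow> norm x \<le> 1 + t * (cos (2 * real m * v))\<^sup>2"
      unfolding perturbed_disc_def radial_set_of_def
      using False radial_function_K_cos[OF sph, of m] angle_unit[of v] v(1,2) by (simp add: u)
    also have "\<dots> \<longleftrightarrow> norm x / ?a \<le> wave N s v"
      unfolding radial using a by (simp add: pos_divide_le_eq mult.commute)
    also have "\<dots> \<longleftrightarrow> polar (norm x / ?a) v \<in> star_body (wave N s)"
      using a False by (intro polar_mem_iff[symmetric]) simp
    also have "polar (norm x / ?a) v = inverse ?a *\<^sub>R polar (norm x) v"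
      unfolding polar_scale by (rule arg_cong[where f = "\<lambda>r. polar r v"]) (metis divide_inverse mult.commute)
    also have "\<dots> = x /\<^sub>R ?a" using v(3) by (rule arg_cong[symmetric])
    finally show ?thesis .
  qed
  show ?thesis
  proof (intro equalityI subsetI)
    fix x assume "x \<in> perturbed_disc (K_cos m) t"
    then have "x /\<^sub>R ?a \<in> star_body (wave N s)" using mem by simp
    then have "?a *\<^sub>R (x /\<^sub>R ?a) \<in> (\<lambda>x. ?a *\<^sub>R x) ` star_body (wave N s)" by blast
    then show "x \<in> (\<lambda>x. ?a *\<^sub>R x) ` star_body (wave N s)" using a by simp
  next
    fix x assume "x \<in> (\<lambda>x. ?a *\<^sub>R x) ` star_body (wave N s)"
    then obtain z where z: "x = ?a *\<^sub>R z" "z \<in> star_body (wave N s)" by blast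
    have "x /\<^sub>R ?a = z" unfolding z(1) using a by simp
    then show "x \<in> perturbed_disc (K_cos m) t" using mem[of x] z(2) by (simp only:)
  qed
qed

theorem theorem1p8:
  fixes \<delta> :: real
  assumes "0 < \<delta>" and "\<delta> < 1"
  shows "\<exists>m::nat. m \<ge> 1 \<and>
    (\<exists>F' D.
      (\<forall>\<^sub>F t in nhds 0.
        ((\<lambda>s. measure lebesgue (conv_body \<delta> (normalized (perturbed_disc (K_cos m) s))))
          has_real_derivative F' t) (at t)) \<and>
      (F' has_real_derivative D) (at 0) \<and>
      D > 0)"
proof -
  obtain h0 where h0: "0 < h0" "h0 < pi / 2" "2 * h0 - sin (2 * h0) = \<delta> * pi"
    using exists_half_angle[OF assms] .
  obtain m :: nat where m: "m \<ge> 1" and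
    freq: "(sin (4 * real m * h0))\<^sup>2 < (level_coeff (4 * real m) \<delta> 1 h0 / level_coeff_d (4 * real m) 0 h0)\<^sup>2"
    using exists_resonant_frequency[OF h0(1,2)] .
  define N where "N = 4 * real m"
  define k where "k = level_coeff N \<delta> 1 h0 / level_coeff_d N 0 h0"
  define A where "A s = measure lebesgue (conv_body \<delta> (star_body (wave N s)))" for s
  define F where "F t = measure lebesgue (conv_body \<delta> (normalized (perturbed_disc (K_cos m) t)))" for t
  have A0: "A 0 = 4 * pi * (cos h0)\<^sup>2"
    using area_second_derivative(1)[OF N_def m assms(1) h0] unfolding A_def .
  obtain A' where A': "\<forall>\<^sub>F s in nhds 0. (A has_real_derivative A' s) (at s)" "A' 0 = 0"
    "(A' has_real_derivative 4 * pi * ((cos h0)\<^sup>2 - (sin (N * h0))\<^sup>2 + k\<^sup>2)) (at 0)"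
    using area_second_derivative(2)[OF N_def m assms(1) h0] unfolding A_def[abs_def] k_def by blast
  define \<sigma> where "\<sigma> t = t / (2 + t)" for t :: real
  define q where "q s = pi * (1 + s\<^sup>2 / 2)" for s :: real
  have q: "0 < q s" for s unfolding q_def by (simp add: add_pos_nonneg)
  have q': "(q has_real_derivative pi * s) (at s)" for s
    unfolding q_def[abs_def] by (auto intro!: derivative_eq_intros)
  have \<sigma>': "(\<sigma> has_real_derivative 2 / (2 + t)\<^sup>2) (at t)" if "\<bar>t\<bar> < 1" for t
    unfolding \<sigma>_def[abs_def] using that
    by (auto intro!: derivative_eq_intros simp: power2_eq_square divide_simps)
  have near1: "\<forall>\<^sub>F t in nhds (0::real). \<bar>t\<bar> < 1"
    using eventually_nhds_in_open[of "{-1<..<1::real}" 0] by (auto elim!: eventually_mono)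
  have "isCont \<sigma> 0" using \<sigma>'[of 0] by (auto intro: DERIV_isCont)
  then have lim: "filterlim \<sigma> (nhds 0) (nhds 0)"
    unfolding isCont_def by (simp add: \<sigma>_def tendsto_nhds_iff)
  have "\<forall>\<^sub>F s in nhds (0::real). \<bar>s\<bar> * (1 + N\<^sup>2) < 1"
  proof -
    have "open {s::real. \<bar>s\<bar> * (1 + N\<^sup>2) < 1}" by (intro open_Collect_less continuous_intros)
    then show ?thesis using eventually_nhds_in_open[of "{s::real. \<bar>s\<bar> * (1 + N\<^sup>2) < 1}" 0] by simp
  qed
  from eventually_compose_filterlim[OF this lim] have small: "\<forall>\<^sub>F t in nhds 0. \<bar>\<sigma> t\<bar> * (1 + N\<^sup>2) < 1" .
  have F_eq: "\<forall>\<^sub>F t in nhds 0. F t = A (\<sigma> t) / q (\<sigma> t)"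
    using near1 small
  proof eventually_elim
    case (elim t)
    have "measure lebesgue (star_body (wave N (\<sigma> t))) = q (\<sigma> t)"
      unfolding q_def by (rule measure_wave_body[OF N_def m elim(2)])
    then show ?case
      unfolding F_def perturbed_disc_eq[OF N_def elim(1) \<sigma>_def[of t] elim(2)] A_def
      using elim(1) q[of "\<sigma> t"] by (subst measure_conv_body_normalized) auto
  qed
  define F' where "F' t = (A' (\<sigma> t) * q (\<sigma> t) - A (\<sigma> t) * (pi * \<sigma> t)) / (q (\<sigma> t) * q (\<sigma> t)) * (2 / (2 + t)\<^sup>2)" for t
  have dF: "\<forall>\<^sub>F t in nhds 0. (F has_real_derivative F' t) (at t)"
    using eventually_eventually[THEN iffD2, OF F_eq] near1 eventually_compose_filterlim[OF A'(1) lim]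
  proof eventually_elim
    case (elim t)
    have "((\<lambda>t. A (\<sigma> t) / q (\<sigma> t)) has_real_derivative F' t) (at t)"
      unfolding F'_def
      by (rule DERIV_chain2[where f = "\<lambda>s. A s / q s"], rule DERIV_divide[OF elim(3) q'])
         (use q[of "\<sigma> t"] \<sigma>'[OF elim(2)] in auto)
    with DERIV_cong_ev[OF refl elim(1) refl] show ?case by (rule iffD2)
  qed
  define D where "D = k\<^sup>2 - (sin (N * h0))\<^sup>2"
  have "(F' has_real_derivative D) (at 0)"
  proof -
    have \<sigma>0: "\<sigma> 0 = 0" by (simp add: \<sigma>_def)
    have d\<sigma>: "(\<sigma> has_real_derivative 1 / 2) (at 0)" using \<sigma>'[of 0] by simp
    have dA: "(A has_real_derivative 0) (at 0)"
      using eventually_nhds_x_imp_x[OF A'(1)] A'(2) by simp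
    let ?a = "4 * pi * ((cos h0)\<^sup>2 - (sin (N * h0))\<^sup>2 + k\<^sup>2)"
    have num: "((\<lambda>s. A' s * q s - A s * (pi * s)) has_real_derivative ?a * pi - A 0 * pi) (at 0)"
      by (rule DERIV_cong, rule DERIV_diff, rule DERIV_mult[OF A'(3) q'], rule DERIV_mult[OF dA], rule DERIV_cmult_Id)
         (simp add: A'(2) q_def)
    have den: "((\<lambda>s. q s * q s) has_real_derivative 0) (at 0)"
      by (rule DERIV_cong, rule DERIV_mult[OF q' q']) simp
    have "((\<lambda>s. (A' s * q s - A s * (pi * s)) / (q s * q s)) has_real_derivative 4 * (k\<^sup>2 - (sin (N * h0))\<^sup>2)) (at 0)"
      by (rule DERIV_cong, rule DERIV_divide[OF num den])
         (use q[of 0] in \<open>simp_all add: A'(2) A0 q_def field_simps\<close>)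
    then have "((\<lambda>s. (A' s * q s - A s * (pi * s)) / (q s * q s)) has_real_derivative 4 * (k\<^sup>2 - (sin (N * h0))\<^sup>2)) (at (\<sigma> 0))"
      unfolding \<sigma>0 .
    from DERIV_chain2[OF this d\<sigma>]
    have "((\<lambda>t. (A' (\<sigma> t) * q (\<sigma> t) - A (\<sigma> t) * (pi * \<sigma> t)) / (q (\<sigma> t) * q (\<sigma> t))) has_real_derivative
        4 * (k\<^sup>2 - (sin (N * h0))\<^sup>2) * (1 / 2)) (at 0)" .
    moreover have "((\<lambda>t::real. 2 / (2 + t)\<^sup>2) has_real_derivative - 1 / 2) (at 0)"
      by (auto intro!: derivative_eq_intros simp: power2_eq_square)
    ultimately show ?thesis unfolding F'_def[abs_def]
      by (rule DERIV_cong[OF DERIV_mult]) (simp add: \<sigma>0 A'(2) D_def)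
  qed
  moreover have "D > 0" using freq unfolding D_def k_def N_def by simp
  ultimately show ?thesis using m dF unfolding F_def[abs_def] by blast
qed

end
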